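(* Let $0<\delta<0.1$ be fixed. There exists $q_0(\delta)$ such that the following holds. Let $q\ge q_{0}(\delta)$ be an integer, let $d=\prod_{p\mid q}p$ be the kernel of $q$, put $$\gamma_{1}=1200\,\delta^{-2}\bigl(\log(1/\delta)\bigr)^{2/3},\qquad \gamma=201^{-4}\,\delta^{6}\bigl(\log(1/\delta)\bigr)^{-2},$$ and let $N$ be an integer with $$\max\bigl(d^{\,2+\delta},\,e^{\gamma_{1}(\log q)^{2/3}}\bigr)\le N\le q^{\delta/20}.$$ Then for any integers $a,b,c$ with $(a,q)=1$, $$\Bigl|\sum_{\substack{c<n\le c+N\\ (n,q)=1}} e^{2\pi i (a n^{*}+bn)/q}\Bigr|<N\exp\Bigl(-\gamma\,\frac{(\log N)^{3}}{(\log q)^{2}}\Bigr),$$ where for $(n,q)=1$, $n^{*}$ denotes an integer with $nn^{*}\equiv 1\pmod q$.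
   Context: The summation runs over integers $n$ in the interval $c<n\le c+N$ coprime to $q$; the value does not depend on the choice of the inverse $n^{*}$ modulo $q$. $\log$ is the natural logarithm. *)

theory Defs
  imports
    Complex_Main
    "HOL-Computational_Algebra.Primes"
    "HOL-Number_Theory.Modular_Inverse"
begin

definition squarefree_kernel :: "nat \<Rightarrow> nat" where
  "squarefree_kernel q = (\<Prod>p\<in>prime_factors q. p)"

definition gamma1 :: "real \<Rightarrow> real" where
  "gamma1 \<delta> = 1200 * \<delta> powi (-2) * ln (1 / \<delta>) powr (2 / 3)"

definition gamma0 :: "real \<Rightarrow> real" where
  "gamma0 \<delta> = 201 powi (-4) * \<delta> ^ 6 * ln (1 / \<delta>) powi (-2)"

definition kloosterman_term :: "nat \<Rightarrow> int \<Rightarrow> int \<Rightarrow> int \<Rightarrow> int \<Rightarrow> complex" where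
  "kloosterman_term q a b n m =
     exp (2 * complex_of_real pi * \<i> * of_int (a * m + b * n) / of_nat q)"

definition kloosterman_sum :: "nat \<Rightarrow> int \<Rightarrow> int \<Rightarrow> int \<Rightarrow> int \<Rightarrow> complex" where
  "kloosterman_sum q a b c N =
     (\<Sum>n | n \<in> {c<..c + N} \<and> coprime n (int q).
        kloosterman_term q a b n (modular_inverse (int q) n))"

text \<open>
  The library's representative of the inverse of \<open>n\<close> modulo \<open>q\<close> may be replaced by any other
  integer inverse.
\<close>

lemma kloosterman_term_cong:
  assumes "q > 0" "[m = m'] (mod int q)"
  shows "kloosterman_term q a b n m = kloosterman_term q a b n m'"
proof -
  obtain k where k: "m = m' + int q * k"
    using assms(2) by (metis cong_iff_lin cong_sym)
  have "2 * complex_of_real pi * \<i> * of_int (a * m + b * n) / of_nat q =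
        2 * complex_of_real pi * \<i> * of_int (a * m' + b * n) / of_nat q
          + \<i> * complex_of_real (2 * pi * of_int (a * k))"
    using assms(1) by (simp add: k field_simps)
  moreover have "exp (\<i> * complex_of_real (2 * pi * of_int (a * k))) = 1"
    unfolding cis_conv_exp[symmetric] by (rule cis_multiple_2pi) auto
  ultimately show ?thesis
    by (simp only: kloosterman_term_def exp_add mult_1_right)
qed

lemma kloosterman_sum_any_inverse:
  assumes "q > 0"
    and "\<And>n. coprime n (int q) \<Longrightarrow> [n * star n = 1] (mod int q)"
  shows "kloosterman_sum q a b c N =
           (\<Sum>n | n \<in> {c<..c + N} \<and> coprime n (int q). kloosterman_term q a b n (star n))"
  unfolding kloosterman_sum_def
proof (rule sum.cong)
  fix n assume "n \<in> {n. n \<in> {c<..c + N} \<and> coprime n (int q)}"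
  then have cop: "coprime n (int q)"
    by simp
  have "[n * modular_inverse (int q) n = n * star n] (mod int q)"
    using cong_modular_inverse1[OF cop] assms(2)[OF cop] by (metis cong_sym cong_trans)
  then have "[modular_inverse (int q) n = star n] (mod int q)"
    using cop by (simp add: cong_mult_lcancel)
  then show "kloosterman_term q a b n (modular_inverse (int q) n) =
             kloosterman_term q a b n (star n)"
    by (rule kloosterman_term_cong[OF assms(1)])
qed simp

end

theory Submission
  imports
    Defs
    "HOL-Analysis.Convex"
    "HOL-Library.FuncSet"
    "HOL-Computational_Algebra.Formal_Power_Series"
begin

text \<open>
  Choose \<open>q1\<close> with \<open>q dvd q1 ^ s\<close> and \<open>q1 \<le> d * q powr (1 / s)\<close>, where \<open>s\<close> is about
  \<open>4 * ln q / (\<delta> * ln N)\<close>. Replacing \<open>n\<close> by \<open>n + q1 * x * y\<close> with \<open>x, y < P\<close> barely changes the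
  sum, and the geometric series for the inverse of \<open>n + q1 * x * y\<close> modulo \<open>q\<close> stops at degree
  \<open>K = s - 1\<close>. For fixed \<open>n\<close> this leaves a double sum over \<open>x, y\<close> whose phase is a polynomial in
  \<open>x * y\<close> of degree \<open>K\<close>. Two applications of Hoelder's inequality bound it by Vinogradov's mean
  value and by one bilinear sum for each degree \<open>k\<close>. The coefficient of degree \<open>k\<close> has denominator
  between \<open>q powr (1 - k / s) / d ^ k\<close> and \<open>q powr (1 - k / s)\<close>. Since \<open>N \<ge> d powr (2 + \<delta>)\<close>, this
  denominator lies well inside the interval from \<open>1\<close> to \<open>P ^ (2 * k)\<close> for a window of about
  \<open>ln q / ln N * \<delta>\<close> degrees, and each of them saves a power of \<open>N\<close>.

  The mean value is bounded by Linnik's method with the single prime \<open>p > K ^ 4\<close> and \<open>P = p ^ m\<close>: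
  power sums up to order \<open>K\<close> modulo a power of \<open>p\<close> determine \<open>K\<close> integers with distinct residues
  modulo \<open>p\<close> up to order.
\<close>

section \<open>Exponential sums over solution sets\<close>

text \<open>The product \<open>x * y\<close> is essential: after both Hoelder steps the coefficient
  of degree \<open>k\<close> multiplies a product of two integers of size up to
  \<open>b * P ^ k\<close>, \<open>b\<close> being half the number of variables in the mean value.
  Enlarging their ranges to full boxes decouples the degrees, so each denominator is exploited by
  itself. The mean value must lose almost nothing. Its excess exponent shrinks by the factor
  \<open>1 - 1 / K\<close> with each block of \<open>K\<close> variables, so about
  \<open>9 * L * K\<close> blocks, \<open>L = ln (1 / \<delta>)\<close>, reduce it by
  \<open>\<delta> ^ 9\<close>. Then \<open>b\<close> has order \<open>L * K ^ 2\<close>, and a root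
  of order \<open>4 * b ^ 2\<close> must be extracted. With
  \<open>A = ln q / (\<delta> * ln N)\<close> and \<open>K\<close> about \<open>4 * A\<close>, the
  total saving, of order \<open>\<delta> ^ 4 * A ^ 2 * ln N\<close>, becomes
  \<open>\<delta> ^ 4 * ln N / (L * A) ^ 2\<close>: this is the shape of \<open>gamma0\<close>. The
  condition with \<open>gamma1\<close> makes the saving dominate the constant-factor losses of the
  mean value bound.\<close>

lemma weighted_power_mean:
  fixes c x :: "'a \<Rightarrow> real"
  assumes c: "\<And>i. i \<in> I \<Longrightarrow> 0 \<le> c i" and x: "\<And>i. i \<in> I \<Longrightarrow> 0 \<le> x i"
  shows "(\<Sum>i\<in>I. c i * x i) ^ Suc n \<le> (\<Sum>i\<in>I. c i) ^ n * (\<Sum>i\<in>I. c i * x i ^ Suc n)"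
proof (induction n)
  case 0
  show ?case by simp
next
  case (Suc n)
  \<comment> \<open>Chebyshev's sum inequality: \<open>x\<close> and \<open>x ^ Suc n\<close> are
    ordered alike, so the weighted double sum of products of differences is nonnegative, and
    expanding it gives the claim.\<close>
  have cheb: "(\<Sum>i\<in>I. c i * x i ^ Suc n) * (\<Sum>i\<in>I. c i * x i)
      \<le> (\<Sum>i\<in>I. c i) * (\<Sum>i\<in>I. c i * x i ^ Suc (Suc n))"
  proof -
    have "0 \<le> (\<Sum>i\<in>I. \<Sum>j\<in>I. c i * c j * ((x i ^ Suc n - x j ^ Suc n) * (x i - x j)))"
    proof (intro sum_nonneg)
      fix i j assume ij: "i \<in> I" "j \<in> I"
      have "0 \<le> (x i ^ Suc n - x j ^ Suc n) * (x i - x j)"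
      proof (cases "x i \<le> x j")
        case True
        then have "x i ^ Suc n \<le> x j ^ Suc n" using x ij by (intro power_mono) auto
        then show ?thesis using True by (intro mult_nonpos_nonpos) auto
      next
        case False
        then have "x j ^ Suc n \<le> x i ^ Suc n" using x ij by (intro power_mono) auto
        then show ?thesis using False by (intro mult_nonneg_nonneg) auto
      qed
      then show "0 \<le> c i * c j * ((x i ^ Suc n - x j ^ Suc n) * (x i - x j))"
        using c[OF ij(1)] c[OF ij(2)] by (metis mult_nonneg_nonneg)
    qed
    also have "\<dots> = (\<Sum>i\<in>I. \<Sum>j\<in>I. c j * (c i * x i ^ Suc (Suc n)) - (c i * x i ^ Suc n) * (c j * x j)
                   - (c j * x j ^ Suc n) * (c i * x i) + c i * (c j * x j ^ Suc (Suc n)))"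
      by (intro sum.cong refl) (simp add: algebra_simps)
    also have "\<dots> = 2 * ((\<Sum>i\<in>I. c i) * (\<Sum>i\<in>I. c i * x i ^ Suc (Suc n)))
                   - 2 * ((\<Sum>i\<in>I. c i * x i ^ Suc n) * (\<Sum>i\<in>I. c i * x i))"
      by (simp only: sum.distrib sum_subtractf sum_distrib_left[symmetric] sum_distrib_right[symmetric])
    finally show ?thesis by simp
  qed
  have "(\<Sum>i\<in>I. c i * x i) ^ Suc (Suc n) = (\<Sum>i\<in>I. c i * x i) ^ Suc n * (\<Sum>i\<in>I. c i * x i)"
    by simp
  also have "\<dots> \<le> (\<Sum>i\<in>I. c i) ^ n * (\<Sum>i\<in>I. c i * x i ^ Suc n) * (\<Sum>i\<in>I. c i * x i)"
    by (intro mult_right_mono Suc sum_nonneg mult_nonneg_nonneg c x)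
  also have "\<dots> \<le> (\<Sum>i\<in>I. c i) ^ n * ((\<Sum>i\<in>I. c i) * (\<Sum>i\<in>I. c i * x i ^ Suc (Suc n)))"
    unfolding mult.assoc by (intro mult_left_mono cheb zero_le_power sum_nonneg c)
  finally show ?case by (simp add: mult_ac)
qed

lemma power_mean_card:
  fixes x :: "'a \<Rightarrow> real"
  assumes "\<And>i. i \<in> I \<Longrightarrow> 0 \<le> x i" "n > 0"
  shows "(\<Sum>i\<in>I. x i) ^ n \<le> real (card I) ^ (n - 1) * (\<Sum>i\<in>I. x i ^ n)"
  using weighted_power_mean[of I "\<lambda>_. 1" x "n - 1"] assms by simp

lemma cis_sum: "cis (sum f I) = (\<Prod>i\<in>I. cis (f i))"
  by (induction I rule: infinite_finite_induct) (simp_all add: cis_mult[symmetric])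

lemma cis_2pi_int: "cis (2 * pi * of_int k) = 1"
  by (rule cis_multiple_2pi) auto

text \<open>The index type is arbitrary, so that single integers (\<open>h = power\<close>) and
  tuples (\<open>h = pow_sums I\<close>) are treated alike.\<close>

definition expsum :: "nat \<Rightarrow> (nat \<Rightarrow> real) \<Rightarrow> ('a \<Rightarrow> nat \<Rightarrow> int) \<Rightarrow> 'a set \<Rightarrow> complex" where
  "expsum K t h G = (\<Sum>g\<in>G. cis (2 * pi * (\<Sum>j=1..K. t j * of_int (h g j))))"

text \<open>For \<open>h = pow_sums I\<close> on a box and \<open>l = 0\<close> this counts the
  solutions of Vinogradov's system. General \<open>l\<close> occurs because fixing some variables
  leaves an inhomogeneous system for the others.\<close>

definition diffcount :: "nat \<Rightarrow> ('a \<Rightarrow> nat \<Rightarrow> int) \<Rightarrow> 'a set \<Rightarrow> (nat \<Rightarrow> int) \<Rightarrow> nat" where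
  "diffcount K h G l = card {(g, g'). g \<in> G \<and> g' \<in> G \<and> (\<forall>j\<in>{1..K}. h g j - h g' j = l j)}"

abbreviation energy :: "nat \<Rightarrow> ('a \<Rightarrow> nat \<Rightarrow> int) \<Rightarrow> 'a set \<Rightarrow> nat" where
  "energy K h G \<equiv> diffcount K h G (\<lambda>_. 0)"

lemma sum_cis_period:
  fixes l :: int
  assumes "Q > 0"
  shows "(\<Sum>a<Q. cis (2 * pi * (real a / real Q * of_int l))) = (if int Q dvd l then of_nat Q else 0)"
proof (cases "int Q dvd l")
  case True
  then obtain k where k: "l = int Q * k" by auto
  have "cis (2 * pi * (real a / real Q * of_int l)) = 1" for a
    using cis_2pi_int[of "int a * k"] assms by (simp add: k)
  then show ?thesis using True by simp
next
  case False
  define w where "w = cis (2 * pi * (of_int l / real Q))"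
  have pw: "cis (2 * pi * (real a / real Q * of_int l)) = w ^ a" for a
    unfolding w_def Complex.DeMoivre by (simp add: field_simps)
  have "w ^ Q = 1"
    using cis_2pi_int[of l] assms unfolding w_def Complex.DeMoivre by (simp add: field_simps)
  moreover have "w \<noteq> 1"
  proof
    assume "w = 1"
    then have "sin (2 * pi * (of_int l / real Q)) = 0 \<and> cos (2 * pi * (of_int l / real Q)) = 1"
      by (auto simp: w_def complex_eq_iff)
    then obtain n :: int where "2 * pi * (of_int l / real Q) = of_int n * 2 * pi"
      using cos_one_2pi_int by auto
    then have "of_int l = real_of_int n * real Q"
      using assms by (simp add: field_simps)
    then have "l = n * int Q" by (metis of_int_eq_iff of_int_mult of_int_of_nat_eq)
    then show False using False by simp
  qed
  ultimately show ?thesis using False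
    by (simp only: pw) (simp add: geometric_sum)
qed

lemma orthogonality:
  fixes l :: "nat \<Rightarrow> int"
  assumes "Q > 0"
  shows "(\<Sum>\<theta>\<in>PiE {1..K} (\<lambda>_. {..<Q}). cis (2 * pi * (\<Sum>j=1..K. real (\<theta> j) / real Q * of_int (l j))))
       = (if \<forall>j\<in>{1..K}. int Q dvd l j then of_nat Q ^ K else 0)"
proof -
  have "(\<Sum>\<theta>\<in>PiE {1..K} (\<lambda>_. {..<Q}). cis (2 * pi * (\<Sum>j=1..K. real (\<theta> j) / real Q * of_int (l j))))
      = (\<Sum>\<theta>\<in>PiE {1..K} (\<lambda>_. {..<Q}). \<Prod>j\<in>{1..K}. cis (2 * pi * (real (\<theta> j) / real Q * of_int (l j))))"
    by (simp only: sum_distrib_left cis_sum)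
  also have "\<dots> = (\<Prod>j\<in>{1..K}. \<Sum>a<Q. cis (2 * pi * (real a / real Q * of_int (l j))))"
    by (rule prod_sum_PiE[symmetric]) auto
  also have "\<dots> = (\<Prod>j\<in>{1..K}. if int Q dvd l j then of_nat Q else 0)"
    by (simp only: sum_cis_period[OF assms])
  also have "\<dots> = (if \<forall>j\<in>{1..K}. int Q dvd l j then of_nat Q ^ K else 0)"
    by (auto intro!: prod_zero)
  finally show ?thesis .
qed

lemma expsum_norm_square:
  "complex_of_real ((cmod (expsum K t h G))\<^sup>2)
    = (\<Sum>(g, g')\<in>G \<times> G. cis (2 * pi * (\<Sum>j=1..K. t j * of_int (h g j - h g' j))))"
proof -
  have "complex_of_real ((cmod (expsum K t h G))\<^sup>2) = expsum K t h G * cnj (expsum K t h G)"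
    by (rule complex_norm_square)
  also have "\<dots> = (\<Sum>g\<in>G. \<Sum>g'\<in>G. cis (2 * pi * (\<Sum>j=1..K. t j * of_int (h g j)))
       * cis (- (2 * pi * (\<Sum>j=1..K. t j * of_int (h g' j)))))"
    by (simp add: expsum_def cis_cnj sum_product)
  also have "\<dots> = (\<Sum>g\<in>G. \<Sum>g'\<in>G. cis (2 * pi * (\<Sum>j=1..K. t j * of_int (h g j - h g' j))))"
    by (intro sum.cong refl) (simp add: cis_mult sum_subtractf ring_distribs)
  finally show ?thesis by (simp add: sum.cartesian_product)
qed

text \<open>A finite grid of frequencies \<open>a / Q\<close> replaces the integral over the torus.
  Once \<open>Q\<close> exceeds all the integers \<open>h g j - h g' j - l j\<close> in absolute
  value, divisibility by \<open>Q\<close> means vanishing and the average is exact. The "eventually"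
  form lets one grid serve several counts at once.\<close>

lemma diffcount_Fourier:
  assumes "finite G"
  shows "\<forall>\<^sub>F Q in sequentially. (\<Sum>\<theta>\<in>PiE {1..K} (\<lambda>_. {..<Q}).
           complex_of_real ((cmod (expsum K (\<lambda>j. real (\<theta> j) / real Q) h G))\<^sup>2)
             * cis (- (2 * pi * (\<Sum>j=1..K. real (\<theta> j) / real Q * of_int (l j)))))
         = of_nat Q ^ K * of_nat (diffcount K h G l)"
proof -
  define B where "B = (\<Sum>x\<in>G \<times> G. \<Sum>j=1..K. \<bar>h (fst x) j - h (snd x) j - l j\<bar>)"
  have B: "\<bar>h g j - h g' j - l j\<bar> \<le> B" if "g \<in> G" "g' \<in> G" "j \<in> {1..K}" for g g' j
  proof -
    have "\<bar>h g j - h g' j - l j\<bar> \<le> (\<Sum>j=1..K. \<bar>h g j - h g' j - l j\<bar>)"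
      using that by (intro member_le_sum) auto
    also have "\<dots> \<le> B"
      using member_le_sum[of "(g, g')" "G \<times> G" "\<lambda>x. \<Sum>j=1..K. \<bar>h (fst x) j - h (snd x) j - l j\<bar>"] that assms
      by (simp add: B_def sum_nonneg)
    finally show ?thesis .
  qed
  show ?thesis
  proof (rule eventually_sequentiallyI[of "nat B + 1"])
    fix Q assume Q: "nat B + 1 \<le> Q"
    then have Q0: "Q > 0" by simp
    have iff: "(\<forall>j\<in>{1..K}. int Q dvd h g j - h g' j - l j) \<longleftrightarrow> (\<forall>j\<in>{1..K}. h g j - h g' j = l j)"
      if "g \<in> G" "g' \<in> G" for g g'
    proof (intro ball_cong refl)
      fix j assume j: "j \<in> {1..K}"
      have "\<bar>h g j - h g' j - l j\<bar> < int Q" using B[OF that j] Q by linarith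
      then show "(int Q dvd h g j - h g' j - l j) \<longleftrightarrow> (h g j - h g' j = l j)"
        using zdvd_imp_le[of "int Q" "\<bar>h g j - h g' j - l j\<bar>"] by auto
    qed
    have "(\<Sum>\<theta>\<in>PiE {1..K} (\<lambda>_. {..<Q}).
           complex_of_real ((cmod (expsum K (\<lambda>j. real (\<theta> j) / real Q) h G))\<^sup>2)
             * cis (- (2 * pi * (\<Sum>j=1..K. real (\<theta> j) / real Q * of_int (l j)))))
       = (\<Sum>\<theta>\<in>PiE {1..K} (\<lambda>_. {..<Q}). \<Sum>(g, g')\<in>G \<times> G.
            cis (2 * pi * (\<Sum>j=1..K. real (\<theta> j) / real Q * of_int (h g j - h g' j - l j))))"
      unfolding expsum_norm_square sum_distrib_right
      by (intro sum.cong refl)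
         (simp add: case_prod_unfold cis_mult sum_subtractf ring_distribs diff_divide_distrib)
    also have "\<dots> = (\<Sum>(g, g')\<in>G \<times> G. \<Sum>\<theta>\<in>PiE {1..K} (\<lambda>_. {..<Q}).
            cis (2 * pi * (\<Sum>j=1..K. real (\<theta> j) / real Q * of_int (h g j - h g' j - l j))))"
      by (subst sum.swap) (simp add: case_prod_unfold)
    also have "\<dots> = (\<Sum>(g, g')\<in>G \<times> G. if \<forall>j\<in>{1..K}. h g j - h g' j = l j then of_nat Q ^ K else 0)"
      by (intro sum.cong refl) (clarsimp simp only: orthogonality[OF Q0] iff split: prod.splits)
    also have "\<dots> = (\<Sum>x\<in>{x \<in> G \<times> G. \<forall>j\<in>{1..K}. h (fst x) j - h (snd x) j = l j}. of_nat Q ^ K)"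
      using assms by (subst sum.inter_filter) (auto simp: case_prod_unfold)
    also have "\<dots> = of_nat Q ^ K * of_nat (diffcount K h G l)"
      unfolding diffcount_def by (simp add: case_prod_unfold mem_Times_iff conj_assoc)
    finally show "(\<Sum>\<theta>\<in>PiE {1..K} (\<lambda>_. {..<Q}).
           complex_of_real ((cmod (expsum K (\<lambda>j. real (\<theta> j) / real Q) h G))\<^sup>2)
             * cis (- (2 * pi * (\<Sum>j=1..K. real (\<theta> j) / real Q * of_int (l j)))))
       = of_nat Q ^ K * of_nat (diffcount K h G l)" .
  qed
qed

lemma energy_Fourier:
  assumes "finite G"
  shows "\<forall>\<^sub>F Q in sequentially. (\<Sum>\<theta>\<in>PiE {1..K} (\<lambda>_. {..<Q}).
           (cmod (expsum K (\<lambda>j. real (\<theta> j) / real Q) h G))\<^sup>2) = real Q ^ K * real (energy K h G)"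
  using diffcount_Fourier[OF assms, of K h "\<lambda>_. 0"]
proof eventually_elim
  case (elim Q)
  then have "complex_of_real (\<Sum>\<theta>\<in>PiE {1..K} (\<lambda>_. {..<Q}).
           (cmod (expsum K (\<lambda>j. real (\<theta> j) / real Q) h G))\<^sup>2) = complex_of_real (real Q ^ K * real (energy K h G))"
    by simp
  then show ?case by (simp only: of_real_eq_iff)
qed

text \<open>The count for \<open>l\<close> is a Fourier coefficient of the squared modulus of the
  exponential sum, a nonnegative function whose mean is the energy.\<close>

lemma diffcount_le_energy:
  assumes "finite G"
  shows "diffcount K h G l \<le> energy K h G"
proof -
  have "\<forall>\<^sub>F Q in sequentially. diffcount K h G l \<le> energy K h G"
    using diffcount_Fourier[OF assms, of K h l] energy_Fourier[OF assms, of K h] eventually_gt_at_top[of 0]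
  proof eventually_elim
    case (elim Q)
    have "real Q ^ K * real (diffcount K h G l) = cmod (of_nat Q ^ K * of_nat (diffcount K h G l))"
      by (simp add: norm_mult norm_power)
    also have "\<dots> \<le> (\<Sum>\<theta>\<in>PiE {1..K} (\<lambda>_. {..<Q}).
           (cmod (expsum K (\<lambda>j. real (\<theta> j) / real Q) h G))\<^sup>2)"
      unfolding elim(1)[symmetric] by (rule sum_norm_le) (simp add: norm_mult norm_power)
    also have "\<dots> = real Q ^ K * real (energy K h G)" by (rule elim(2))
    finally show ?case using elim(3) by simp
  qed
  then show ?thesis by simp
qed

text \<open>Averaging over the dual group turns a pointwise inequality between exponential sums into an
  inequality between the numbers of solutions of the underlying systems of equations.\<close>

lemma energy_le_sum_energy:
  assumes "finite G" "finite I" "\<And>i. i \<in> I \<Longrightarrow> finite (H i)"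
    and le: "\<And>t. (cmod (expsum K t h G))\<^sup>2 \<le> a * (\<Sum>i\<in>I. (cmod (expsum K t (h' i) (H i)))\<^sup>2)"
  shows "real (energy K h G) \<le> a * (\<Sum>i\<in>I. real (energy K (h' i) (H i)))"
proof -
  have "\<forall>\<^sub>F Q in sequentially. \<forall>i\<in>I. (\<Sum>\<theta>\<in>PiE {1..K} (\<lambda>_. {..<Q}).
           (cmod (expsum K (\<lambda>j. real (\<theta> j) / real Q) (h' i) (H i)))\<^sup>2) = real Q ^ K * real (energy K (h' i) (H i))"
    using assms by (intro eventually_ball_finite ballI energy_Fourier) auto
  then have "\<forall>\<^sub>F Q in sequentially. real (energy K h G) \<le> a * (\<Sum>i\<in>I. real (energy K (h' i) (H i)))"
    using energy_Fourier[OF assms(1), of K h] eventually_gt_at_top[of 0]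
  proof eventually_elim
    case (elim Q)
    have "real Q ^ K * real (energy K h G) = (\<Sum>\<theta>\<in>PiE {1..K} (\<lambda>_. {..<Q}).
           (cmod (expsum K (\<lambda>j. real (\<theta> j) / real Q) h G))\<^sup>2)"
      by (rule elim(2)[symmetric])
    also have "\<dots> \<le> (\<Sum>\<theta>\<in>PiE {1..K} (\<lambda>_. {..<Q}). a * (\<Sum>i\<in>I.
           (cmod (expsum K (\<lambda>j. real (\<theta> j) / real Q) (h' i) (H i)))\<^sup>2))"
      by (intro sum_mono le)
    also have "\<dots> = a * (\<Sum>i\<in>I. \<Sum>\<theta>\<in>PiE {1..K} (\<lambda>_. {..<Q}).
           (cmod (expsum K (\<lambda>j. real (\<theta> j) / real Q) (h' i) (H i)))\<^sup>2)"
      by (subst sum.swap) (simp add: sum_distrib_left)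
    also have "\<dots> = a * (\<Sum>i\<in>I. real Q ^ K * real (energy K (h' i) (H i)))"
      using elim(1) by simp
    also have "\<dots> = real Q ^ K * (a * (\<Sum>i\<in>I. real (energy K (h' i) (H i))))"
      by (simp add: sum_distrib_left mult_ac)
    finally show ?case using elim(3) by simp
  qed
  then show ?thesis by simp
qed

section \<open>A prime between \<open>M\<close> and \<open>M ^ 2\<close>\<close>

text \<open>The Leibniz harmonic triangle: the numbers \<open>L(n, k) = (n + 1) * (n choose k)\<close> satisfy
  \<open>1 / L(n + 1, k + 1) = 1 / L(n, k) - 1 / L(n + 1, k)\<close>.\<close>

lemma leibniz_dvd_Lcm:
  assumes "k \<le> n"
  shows "Suc n * (n choose k) dvd Lcm {1..Suc n}"
proof -
  \<comment> \<open>The least common multiple is replaced by any common multiple \<open>D\<close>: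
    the recurrence refers to the previous row, whose own least common multiple may be
    smaller.\<close>
  have "real D / real (Suc n * (n choose k)) \<in> \<int>" if "k \<le> n" "\<forall>i\<in>{1..Suc n}. i dvd D" for D
    using that
  proof (induction k arbitrary: n)
    case 0
    then have "Suc n dvd D" by simp
    then obtain c where c: "D = Suc n * c" by (elim dvdE)
    have "real D / real (Suc n * (n choose 0)) = real c" unfolding c of_nat_mult by simp
    then show ?case by simp
  next
    case (Suc k)
    then obtain m where m: "n = Suc m" "k \<le> m" by (cases n) auto
    have pos: "real (m choose k) > 0" using m by simp
    have 1: "real (Suc k) * real (Suc m choose Suc k) = real (Suc m) * real (m choose k)"
      using Suc_times_binomial[of k m] by (metis of_nat_mult)
    have "(Suc m - k) * (Suc m choose k) = Suc m * (m choose k)"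
      using binomial_absorb_comp[of "Suc m" k] by simp
    then have 2: "(real (Suc m) - real k) * real (Suc m choose k) = real (Suc m) * real (m choose k)"
      using m by (metis le_SucI of_nat_diff of_nat_mult)
    have c1: "real (Suc m choose Suc k) = real (Suc m) * real (m choose k) / real (Suc k)"
      using 1 by (simp add: field_simps)
    have c2: "real (Suc m choose k) = real (Suc m) * real (m choose k) / (real (Suc m) - real k)"
      using 2 m by (simp add: field_simps)
    \<comment> \<open>The triangle recurrence as an identity of fractions, with
      \<open>x = m + 1\<close>, \<open>y = k + 1\<close>, \<open>B = (m choose k)\<close> and the
      two neighbouring binomials expressed through \<open>B\<close>.\<close>
    have gen: "A / ((x + 1) * (x * B / y)) = A / (x * B) - A / ((x + 1) * (x * B / (x - (y - 1))))"
      if "x > 0" "B > 0" "y > 0" "x - (y - 1) > 0" for A B x y :: real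
    proof -
      have "A / (x * B) - A / ((x + 1) * (x * B / z)) = A / (x * B) * (1 - z / (x + 1))" if "z > 0" for z
        by (simp add: right_diff_distrib mult_ac)
      then have "A / (x * B) - A / ((x + 1) * (x * B / (x - (y - 1)))) = A / (x * B) * (1 - (x - (y - 1)) / (x + 1))"
        using that by blast
      also have "1 - (x - (y - 1)) / (x + 1) = y / (x + 1)" using that by (simp add: field_simps)
      also have "A / (x * B) * (y / (x + 1)) = A / ((x + 1) * (x * B / y))" by simp
      finally show ?thesis by simp
    qed
    have "real D / real (Suc (Suc m) * (Suc m choose Suc k))
        = real D / real (Suc m * (m choose k)) - real D / real (Suc (Suc m) * (Suc m choose k))"
      using gen[of "real (Suc m)" "real (m choose k)" "real (Suc k)" "real D"] pos m(2)
      by (simp only: of_nat_mult c1 c2) (simp add: algebra_simps)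
    moreover have "real D / real (Suc m * (m choose k)) \<in> \<int>"
      using Suc.prems m by (intro Suc.IH) auto
    moreover have "real D / real (Suc (Suc m) * (Suc m choose k)) \<in> \<int>"
      using Suc.prems m by (intro Suc.IH) auto
    ultimately show ?case unfolding m(1) by (simp only: Ints_diff)
  qed
  from this[OF assms, of "Lcm {1..Suc n}"]
  have "real (Lcm {1..Suc n}) / real (Suc n * (n choose k)) \<in> \<int>" by auto
  then obtain z :: int where "real (Lcm {1..Suc n}) / real (Suc n * (n choose k)) = of_int z"
    by (elim Ints_cases)
  moreover have "real (Suc n * (n choose k)) > 0" using assms unfolding of_nat_0_less_iff by simp
  ultimately have "real (Lcm {1..Suc n}) = of_int z * real (Suc n * (n choose k))"
    by (metis less_irrefl nonzero_eq_divide_eq)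
  then have "int (Lcm {1..Suc n}) = z * int (Suc n * (n choose k))"
    by (metis of_int_eq_iff of_int_mult of_int_of_nat_eq)
  then show ?thesis by (metis dvd_triv_right int_dvd_int_iff)
qed

text \<open>The exponent of \<open>p\<close> in a least common multiple is the largest exponent
  among the members. Applied to \<open>{1..n + 1}\<close>, it keeps every prime power in the least
  common multiple below \<open>n + 2\<close>.\<close>

lemma multiplicity_Lcm_le:
  fixes A :: "nat set"
  assumes "finite A" "A \<noteq> {}" "0 \<notin> A" "prime p"
  shows "\<exists>a\<in>A. p ^ multiplicity p (Lcm A) dvd a"
  using assms
proof (induction A rule: finite_ne_induct)
  case (singleton x)
  then show ?case by (simp add: multiplicity_dvd)
next
  case (insert x F)
  have nz: "x \<noteq> 0" "Lcm F \<noteq> 0" using insert by (auto simp: Lcm_0_iff)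
  have "multiplicity p (lcm x (Lcm F)) = count (prime_factorization (lcm x (Lcm F))) p"
    using insert.prems by (simp add: count_prime_factorization_prime)
  also have "\<dots> = max (multiplicity p x) (multiplicity p (Lcm F))"
    using nz insert.prems by (simp add: prime_factorization_lcm count_prime_factorization_prime)
  finally have eq: "multiplicity p (Lcm (insert x F)) = max (multiplicity p x) (multiplicity p (Lcm F))"
    by simp
  show ?case
  proof (cases "multiplicity p x \<le> multiplicity p (Lcm F)")
    case True
    then show ?thesis using insert eq by (auto simp: max_def)
  next
    case False
    then show ?thesis using eq by (auto simp: max_def multiplicity_dvd)
  qed
qed

text \<open>Put \<open>n = M ^ 2\<close>. Without such a prime, the least common multiple of
  \<open>{1..n + 1}\<close> has at most \<open>M\<close> prime factors, each to a power at most
  \<open>n + 1\<close>, so it is at most \<open>(n + 1) ^ M < 2 ^ n\<close>. But it is a multiple of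
  \<open>n + 1\<close> times the middle binomial coefficient, hence at least \<open>2 ^ n\<close>.
  The wide interval is harmless, as only the order of \<open>ln p\<close> matters later.\<close>

lemma exists_prime_between:
  fixes M :: nat
  assumes "M \<ge> 5"
  shows "\<exists>p. prime p \<and> M < p \<and> p \<le> M\<^sup>2 + 1"
proof (rule ccontr)
  assume no: "\<nexists>p. prime p \<and> M < p \<and> p \<le> M\<^sup>2 + 1"
  define n where "n = M\<^sup>2"
  define D where "D = Lcm {1..Suc n}"
  have D0: "D \<noteq> 0" by (auto simp: D_def Lcm_0_iff)
  have Dpos: "0 < D" using D0 by simp
  have pp: "p ^ multiplicity p D \<le> Suc n" if "prime p" for p
  proof -
    have "\<exists>a\<in>{1..Suc n}. p ^ multiplicity p D dvd a"
      unfolding D_def by (rule multiplicity_Lcm_le) (use that in auto)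
    then show ?thesis by (auto dest!: dvd_imp_le)
  qed
  have sub: "prime_factors D \<subseteq> {1..M}"
  proof
    fix p assume p: "p \<in> prime_factors D"
    then have "prime p" "p dvd D" by auto
    then have "multiplicity p D > 0" using D0 by (simp add: prime_multiplicity_gt_zero_iff)
    then have "p \<le> p ^ multiplicity p D"
      using \<open>prime p\<close> by (intro self_le_power) (auto dest: prime_gt_0_nat)
    then have "p \<le> M\<^sup>2 + 1" using pp[OF \<open>prime p\<close>] by (simp add: n_def)
    then show "p \<in> {1..M}" using no \<open>prime p\<close> by (auto simp: not_less dest: prime_gt_0_nat)
  qed
  have "2 ^ n = (\<Sum>k\<le>n. n choose k)" by (simp add: choose_row_sum)
  also have "\<dots> \<le> (\<Sum>k\<le>n. n choose (n div 2))" by (intro sum_mono binomial_maximum)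
  also have "\<dots> = Suc n * (n choose (n div 2))" by simp
  also have "\<dots> \<le> D"
    by (rule dvd_imp_le[OF _ Dpos], unfold D_def, rule leibniz_dvd_Lcm) simp
  also have "D = (\<Prod>p\<in>prime_factors D. p ^ multiplicity p D)"
    using prime_factorization_nat[of D] D0 by simp
  also have "\<dots> \<le> (\<Prod>p\<in>prime_factors D. Suc n)"
    by (intro prod_mono conjI pp) auto
  also have "\<dots> = Suc n ^ card (prime_factors D)" by simp
  also have "\<dots> \<le> Suc n ^ M"
    using card_mono[OF _ sub] by (intro power_increasing) auto
  finally have le: "2 ^ n \<le> Suc n ^ M" .
  have "M\<^sup>2 + 1 < 2 ^ M"
    using assms
  proof (induction M rule: nat_induct_at_least)
    case (Suc k)
    have "5 * k \<le> k * k" using Suc.hyps by (intro mult_right_mono) auto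
    then have "(Suc k)\<^sup>2 + 1 \<le> 2 * (k\<^sup>2 + 1)" using Suc.hyps
      unfolding power2_eq_square mult_Suc mult_Suc_right distrib_left by linarith
    then show ?case using Suc.IH by simp
  qed simp
  then have "Suc n ^ M < (2 ^ M) ^ M" using assms unfolding n_def by (intro power_strict_mono) auto
  then show False using le by (simp add: n_def power2_eq_square power_mult)
qed

section \<open>Newton identities and the Linnik count\<close>

unbundle fps_syntax

text \<open>Up to sign the coefficients are the elementary symmetric functions of the
  \<open>u i\<close>. Read as a power series, the product has minus the generating function of the
  power sums as its logarithmic derivative.\<close>

definition reciprocal_prod :: "('a \<Rightarrow> int) \<Rightarrow> 'a set \<Rightarrow> int fps" where
  "reciprocal_prod u S = (\<Prod>i\<in>S. 1 - fps_const (u i) * fps_X)"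

lemma geometric_fps: "(1 - fps_const a * fps_X) * Abs_fps (\<lambda>j. a ^ Suc j) = fps_const (a :: int)"
proof (rule fps_ext)
  fix n show "((1 - fps_const a * fps_X) * Abs_fps (\<lambda>j. a ^ Suc j)) $ n = fps_const a $ n"
    by (cases n) (simp_all add: ring_distribs mult.assoc)
qed

text \<open>Logarithmic differentiation: the factor of \<open>i\<close> contributes
  \<open>- u i / (1 - u i * X)\<close>, and the series summed on the right are the expansions of
  \<open>u i / (1 - u i * X)\<close>. Comparing coefficients gives Newton's identities.\<close>

lemma deriv_reciprocal_prod:
  assumes "finite S"
  shows "fps_deriv (reciprocal_prod u S)
    = - reciprocal_prod u S * (\<Sum>i\<in>S. Abs_fps (\<lambda>j. u i ^ Suc j))"
  using assms
proof (induction S rule: finite_induct)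
  case empty
  then show ?case by (simp add: reciprocal_prod_def)
next
  case (insert x F)
  let ?l = "1 - fps_const (u x) * fps_X :: int fps"
  let ?T = "Abs_fps (\<lambda>j. u x ^ Suc j) :: int fps"
  let ?s = "\<Sum>i\<in>F. Abs_fps (\<lambda>j. u i ^ Suc j) :: int fps"
  have r: "reciprocal_prod u (insert x F) = ?l * reciprocal_prod u F"
    using insert by (simp add: reciprocal_prod_def)
  have "fps_deriv (reciprocal_prod u (insert x F))
      = - fps_const (u x) * reciprocal_prod u F + ?l * (- reciprocal_prod u F * ?s)"
    by (simp add: r insert.IH)
  also have "\<dots> = - (?l * ?T) * reciprocal_prod u F + ?l * (- reciprocal_prod u F * ?s)"
    by (simp only: geometric_fps)
  also have "\<dots> = - (?l * reciprocal_prod u F) * (?T + ?s)"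
    by (simp only: ring_distribs mult_ac minus_mult_left[symmetric] minus_mult_right[symmetric])
  finally show ?case using insert(1,2) by (simp only: r sum.insert not_False_eq_True)
qed

lemma reciprocal_prod_nth_0: "reciprocal_prod u S $ 0 = 1"
  unfolding reciprocal_prod_def by (induction S rule: infinite_finite_induct) simp_all

lemma Newton_identity:
  assumes "finite S"
  shows "int (Suc n) * reciprocal_prod u S $ Suc n
    = - (\<Sum>k\<le>n. reciprocal_prod u S $ k * (\<Sum>i\<in>S. u i ^ (Suc n - k)))"
proof -
  have "int (Suc n) * reciprocal_prod u S $ Suc n = fps_deriv (reciprocal_prod u S) $ n"
    by (simp add: fps_deriv_def)
  also have "\<dots> = - (\<Sum>k\<le>n. reciprocal_prod u S $ k * (\<Sum>i\<in>S. u i ^ Suc (n - k)))"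
    unfolding deriv_reciprocal_prod[OF assms]
    by (simp add: fps_mult_nth fps_sum_nth sum_negf atLeast0AtMost)
  also have "(\<Sum>k\<le>n. reciprocal_prod u S $ k * (\<Sum>i\<in>S. u i ^ Suc (n - k)))
      = (\<Sum>k\<le>n. reciprocal_prod u S $ k * (\<Sum>i\<in>S. u i ^ (Suc n - k)))"
    by (intro sum.cong refl) (auto simp: Suc_diff_le)
  finally show ?thesis .
qed

text \<open>Newton's identities express \<open>n\<close> times the \<open>n\<close>-th coefficient
  through lower coefficients and power sums, and each \<open>n\<close> from \<open>1\<close> to
  \<open>K\<close> can be cancelled modulo \<open>M\<close>.\<close>

lemma reciprocal_prod_cong:
  assumes "finite S" "\<And>j. j \<in> {1..K} \<Longrightarrow> [(\<Sum>i\<in>S. u i ^ j) = (\<Sum>i\<in>S. v i ^ j)] (mod M)"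
    and "\<And>j. j \<in> {1..K} \<Longrightarrow> coprime (int j) M" "n \<le> K"
  shows "[reciprocal_prod u S $ n = reciprocal_prod v S $ n] (mod M)"
  using \<open>n \<le> K\<close>
proof (induction n rule: less_induct)
  case (less n)
  show ?case
  proof (cases n)
    case 0
    then show ?thesis by (simp add: reciprocal_prod_nth_0)
  next
    case (Suc m)
    have "[(\<Sum>k\<le>m. reciprocal_prod u S $ k * (\<Sum>i\<in>S. u i ^ (Suc m - k)))
        = (\<Sum>k\<le>m. reciprocal_prod v S $ k * (\<Sum>i\<in>S. v i ^ (Suc m - k)))] (mod M)"
      using less.prems Suc by (intro cong_sum cong_mult less.IH assms(2)) auto
    then have "[int (Suc m) * reciprocal_prod u S $ Suc m = int (Suc m) * reciprocal_prod v S $ Suc m] (mod M)"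
      unfolding Newton_identity[OF assms(1)] by (simp add: cong_minus_minus_iff)
    moreover have "coprime (int (Suc m)) M" using assms(3)[of n] less.prems Suc by simp
    ultimately show ?thesis using cong_mult_lcancel Suc by blast
  qed
qed

text \<open>This is the reversal of coefficients, \<open>t ^ card S\<close> times the value at
  \<open>1 / t\<close>. The vanishing beyond degree \<open>card S\<close> is carried through the
  induction because it removes the surplus top term when a factor is added.\<close>

lemma prod_diff_eq_reciprocal_prod:
  fixes t :: int
  assumes "finite S"
  shows "(\<Prod>i\<in>S. t - u i) = (\<Sum>n\<le>card S. reciprocal_prod u S $ n * t ^ (card S - n))
       \<and> (\<forall>n>card S. reciprocal_prod u S $ n = 0)"
  using assms
proof (induction S rule: finite_induct)
  case empty
  then show ?case by (simp add: reciprocal_prod_def)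
next
  case (insert x F)
  define N where "N = card F"
  have c: "card (insert x F) = Suc N" using insert by (simp add: N_def)
  have r: "reciprocal_prod u (insert x F) = reciprocal_prod u F - fps_const (u x) * (fps_X * reciprocal_prod u F)"
    using insert by (simp add: reciprocal_prod_def ring_distribs mult.assoc)
  have r0: "reciprocal_prod u (insert x F) $ 0 = reciprocal_prod u F $ 0"
    by (simp add: r)
  have rS: "reciprocal_prod u (insert x F) $ Suc n = reciprocal_prod u F $ Suc n - u x * reciprocal_prod u F $ n" for n
    by (simp add: r)
  have z: "reciprocal_prod u F $ Suc N = 0" using insert.IH by (simp add: N_def)
  let ?a = "\<lambda>n. reciprocal_prod u F $ n"
  have "(\<Sum>n\<le>Suc N. reciprocal_prod u (insert x F) $ n * t ^ (Suc N - n))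
      = ?a 0 * t ^ Suc N + (\<Sum>n\<le>N. (?a (Suc n) - u x * ?a n) * t ^ (N - n))"
    unfolding sum.atMost_Suc_shift by (simp add: r0 rS)
  also have "\<dots> = (?a 0 * t ^ Suc N + (\<Sum>n\<le>N. ?a (Suc n) * t ^ (N - n))) - u x * (\<Sum>n\<le>N. ?a n * t ^ (N - n))"
    by (simp add: algebra_simps sum_subtractf sum_distrib_left)
  also have "?a 0 * t ^ Suc N + (\<Sum>n\<le>N. ?a (Suc n) * t ^ (N - n)) = (\<Sum>n\<le>Suc N. ?a n * t ^ (Suc N - n))"
    unfolding sum.atMost_Suc_shift by simp
  also have "\<dots> = (\<Sum>n\<le>N. ?a n * t ^ (Suc N - n))" by (simp add: z)
  also have "\<dots> = t * (\<Sum>n\<le>N. ?a n * t ^ (N - n))"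
    unfolding sum_distrib_left by (intro sum.cong refl) (simp add: Suc_diff_le mult_ac)
  finally have "(\<Sum>n\<le>Suc N. reciprocal_prod u (insert x F) $ n * t ^ (Suc N - n))
      = (t - u x) * (\<Sum>n\<le>N. ?a n * t ^ (N - n))" by (simp add: ring_distribs)
  also have "\<dots> = (\<Prod>i\<in>insert x F. t - u i)" using insert by (simp add: N_def)
  finally have 1: "(\<Prod>i\<in>insert x F. t - u i) = (\<Sum>n\<le>Suc N. reciprocal_prod u (insert x F) $ n * t ^ (Suc N - n))"
    by simp
  have 2: "\<forall>n>Suc N. reciprocal_prod u (insert x F) $ n = 0"
  proof (intro allI impI)
    fix n assume "Suc N < n"
    then obtain n' where "n = Suc n'" "N < n'" by (cases n) auto
    then show "reciprocal_prod u (insert x F) $ n = 0" using insert.IH by (simp add: rS N_def)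
  qed
  show ?case using 1 2 unfolding c by blast
qed

lemma prod_diff_cong:
  fixes t :: int
  assumes "finite S" "\<And>j. j \<in> {1..card S} \<Longrightarrow> [(\<Sum>i\<in>S. u i ^ j) = (\<Sum>i\<in>S. v i ^ j)] (mod M)"
    and "\<And>j. j \<in> {1..card S} \<Longrightarrow> coprime (int j) M"
  shows "[(\<Prod>i\<in>S. t - u i) = (\<Prod>i\<in>S. t - v i)] (mod M)"
  unfolding prod_diff_eq_reciprocal_prod[OF assms(1), THEN conjunct1]
  using reciprocal_prod_cong[OF assms] by (intro cong_sum cong_mult cong_refl) auto

text \<open>At \<open>t = v i\<close> the polynomial with roots \<open>v\<close> vanishes, so the
  one with roots \<open>u\<close> is divisible by \<open>p ^ n\<close> there. The \<open>u j\<close>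
  being distinct modulo \<open>p\<close>, only one factor \<open>v i - u j\<close> can be divisible
  by \<open>p\<close>, and this factor must absorb the whole power.\<close>

lemma power_sums_determine_residues:
  fixes p :: int
  assumes "finite S" "prime p" "int (card S) < p" "inj_on (\<lambda>i. u i mod p) S"
    and "\<And>j. j \<in> {1..card S} \<Longrightarrow> [(\<Sum>i\<in>S. u i ^ j) = (\<Sum>i\<in>S. v i ^ j)] (mod p ^ n)"
    and "i \<in> S"
  shows "\<exists>j\<in>S. [v i = u j] (mod p ^ n)"
proof (cases "n = 0")
  case True
  then show ?thesis using \<open>i \<in> S\<close> by auto
next
  case False
  have cop: "coprime (int j) (p ^ n)" if "j \<in> {1..card S}" for j
  proof -
    have "\<not> p dvd int j" using that assms(3) by (auto dest!: zdvd_imp_le)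
    then have "coprime p (int j)" using assms(2) by (simp add: prime_imp_coprime)
    then show ?thesis by (simp add: coprime_commute)
  qed
  have "[(\<Prod>j\<in>S. v i - u j) = (\<Prod>j\<in>S. v i - v j)] (mod p ^ n)"
    by (rule prod_diff_cong) (use assms cop in auto)
  moreover have "(\<Prod>j\<in>S. v i - v j) = 0" using assms(1,6) by (auto intro!: prod_zero)
  ultimately have dv: "p ^ n dvd (\<Prod>j\<in>S. v i - u j)" by (simp add: cong_0_iff)
  have "p dvd p ^ n" using False by (simp add: dvd_power)
  then have "p dvd (\<Prod>j\<in>S. v i - u j)" using dv by (rule dvd_trans)
  then have "\<exists>j\<in>S. p dvd v i - u j"
    using prime_dvd_prod_iff[OF assms(1,2), of "\<lambda>j. v i - u j"] by simp
  then obtain j where j: "j \<in> S" "p dvd v i - u j" by blast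
  have "coprime (p ^ n) (\<Prod>k\<in>S - {j}. v i - u k)"
  proof (intro prod_coprime_right)
    fix k assume k: "k \<in> S - {j}"
    have "\<not> p dvd v i - u k"
    proof
      assume "p dvd v i - u k"
      then have "p dvd (v i - u k) - (v i - u j)" using j(2) by (rule dvd_diff)
      then have "u j mod p = u k mod p" by (simp add: mod_eq_dvd_iff)
      then show False using assms(4) j(1) k by (auto dest: inj_onD)
    qed
    then show "coprime (p ^ n) (v i - u k)" using assms(2) by (simp add: prime_imp_coprime)
  qed
  moreover have "(\<Prod>j\<in>S. v i - u j) = (v i - u j) * (\<Prod>k\<in>S - {j}. v i - u k)"
    using assms(1) j(1) by (rule prod.remove)
  ultimately have "p ^ n dvd v i - u j" using dv by (simp add: coprime_dvd_mult_left_iff)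
  then show ?thesis using j(1) by (auto simp: cong_iff_dvd_diff)
qed

lemma card_cong_interval_le:
  fixes M B :: int
  assumes "M > 0" "B \<ge> 0"
  shows "card {x \<in> {0..<M * B}. [x = a] (mod M)} \<le> nat B"
proof -
  have "inj_on (\<lambda>x. x div M) {x \<in> {0..<M * B}. [x = a] (mod M)}"
  proof (rule inj_onI)
    fix x y assume xy: "x \<in> {x \<in> {0..<M * B}. [x = a] (mod M)}" "y \<in> {x \<in> {0..<M * B}. [x = a] (mod M)}" "x div M = y div M"
    then have "x mod M = y mod M" by (auto simp: cong_def)
    then show "x = y" using xy(3) by (metis mult_div_mod_eq)
  qed
  moreover have "(\<lambda>x. x div M) ` {x \<in> {0..<M * B}. [x = a] (mod M)} \<subseteq> {0..<B}"
  proof (intro image_subsetI)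
    fix x assume "x \<in> {x \<in> {0..<M * B}. [x = a] (mod M)}"
    then have x: "0 \<le> x" "x < M * B" by auto
    have "M * (x div M) \<le> x" using assms(1) mult_div_mod_eq[of M x] pos_mod_sign[of M x] by linarith
    then have "M * (x div M) < M * B" using x by linarith
    then show "x div M \<in> {0..<B}" using assms x by (simp add: pos_imp_zdiv_nonneg_iff)
  qed
  ultimately have "card {x \<in> {0..<M * B}. [x = a] (mod M)} \<le> card {0..<B}"
    by (intro card_inj_on_le) auto
  then show ?thesis by simp
qed

lemma card_le_card_image_times_fibre:
  assumes "finite U" "\<And>y. y \<in> f ` U \<Longrightarrow> card {x \<in> U. f x = y} \<le> B"
  shows "card U \<le> card (f ` U) * B"
proof -
  have "card U = (\<Sum>x\<in>U. 1)" by simp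
  also have "\<dots> = (\<Sum>y\<in>f ` U. \<Sum>x\<in>{x \<in> U. f x = y}. 1)"
    using assms(1) by (rule sum.image_gen)
  also have "\<dots> \<le> (\<Sum>y\<in>f ` U. B)" using assms(2) by (intro sum_mono) simp
  finally show ?thesis by simp
qed

text \<open>Each congruence saves its full modulus, up to \<open>K ^ K\<close> in total. Modulo the
  largest modulus \<open>M = p ^ (e * K)\<close> the power sum of degree \<open>j\<close> has only
  \<open>p ^ (e * (K - j))\<close> possible values, and these values together fix the variables
  modulo \<open>M\<close> up to order. The saving stands on the left so that exponents need not be
  subtracted.\<close>

lemma Linnik_count:
  fixes p c :: int
  assumes S: "finite S" "card S = K" and p: "prime p" "int K < p" and em: "e * K \<le> m"
  shows "card {u \<in> PiE S (\<lambda>_. {0..<p ^ m}). inj_on (\<lambda>i. u i mod p) S \<and>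
            (\<forall>j\<in>{1..K}. [(\<Sum>i\<in>S. (u i - c) ^ j) = l j] (mod p ^ (e * j)))} * nat p ^ (\<Sum>j=1..K. e * j)
         \<le> K ^ K * nat p ^ (K * m)"
    (is "card ?U * _ \<le> _")
proof -
  define M where "M = p ^ (e * K)"
  define \<phi> where "\<phi> u = (\<lambda>j\<in>{1..K}. (\<Sum>i\<in>S. (u i - c) ^ j) mod M)" for u :: "'a \<Rightarrow> int"
  have p0: "p > 0" using p by (simp add: prime_gt_0_int)
  then have M0: "M > 0" by (simp add: M_def)
  have pn: "nat (p ^ k) = nat p ^ k" for k using p0 by (simp add: nat_power_eq)
  have pm: "p ^ m = M * p ^ (m - e * K)" using em by (simp add: M_def flip: power_add)
  have fi: "finite {x \<in> {0..<B}. P x}" for B :: int and P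
    by (rule finite_subset[of _ "{0..<B}"]) auto
  have cc: "card {x \<in> {0..<p ^ a * p ^ b}. [x = y] (mod p ^ a)} \<le> nat p ^ b" for a b y
    using card_cong_interval_le[of "p ^ a" "p ^ b" y] p0 by (simp add: pn)
  have fin: "finite ?U" using S by (auto intro!: finite_PiE)
  have "card (\<phi> ` ?U) \<le> card (PiE {1..K} (\<lambda>j. {x \<in> {0..<p ^ (e * j) * p ^ (e * (K - j))}. [x = l j] (mod p ^ (e * j))}))"
  proof (intro card_mono finite_PiE image_subsetI)
    fix u assume u: "u \<in> ?U"
    show "\<phi> u \<in> PiE {1..K} (\<lambda>j. {x \<in> {0..<p ^ (e * j) * p ^ (e * (K - j))}. [x = l j] (mod p ^ (e * j))})"
      unfolding \<phi>_def
    proof (intro restrict_PiE_iff[THEN iffD2] ballI)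
      fix j assume j: "j \<in> {1..K}"
      have eq: "M = p ^ (e * j) * p ^ (e * (K - j))"
        using j unfolding M_def power_add[symmetric] add_mult_distrib2[symmetric] by simp
      have "[(\<Sum>i\<in>S. (u i - c) ^ j) mod M = (\<Sum>i\<in>S. (u i - c) ^ j)] (mod p ^ (e * j))"
        unfolding cong_def eq by (rule mod_mod_cancel) simp
      then show "(\<Sum>i\<in>S. (u i - c) ^ j) mod M \<in> {x \<in> {0..<p ^ (e * j) * p ^ (e * (K - j))}. [x = l j] (mod p ^ (e * j))}"
        using u j M0 eq by (auto intro: cong_trans)
    qed
  qed (rule fi finite_atLeastAtMost)+
  also have "\<dots> \<le> (\<Prod>j\<in>{1..K}. nat p ^ (e * (K - j)))"
    by (subst card_PiE, simp, intro prod_mono conjI cc) simp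
  also have "\<dots> = nat p ^ (\<Sum>j=1..K. e * (K - j))" by (simp add: power_sum)
  finally have im: "card (\<phi> ` ?U) \<le> nat p ^ (\<Sum>j=1..K. e * (K - j))" .
  have fib: "card {u \<in> ?U. \<phi> u = y} \<le> K ^ K * nat p ^ ((m - e * K) * K)" if y: "y \<in> \<phi> ` ?U" for y
  proof -
    obtain v where v: "v \<in> ?U" "\<phi> v = y" using y by blast
    \<comment> \<open>Here \<open>\<pi>\<close> runs over all maps from \<open>S\<close> to itself:
      this costs \<open>K ^ K\<close> instead of a factorial but spares a proof that
      \<open>\<pi>\<close> is injective.\<close>
    have "{u \<in> ?U. \<phi> u = y} \<subseteq> (\<Union>\<pi>\<in>PiE S (\<lambda>_. S). PiE S (\<lambda>i. {x \<in> {0..<M * p ^ (m - e * K)}. [x = v (\<pi> i)] (mod M)}))"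
    proof
      fix u assume u: "u \<in> {u \<in> ?U. \<phi> u = y}"
      have ps: "[(\<Sum>i\<in>S. (v i - c) ^ j) = (\<Sum>i\<in>S. (u i - c) ^ j)] (mod p ^ (e * K))" if "j \<in> {1..card S}" for j
      proof -
        have "\<phi> v j = \<phi> u j" using u v by simp
        then show ?thesis using that S by (simp add: \<phi>_def cong_def M_def)
      qed
      have inj: "inj_on (\<lambda>i. (v i - c) mod p) S"
      proof (rule inj_onI)
        fix i j assume ij: "i \<in> S" "j \<in> S" "(v i - c) mod p = (v j - c) mod p"
        then have "v i mod p = v j mod p" by (simp add: mod_eq_dvd_iff)
        then show "i = j" using v ij by (auto dest: inj_onD)
      qed
      have "\<exists>j\<in>S. [u i = v j] (mod M)" if "i \<in> S" for i
      proof -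
        have "\<exists>j\<in>S. [u i - c = v j - c] (mod p ^ (e * K))"
          using power_sums_determine_residues[OF S(1) p(1) _ inj ps that] S p(2) by auto
        then show ?thesis by (auto simp: M_def cong_iff_dvd_diff)
      qed
      then obtain \<pi> where \<pi>: "\<And>i. i \<in> S \<Longrightarrow> \<pi> i \<in> S \<and> [u i = v (\<pi> i)] (mod M)" by metis
      have "restrict \<pi> S \<in> PiE S (\<lambda>_. S)" using \<pi> by auto
      moreover have "u \<in> PiE S (\<lambda>i. {x \<in> {0..<M * p ^ (m - e * K)}. [x = v (restrict \<pi> S i)] (mod M)})"
        using u \<pi> by (auto simp: PiE_iff pm[symmetric])
      ultimately show "u \<in> (\<Union>\<pi>\<in>PiE S (\<lambda>_. S). PiE S (\<lambda>i. {x \<in> {0..<M * p ^ (m - e * K)}. [x = v (\<pi> i)] (mod M)}))"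
        by blast
    qed
    then have "card {u \<in> ?U. \<phi> u = y} \<le> card (\<Union>\<pi>\<in>PiE S (\<lambda>_. S). PiE S (\<lambda>i. {x \<in> {0..<M * p ^ (m - e * K)}. [x = v (\<pi> i)] (mod M)}))"
      by (intro card_mono finite_UN_I finite_PiE) (rule S(1) fi | assumption)+
    also have "\<dots> \<le> (\<Sum>\<pi>\<in>PiE S (\<lambda>_. S). card (PiE S (\<lambda>i. {x \<in> {0..<M * p ^ (m - e * K)}. [x = v (\<pi> i)] (mod M)})))"
      using S(1) by (intro card_UN_le finite_PiE) auto
    also have "\<dots> \<le> (\<Sum>\<pi>\<in>PiE S (\<lambda>_. S). nat p ^ ((m - e * K) * K))"
    proof (rule sum_mono)
      fix \<pi> assume "\<pi> \<in> PiE S (\<lambda>_. S)"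
      have "card (PiE S (\<lambda>i. {x \<in> {0..<M * p ^ (m - e * K)}. [x = v (\<pi> i)] (mod M)}))
         \<le> (\<Prod>i\<in>S. nat p ^ (m - e * K))"
        unfolding M_def by (subst card_PiE, rule S(1), intro prod_mono conjI cc) simp
      also have "\<dots> = nat p ^ ((m - e * K) * K)" using S by (simp add: power_mult)
      finally show "card (PiE S (\<lambda>i. {x \<in> {0..<M * p ^ (m - e * K)}. [x = v (\<pi> i)] (mod M)})) \<le> nat p ^ ((m - e * K) * K)" .
    qed
    also have "\<dots> = K ^ K * nat p ^ ((m - e * K) * K)" using S by (simp add: card_PiE)
    finally show ?thesis .
  qed
  have "card ?U \<le> card (\<phi> ` ?U) * (K ^ K * nat p ^ ((m - e * K) * K))"
    using fin fib by (rule card_le_card_image_times_fibre)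
  also have "\<dots> \<le> nat p ^ (\<Sum>j=1..K. e * (K - j)) * (K ^ K * nat p ^ ((m - e * K) * K))"
    by (rule mult_right_mono[OF im]) simp
  finally have "card ?U * nat p ^ (\<Sum>j=1..K. e * j)
      \<le> nat p ^ (\<Sum>j=1..K. e * (K - j)) * (K ^ K * nat p ^ ((m - e * K) * K)) * nat p ^ (\<Sum>j=1..K. e * j)"
    by (rule mult_right_mono) simp
  also have "\<dots> = K ^ K * nat p ^ ((\<Sum>j=1..K. e * (K - j)) + (\<Sum>j=1..K. e * j) + (m - e * K) * K)"
    by (simp only: power_add mult_ac)
  also have "(\<Sum>j=1..K. e * (K - j)) + (\<Sum>j=1..K. e * j) = (\<Sum>j=1..K. e * K)"
    unfolding sum.distrib[symmetric]
    by (intro sum.cong refl) (metis add_mult_distrib2 atLeastAtMost_iff le_add_diff_inverse2)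
  also have "(\<Sum>j=1..K. e * K) + (m - e * K) * K = K * m"
  proof -
    have "K * (e * K) + K * (m - e * K) = K * m" by (metis add_mult_distrib2 em le_add_diff_inverse)
    then show ?thesis by (simp add: mult.commute)
  qed
  finally show ?thesis .
qed

unbundle no fps_syntax

section \<open>Vinogradov's mean value\<close>

definition pow_sums :: "'i set \<Rightarrow> ('i \<Rightarrow> int) \<Rightarrow> nat \<Rightarrow> int" where
  "pow_sums I f j = (\<Sum>i\<in>I. f i ^ j)"

lemma expsum_PiE:
  assumes "finite I" "\<And>i. i \<in> I \<Longrightarrow> finite (A i)"
  shows "expsum K t (pow_sums I) (PiE I A) = (\<Prod>i\<in>I. expsum K t (power :: int \<Rightarrow> nat \<Rightarrow> int) (A i))"
proof -
  have "cis (2 * pi * (\<Sum>j=1..K. t j * of_int (pow_sums I f j)))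
      = (\<Prod>i\<in>I. cis (2 * pi * (\<Sum>j=1..K. t j * of_int (f i ^ j))))" for f :: "'a \<Rightarrow> int"
  proof -
    have "(\<Sum>j=1..K. t j * of_int (pow_sums I f j)) = (\<Sum>i\<in>I. \<Sum>j=1..K. t j * of_int (f i ^ j))"
      unfolding pow_sums_def of_int_sum sum_distrib_left by (rule sum.swap)
    then show ?thesis by (simp only: sum_distrib_left cis_sum)
  qed
  then show ?thesis using assms by (simp only: expsum_def prod_sum_PiE)
qed

text \<open>The assumption on \<open>P\<close> says that it sees only the coordinates in
  \<open>S\<close>. The other coordinates stay independent and contribute plain factors, on which
  Hoelder's inequality can act separately.\<close>

lemma expsum_PiE_split:
  assumes I: "finite I" "S \<subseteq> I" and B: "\<And>i. i \<in> I \<Longrightarrow> finite (B i)"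
    and P: "\<And>f. P (restrict f S) = P f"
  shows "expsum K t (pow_sums I) {f \<in> PiE I B. P f}
    = expsum K t (pow_sums S) {u \<in> PiE S B. P u} * (\<Prod>i\<in>I - S. expsum K t (power :: int \<Rightarrow> nat \<Rightarrow> int) (B i))"
proof -
  have "(\<Prod>i\<in>I - S. expsum K t (power :: int \<Rightarrow> nat \<Rightarrow> int) (B i)) = expsum K t (pow_sums (I - S)) (PiE (I - S) B)"
    using assms by (intro expsum_PiE[symmetric]) auto
  then have "expsum K t (pow_sums S) {u \<in> PiE S B. P u} * (\<Prod>i\<in>I - S. expsum K t (power :: int \<Rightarrow> nat \<Rightarrow> int) (B i))
    = (\<Sum>(u, w)\<in>{u \<in> PiE S B. P u} \<times> PiE (I - S) B.
         cis (2 * pi * (\<Sum>j=1..K. t j * of_int (pow_sums S u j))) * cis (2 * pi * (\<Sum>j=1..K. t j * of_int (pow_sums (I - S) w j))))"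
    by (simp add: expsum_def sum_product sum.cartesian_product)
  also have "\<dots> = expsum K t (pow_sums I) {f \<in> PiE I B. P f}"
    unfolding expsum_def
  proof (rule sum.reindex_bij_witness[where i = "\<lambda>f. (restrict f S, restrict f (I - S))"
        and j = "\<lambda>(u, w) i. if i \<in> S then u i else w i"], goal_cases)
    case (1 a)
    then show ?case using I by (auto simp: PiE_def extensional_def fun_eq_iff)
  next
    case (2 a)
    obtain u w where a: "a = (u, w)" by (cases a)
    have "P (\<lambda>i. if i \<in> S then u i else w i) = P (restrict (\<lambda>i. if i \<in> S then u i else w i) S)"
      by (rule P[symmetric])
    also have "restrict (\<lambda>i. if i \<in> S then u i else w i) S = u"
      using 2 by (auto simp: a PiE_def extensional_def fun_eq_iff)
    finally show ?case using 2 I by (auto simp: a PiE_def extensional_def)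
  next
    case (3 b)
    then show ?case using I by (auto simp: PiE_def extensional_def fun_eq_iff)
  next
    case (4 b)
    then show ?case using I P by (auto simp: PiE_def)
  next
    case (5 a)
    obtain u w where a: "a = (u, w)" by (cases a)
    have "pow_sums I (\<lambda>i. if i \<in> S then u i else w i) j = pow_sums S u j + pow_sums (I - S) w j" for j
      unfolding pow_sums_def using I by (subst sum.subset_diff[of S I]) auto
    then show ?case
      by (simp add: a cis_mult sum.distrib ring_distribs)
  qed
  finally show ?thesis by simp
qed

lemma energy_eq_sum_squares:
  assumes "finite G" "finite L" "(\<lambda>g. restrict (h g) {1..K}) ` G \<subseteq> L"
  shows "energy K h G = (\<Sum>l\<in>L. (card {g \<in> G. restrict (h g) {1..K} = l})\<^sup>2)"
proof -
  let ?k = "\<lambda>g. restrict (h g) {1..K}"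
  have eq: "?k g = ?k g' \<longleftrightarrow> (\<forall>j\<in>{1..K}. h g j - h g' j = 0)" for g g'
    by (auto simp: restrict_def fun_eq_iff)
  have "{(g, g'). g \<in> G \<and> g' \<in> G \<and> (\<forall>j\<in>{1..K}. h g j - h g' j = 0)}
      = (\<Union>l\<in>L. {g \<in> G. ?k g = l} \<times> {g \<in> G. ?k g = l})"
    using assms(3) unfolding eq[symmetric] by auto
  then have "energy K h G = card (\<Union>l\<in>L. {g \<in> G. ?k g = l} \<times> {g \<in> G. ?k g = l})"
    by (simp only: diffcount_def)
  also have "\<dots> = (\<Sum>l\<in>L. card ({g \<in> G. ?k g = l} \<times> {g \<in> G. ?k g = l}))"
    using assms by (intro card_UN_disjoint) auto
  finally show ?thesis by (simp add: card_cartesian_product power2_eq_square)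
qed

text \<open>Cauchy-Schwarz for the representation numbers. Overlaps among the \<open>G i\<close> are
  harmless, since only subadditivity of these numbers is used.\<close>

lemma energy_UN_le:
  assumes "finite F" "\<And>i. i \<in> F \<Longrightarrow> finite (G i)"
  shows "energy K h (\<Union>i\<in>F. G i) \<le> card F * (\<Sum>i\<in>F. energy K h (G i))"
proof -
  let ?k = "\<lambda>g. restrict (h g) {1..K}"
  let ?U = "\<Union>i\<in>F. G i"
  define L where "L = ?k ` ?U"
  have fin: "finite ?U" using assms by auto
  have finL: "finite L" using fin by (simp add: L_def)
  have c: "real (card {g \<in> ?U. ?k g = l}) \<le> (\<Sum>i\<in>F. real (card {g \<in> G i. ?k g = l}))" for l
  proof -
    have "{g \<in> ?U. ?k g = l} = (\<Union>i\<in>F. {g \<in> G i. ?k g = l})" by auto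
    then have "card {g \<in> ?U. ?k g = l} \<le> (\<Sum>i\<in>F. card {g \<in> G i. ?k g = l})"
      using card_UN_le[OF assms(1), of "\<lambda>i. {g \<in> G i. ?k g = l}"] by simp
    then show ?thesis by (simp flip: of_nat_sum)
  qed
  have "real (energy K h ?U) = (\<Sum>l\<in>L. (real (card {g \<in> ?U. ?k g = l}))\<^sup>2)"
    using energy_eq_sum_squares[OF fin finL, of h K] by (simp add: L_def)
  also have "\<dots> \<le> (\<Sum>l\<in>L. (\<Sum>i\<in>F. real (card {g \<in> G i. ?k g = l}))\<^sup>2)"
    by (intro sum_mono power_mono c) auto
  also have "\<dots> \<le> (\<Sum>l\<in>L. (\<Sum>i\<in>F. (real (card {g \<in> G i. ?k g = l}))\<^sup>2) * real (card F))"
    by (intro sum_mono sum_squared_le_sum_of_squares)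
  also have "\<dots> = real (card F) * (\<Sum>i\<in>F. \<Sum>l\<in>L. (real (card {g \<in> G i. ?k g = l}))\<^sup>2)"
    by (subst sum.swap) (simp add: sum_distrib_left mult.commute sum_distrib_right)
  also have "\<dots> = real (card F) * (\<Sum>i\<in>F. real (energy K h (G i)))"
  proof (intro arg_cong2[of _ _ _ _ "(*)"] refl sum.cong)
    fix i assume "i \<in> F"
    then show "(\<Sum>l\<in>L. (real (card {g \<in> G i. ?k g = l}))\<^sup>2) = real (energy K h (G i))"
      by (subst energy_eq_sum_squares[OF assms(2) finL]) (auto simp: L_def)
  qed
  also have "\<dots> = real (card F * (\<Sum>i\<in>F. energy K h (G i)))" by simp
  finally show ?thesis by (simp only: of_nat_le_iff)
qed

text \<open>By the binomial theorem the translated sum of degree \<open>j\<close> involves only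
  power sums of degree at most \<open>j\<close>. This invariance is what allows a residue class to
  be rescaled to an interval.\<close>

lemma power_sums_translate:
  fixes x y :: "'i \<Rightarrow> int"
  assumes "\<forall>j\<in>{1..K}. (\<Sum>i\<in>I. x i ^ j) = (\<Sum>i\<in>I. y i ^ j)"
  shows "\<forall>j\<in>{1..K}. (\<Sum>i\<in>I. (x i + c) ^ j) = (\<Sum>i\<in>I. (y i + c) ^ j)"
proof
  fix j assume j: "j \<in> {1..K}"
  have exp: "(\<Sum>i\<in>I. (z i + c) ^ j) = (\<Sum>k\<le>j. of_nat (j choose k) * c ^ (j - k) * (\<Sum>i\<in>I. z i ^ k))" for z :: "'i \<Rightarrow> int"
    unfolding binomial_ring sum_distrib_left
    by (subst sum.swap) (intro sum.cong refl, simp add: mult_ac)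
  have "(\<Sum>i\<in>I. x i ^ k) = (\<Sum>i\<in>I. y i ^ k)" if "k \<le> j" for k
    using that j assms by (cases "k = 0") auto
  then show "(\<Sum>i\<in>I. (x i + c) ^ j) = (\<Sum>i\<in>I. (y i + c) ^ j)" unfolding exp by simp
qed

lemma residue_class_quotient:
  fixes p y :: int
  assumes "y \<in> {y \<in> {0..<p ^ m}. y mod p ^ e = c}" "p > 0" "e \<le> m"
  shows "y = c + p ^ e * (y div p ^ e) \<and> y div p ^ e \<in> {0..<p ^ (m - e)}"
proof -
  have pe: "p ^ e > 0" using assms by simp
  have yc: "y mod p ^ e = c" using assms by simp
  have eq: "y = c + p ^ e * (y div p ^ e)" unfolding yc[symmetric] by simp
  have "p ^ e * (y div p ^ e) \<le> y" using eq yc pe by (metis le_add_same_cancel2 pos_mod_sign)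
  also have "y < p ^ e * p ^ (m - e)" using assms by (simp flip: power_add)
  finally have "y div p ^ e < p ^ (m - e)" using pe by simp
  then show ?thesis using eq assms(1) pe by (simp add: pos_imp_zdiv_nonneg_iff)
qed

text \<open>Translation by \<open>- c\<close> followed by division by \<open>p ^ e\<close> maps
  solutions inside the class injectively to solutions in the shorter interval; the equation of
  degree \<open>j\<close> loses the common factor \<open>p ^ (e * j)\<close>.\<close>

lemma energy_residue_class_le:
  fixes p c :: int
  assumes "finite I" "p > 0" "c \<in> {0..<p ^ e}" "e \<le> m"
  shows "energy K (pow_sums I) (PiE I (\<lambda>_. {y \<in> {0..<p ^ m}. y mod p ^ e = c}))
       \<le> energy K (pow_sums I) (PiE I (\<lambda>_. {0..<p ^ (m - e)}))"
proof -
  let ?A = "{y \<in> {0..<p ^ m}. y mod p ^ e = c}"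
  let ?T = "\<lambda>f. \<lambda>i\<in>I. (f i) div p ^ e"
  have pe: "p ^ e > 0" using assms by simp
  have y: "y = c + p ^ e * (y div p ^ e) \<and> y div p ^ e \<in> {0..<p ^ (m - e)}" if "y \<in> ?A" for y
    using residue_class_quotient[OF that] assms by blast
  let ?P = "{(f, g). f \<in> PiE I (\<lambda>_. ?A) \<and> g \<in> PiE I (\<lambda>_. ?A) \<and> (\<forall>j\<in>{1..K}. pow_sums I f j - pow_sums I g j = 0)}"
  let ?Q = "{(f, g). f \<in> PiE I (\<lambda>_. {0..<p ^ (m - e)}) \<and> g \<in> PiE I (\<lambda>_. {0..<p ^ (m - e)}) \<and> (\<forall>j\<in>{1..K}. pow_sums I f j - pow_sums I g j = 0)}"
  have T: "f i = c + p ^ e * ?T f i" if "f \<in> PiE I (\<lambda>_. ?A)" "i \<in> I" for f i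
    using y[of "f i"] that by auto
  have inj: "f = g" if fg: "f \<in> PiE I (\<lambda>_. ?A)" "g \<in> PiE I (\<lambda>_. ?A)" "?T f = ?T g" for f g
  proof (rule PiE_ext[OF fg(1,2)])
    fix i assume "i \<in> I"
    then show "f i = g i" using T[OF fg(1)] T[OF fg(2)] fg(3) by metis
  qed
  have "card ?P \<le> card ?Q"
  proof (rule card_inj_on_le[where f = "\<lambda>(f, g). (?T f, ?T g)"])
    show "inj_on (\<lambda>(f, g). (?T f, ?T g)) ?P"
      using inj by (auto simp: inj_on_def split_beta)
    show "finite ?Q"
      by (rule finite_subset[of _ "PiE I (\<lambda>_. {0..<p ^ (m - e)}) \<times> PiE I (\<lambda>_. {0..<p ^ (m - e)})"])
         (use assms in \<open>auto intro!: finite_PiE\<close>)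
    show "(\<lambda>(f, g). (?T f, ?T g)) ` ?P \<subseteq> ?Q"
    proof clarify
      fix f g assume fg: "f \<in> PiE I (\<lambda>_. ?A)" "g \<in> PiE I (\<lambda>_. ?A)" "\<forall>j\<in>{1..K}. pow_sums I f j - pow_sums I g j = 0"
      have "\<forall>j\<in>{1..K}. (\<Sum>i\<in>I. (f i + - c) ^ j) = (\<Sum>i\<in>I. (g i + - c) ^ j)"
        by (rule power_sums_translate) (use fg(3) in \<open>simp add: pow_sums_def\<close>)
      moreover have "p ^ (e * j) * pow_sums I (?T h) j = (\<Sum>i\<in>I. (h i + - c) ^ j)"
        if "h \<in> PiE I (\<lambda>_. ?A)" for h j
      proof -
        have "p ^ (e * j) * ?T h i ^ j = (h i + - c) ^ j" if "i \<in> I" for i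
        proof -
          have "h i + - c = p ^ e * ?T h i" using T[OF \<open>h \<in> _\<close> that] by linarith
          then show ?thesis by (simp only: power_mult_distrib power_mult)
        qed
        then show ?thesis unfolding pow_sums_def sum_distrib_left by (intro sum.cong refl)
      qed
      ultimately have "\<forall>j\<in>{1..K}. p ^ (e * j) * pow_sums I (?T f) j = p ^ (e * j) * pow_sums I (?T g) j"
        using fg(1,2) by simp
      then have "\<forall>j\<in>{1..K}. pow_sums I (?T f) j - pow_sums I (?T g) j = 0" using assms by simp
      moreover have "?T f \<in> PiE I (\<lambda>_. {0..<p ^ (m - e)})" "?T g \<in> PiE I (\<lambda>_. {0..<p ^ (m - e)})"
        using y fg(1,2) by (auto simp: PiE_iff)
      ultimately show "?T f \<in> PiE I (\<lambda>_. {0..<p ^ (m - e)}) \<and> ?T g \<in> PiE I (\<lambda>_. {0..<p ^ (m - e)}) \<and>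
         (\<forall>j\<in>{1..K}. pow_sums I (?T f) j - pow_sums I (?T g) j = 0)" by blast
    qed
  qed
  then show ?thesis by (simp only: diffcount_def)
qed

text \<open>After translation by \<open>- c\<close> the variables outside \<open>S\<close>
  contribute multiples of \<open>p ^ (e * j)\<close> in degree \<open>j\<close>. So once the
  \<open>S\<close>-part of \<open>g\<close> is chosen, in at most \<open>p ^ (K * m)\<close> ways,
  \<open>Linnik_count\<close> bounds the \<open>S\<close>-parts of \<open>f\<close>. The quotients
  outside \<open>S\<close> then solve an inhomogeneous system, which has at most as many solutions
  as the homogeneous one.\<close>

lemma energy_conditioned_class:
  fixes p c :: int
  assumes I: "finite I" "S \<subseteq> I" "card S = K" and p: "prime p" "int K < p" and em: "e * K \<le> m"
    and e: "e \<le> m"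
  shows "energy K (pow_sums I) {f \<in> PiE I (\<lambda>i. if i \<in> S then {0..<p ^ m} else {y \<in> {0..<p ^ m}. y mod p ^ e = c}).
              inj_on (\<lambda>i. f i mod p) S} * nat p ^ (\<Sum>j=1..K. e * j)
       \<le> K ^ K * nat p ^ (2 * K * m) * energy K (pow_sums (I - S)) (PiE (I - S) (\<lambda>_. {0..<p ^ (m - e)}))"
    (is "energy K _ ?G * ?X \<le> _ * ?E")
proof -
  let ?A = "{0..<p ^ m}" and ?Ac = "{y \<in> {0..<p ^ m}. y mod p ^ e = c}"
  let ?I' = "I - S"
  let ?T = "\<lambda>f. \<lambda>i\<in>?I'. (f i) div p ^ e"
  let ?s = "\<lambda>f j. \<Sum>i\<in>S. (f i - c) ^ j"
  have p0: "p > 0" using p by (simp add: prime_gt_0_int)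
  have finS: "finite S" using I finite_subset by blast
  define D where "D = {u \<in> PiE S (\<lambda>_. ?A). inj_on (\<lambda>i. u i mod p) S}"
  define W where "W v = {u \<in> PiE S (\<lambda>_. ?A). inj_on (\<lambda>i. u i mod p) S \<and>
            (\<forall>j\<in>{1..K}. [?s u j = ?s v j] (mod p ^ (e * j)))}" for v
  define V where "V x = {(v, v'). v \<in> PiE ?I' (\<lambda>_. {0..<p ^ (m - e)}) \<and> v' \<in> PiE ?I' (\<lambda>_. {0..<p ^ (m - e)}) \<and>
      (\<forall>j\<in>{1..K}. pow_sums ?I' v j - pow_sums ?I' v' j = (?s (fst x) j - ?s (snd x) j) div p ^ (e * j))}" for x
  have finD: "finite D" unfolding D_def using finS by (auto intro!: finite_PiE)
  have finW: "finite (W v)" for v unfolding W_def using finS by (auto intro!: finite_PiE)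
  have finB: "finite (PiE ?I' (\<lambda>_. {0..<p ^ (m - e)}))" using I by (auto intro!: finite_PiE)
  have finV: "finite (V x)" for x
    by (rule finite_subset[OF _ finite_cartesian_product[OF finB finB]]) (auto simp: V_def)
  have cardV: "card (V x) \<le> ?E" for x
    unfolding V_def using diffcount_le_energy[OF finB, of K "pow_sums ?I'" "\<lambda>j. (?s (fst x) j - ?s (snd x) j) div p ^ (e * j)"]
    by (simp only: diffcount_def)
  have y: "y = c + p ^ e * (y div p ^ e) \<and> y div p ^ e \<in> {0..<p ^ (m - e)}" if "y \<in> ?Ac" for y
    using residue_class_quotient[OF that p0 e] .
  have T: "f i = c + p ^ e * ?T f i" "?T f i \<in> {0..<p ^ (m - e)}" if "f \<in> ?G" "i \<in> ?I'" for f i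
  proof -
    have "f i \<in> ?Ac" using that by (auto simp: PiE_iff split: if_splits)
    from y[OF this] show "f i = c + p ^ e * ?T f i" "?T f i \<in> {0..<p ^ (m - e)}" using that(2) by auto
  qed
  have rS: "restrict f S \<in> D" if f: "f \<in> ?G" for f
  proof -
    have "f i \<in> ?A" if "i \<in> S" for i
      using f that I(2) by (auto simp: PiE_iff dest!: bspec[of I _ i])
    moreover have "inj_on (\<lambda>i. restrict f S i mod p) S \<longleftrightarrow> inj_on (\<lambda>i. f i mod p) S"
      by (rule inj_on_cong) auto
    ultimately show ?thesis using f unfolding D_def by auto
  qed
  have rs: "?s (restrict f S) j = ?s f j" for f j by simp
  let ?P = "{(f, g). f \<in> ?G \<and> g \<in> ?G \<and> (\<forall>j\<in>{1..K}. pow_sums I f j - pow_sums I g j = 0)}"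
  let ?Q = "SIGMA x:(SIGMA v:D. W v). V x"
  let ?h = "\<lambda>(f, g). ((restrict g S, restrict f S), (?T f, ?T g))"
  have inj: "f = g" if fg: "f \<in> ?G" "g \<in> ?G" "restrict f S = restrict g S" "?T f = ?T g" for f g
  proof (rule PiE_ext)
    show "f \<in> PiE I (\<lambda>i. if i \<in> S then ?A else ?Ac)" "g \<in> PiE I (\<lambda>i. if i \<in> S then ?A else ?Ac)"
      using fg by auto
    fix i assume i: "i \<in> I"
    show "f i = g i"
    proof (cases "i \<in> S")
      case True
      then show ?thesis using fg(3) by (metis restrict_apply')
    next
      case False
      then have "i \<in> ?I'" using i by simp
      then show ?thesis using T(1)[OF fg(1)] T(1)[OF fg(2)] fg(4) by metis
    qed
  qed
  have "card ?P \<le> card ?Q"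
  proof (rule card_inj_on_le[where f = ?h])
    show "inj_on ?h ?P"
    proof (rule inj_onI)
      fix a b assume ab: "a \<in> ?P" "b \<in> ?P" "?h a = ?h b"
      obtain f g f' g' where *: "a = (f, g)" "b = (f', g')" by (cases a, cases b)
      have "f = f'" "g = g'" using ab unfolding * by (auto intro!: inj)
      then show "a = b" by (simp add: *)
    qed
    show "finite ?Q" using finD finW finV by (intro finite_SigmaI) auto
    show "?h ` ?P \<subseteq> ?Q"
    proof (rule image_subsetI)
      fix a assume a: "a \<in> ?P"
      obtain f g where ag: "a = (f, g)" by (cases a)
      have f: "f \<in> ?G" and g: "g \<in> ?G" and eq: "\<forall>j\<in>{1..K}. pow_sums I f j - pow_sums I g j = 0"
        using a by (auto simp: ag)
      have tr: "\<forall>j\<in>{1..K}. (\<Sum>i\<in>I. (f i + - c) ^ j) = (\<Sum>i\<in>I. (g i + - c) ^ j)"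
        by (rule power_sums_translate) (use eq in \<open>simp add: pow_sums_def\<close>)
      have split: "(\<Sum>i\<in>I. (h i + - c) ^ j) = ?s h j + p ^ (e * j) * pow_sums ?I' (?T h) j"
        if "h \<in> ?G" for h j
      proof -
        have "p ^ (e * j) * ?T h i ^ j = (h i + - c) ^ j" if "i \<in> ?I'" for i
        proof -
          have "h i + - c = p ^ e * ?T h i" using T(1)[OF \<open>h \<in> _\<close> that] by linarith
          then show ?thesis by (simp only: power_mult_distrib power_mult)
        qed
        then have "p ^ (e * j) * pow_sums ?I' (?T h) j = (\<Sum>i\<in>?I'. (h i + - c) ^ j)"
          unfolding pow_sums_def sum_distrib_left by (intro sum.cong refl)
        then show ?thesis using I by (simp add: sum.subset_diff[of S I])
      qed
      have key: "p ^ (e * j) * (pow_sums ?I' (?T f) j - pow_sums ?I' (?T g) j) = ?s g j - ?s f j" if "j \<in> {1..K}" for j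
        using tr that split[OF f, of j] split[OF g, of j] by (simp add: right_diff_distrib)
      have "restrict g S \<in> D" using g by (rule rS)
      moreover have "restrict f S \<in> W (restrict g S)"
      proof -
        have "[?s f j = ?s g j] (mod p ^ (e * j))" if "j \<in> {1..K}" for j
          using key[OF that] by (metis cong_iff_dvd_diff cong_sym dvd_triv_left)
        then show ?thesis using rS[OF f] unfolding W_def D_def by simp
      qed
      moreover have "(?T f, ?T g) \<in> V (restrict g S, restrict f S)"
      proof -
        have "pow_sums ?I' (?T f) j - pow_sums ?I' (?T g) j = (?s g j - ?s f j) div p ^ (e * j)" if "j \<in> {1..K}" for j
          unfolding key[OF that, symmetric] using p0 by simp
        moreover have "?T f \<in> PiE ?I' (\<lambda>_. {0..<p ^ (m - e)})" "?T g \<in> PiE ?I' (\<lambda>_. {0..<p ^ (m - e)})"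
          using T(2)[OF f] T(2)[OF g] by (auto simp: PiE_iff)
        ultimately show ?thesis unfolding V_def mem_Collect_eq case_prod_conv fst_conv snd_conv rs by blast
      qed
      ultimately show "?h a \<in> ?Q" by (simp add: ag)
    qed
  qed
  also have "card ?Q = (\<Sum>x\<in>(SIGMA v:D. W v). card (V x))"
    using finD finW finV by (intro card_SigmaI) auto
  also have "\<dots> \<le> (\<Sum>x\<in>(SIGMA v:D. W v). ?E)" by (intro sum_mono cardV)
  also have "\<dots> = card (SIGMA v:D. W v) * ?E" by simp
  also have "card (SIGMA v:D. W v) = (\<Sum>v\<in>D. card (W v))"
    using finD finW by (intro card_SigmaI) auto
  finally have "energy K (pow_sums I) ?G \<le> (\<Sum>v\<in>D. card (W v)) * ?E" by (simp only: diffcount_def)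
  then have "energy K (pow_sums I) ?G * ?X \<le> (\<Sum>v\<in>D. card (W v)) * ?E * ?X" by (rule mult_right_mono) simp
  also have "\<dots> = (\<Sum>v\<in>D. card (W v) * ?X) * ?E" by (simp only: sum_distrib_right[symmetric] mult_ac)
  also have "\<dots> \<le> (\<Sum>v\<in>D. K ^ K * nat p ^ (K * m)) * ?E"
    unfolding W_def using finS I p em by (intro mult_right_mono sum_mono Linnik_count) auto
  also have "\<dots> = card D * (K ^ K * nat p ^ (K * m)) * ?E" by simp
  also have "\<dots> \<le> card (PiE S (\<lambda>_. ?A)) * (K ^ K * nat p ^ (K * m)) * ?E"
    using finS by (intro mult_right_mono card_mono finite_PiE) (auto simp: D_def)
  also have "card (PiE S (\<lambda>_. ?A)) = nat p ^ (K * m)"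
    using finS I p0 by (simp add: card_PiE nat_power_eq power_mult[symmetric] mult.commute)
  also have "nat p ^ (K * m) * (K ^ K * nat p ^ (K * m)) * ?E = K ^ K * nat p ^ (2 * K * m) * ?E"
  proof -
    have "nat p ^ (2 * K * m) = nat p ^ (K * m) * nat p ^ (K * m)"
      unfolding power_add[symmetric] by (simp add: mult_2 distrib_right)
    then show ?thesis by simp
  qed
  finally show ?thesis .
qed

lemma expsum_residue_classes:
  fixes q :: int and A :: "int set"
  assumes "finite A" "q > 0"
  shows "expsum K t h A = (\<Sum>c\<in>{0..<q}. expsum K t h {y \<in> A. y mod q = c})"
proof -
  have "(\<lambda>y. y mod q) ` A \<subseteq> {0..<q}" using assms by auto
  then show ?thesis unfolding expsum_def using assms by (intro sum.group[symmetric]) auto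
qed

text \<open>With \<open>R = card (I - S)\<close>, Hoelder over the \<open>p ^ e\<close> residue
  classes moves the \<open>2 * R\<close> factors outside \<open>S\<close> into a common class. Its
  constant \<open>p ^ (e * (2 * R - 1))\<close> and the sum over the classes make up
  \<open>p ^ (2 * e * R)\<close>.\<close>

lemma energy_conditioned:
  fixes p :: int
  assumes I: "finite I" "S \<subseteq> I" "card S = K" "S \<noteq> I" and p: "prime p" "int K < p" and em: "e * K \<le> m"
    and e: "e \<le> m"
  shows "energy K (pow_sums I) {f \<in> PiE I (\<lambda>_. {0..<p ^ m}). inj_on (\<lambda>i. f i mod p) S} * nat p ^ (\<Sum>j=1..K. e * j)
       \<le> nat p ^ (2 * e * card (I - S)) * (K ^ K * nat p ^ (2 * K * m)
          * energy K (pow_sums (I - S)) (PiE (I - S) (\<lambda>_. {0..<p ^ (m - e)})))"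
    (is "energy K _ ?G * ?X \<le> _ * ?E")
proof -
  let ?A = "{0..<p ^ m}" and ?Ac = "\<lambda>c. {y \<in> {0..<p ^ m}. y mod p ^ e = c}"
  let ?G' = "\<lambda>c. {f \<in> PiE I (\<lambda>i. if i \<in> S then {0..<p ^ m} else ?Ac c). inj_on (\<lambda>i. f i mod p) S}"
  define R where "R = card (I - S)"
  have p0: "p > 0" using p by (simp add: prime_gt_0_int)
  have R0: "R > 0" using I by (auto simp: R_def card_gt_0_iff)
  have P: "inj_on (\<lambda>i. restrict f S i mod p) S = inj_on (\<lambda>i. f i mod p) S" for f :: "'a \<Rightarrow> int"
    by (rule inj_on_cong) auto
  have finB: "finite (if i \<in> S then ?A else ?Ac c)" for i c
  proof -
    have "finite (?Ac c)" by (rule finite_subset[of _ ?A]) auto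
    then show ?thesis by simp
  qed
  let ?F = "\<lambda>t B. expsum K t (power :: int \<Rightarrow> nat \<Rightarrow> int) B"
  let ?D = "\<lambda>t. expsum K t (pow_sums S) {u \<in> PiE S (\<lambda>_. ?A). inj_on (\<lambda>i. u i mod p) S}"
  have e1: "expsum K t (pow_sums I) ?G = ?D t * ?F t ?A ^ R" for t
    using expsum_PiE_split[OF I(1,2), of "\<lambda>_. ?A" "\<lambda>f. inj_on (\<lambda>i. f i mod p) S" K t] P by (simp add: R_def)
  have e2: "expsum K t (pow_sums I) (?G' c) = ?D t * ?F t (?Ac c) ^ R" for t c
  proof -
    have "(PiE S (\<lambda>i. if i \<in> S then ?A else ?Ac c)) = PiE S (\<lambda>_. ?A)" by (rule PiE_cong) auto
    moreover have "(\<Prod>i\<in>I - S. ?F t (if i \<in> S then ?A else ?Ac c)) = ?F t (?Ac c) ^ R"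
      by (simp add: R_def)
    ultimately show ?thesis
      using finB expsum_PiE_split[OF I(1,2), of "\<lambda>i. if i \<in> S then ?A else ?Ac c" "\<lambda>f. inj_on (\<lambda>i. f i mod p) S" K t] P
      by (simp only:)
  qed
  have "real (energy K (pow_sums I) ?G) \<le> real (nat (p ^ e)) ^ (2 * R - 1) * (\<Sum>c\<in>{0..<p ^ e}. real (energy K (pow_sums I) (?G' c)))"
  proof (rule energy_le_sum_energy)
    show "finite ?G" using I(1) by (auto intro!: finite_PiE)
    show "finite (?G' c)" for c
      by (rule finite_subset[OF _ finite_PiE[OF I(1) finB]]) auto
    fix t
    have "cmod (?F t ?A) \<le> (\<Sum>c\<in>{0..<p ^ e}. cmod (?F t (?Ac c)))"
      using expsum_residue_classes[of ?A "p ^ e" K t power] p0 by (simp add: norm_sum)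
    then have "cmod (?F t ?A) ^ (2 * R) \<le> (\<Sum>c\<in>{0..<p ^ e}. cmod (?F t (?Ac c))) ^ (2 * R)"
      by (rule power_mono) simp
    also have "\<dots> \<le> real (card {0..<p ^ e}) ^ (2 * R - 1) * (\<Sum>c\<in>{0..<p ^ e}. cmod (?F t (?Ac c)) ^ (2 * R))"
      using R0 by (intro power_mean_card) auto
    finally have F: "cmod (?F t ?A) ^ (2 * R) \<le> real (nat (p ^ e)) ^ (2 * R - 1) * (\<Sum>c\<in>{0..<p ^ e}. cmod (?F t (?Ac c)) ^ (2 * R))"
      by simp
    have sq: "(cmod (z * w ^ R))\<^sup>2 = (cmod z)\<^sup>2 * cmod w ^ (2 * R)" for z w :: complex
      by (simp add: norm_mult norm_power power_mult_distrib power_mult[symmetric] mult.commute)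
    have "(cmod (expsum K t (pow_sums I) ?G))\<^sup>2 = (cmod (?D t))\<^sup>2 * cmod (?F t ?A) ^ (2 * R)"
      unfolding e1 sq ..
    also have "\<dots> \<le> (cmod (?D t))\<^sup>2 * (real (nat (p ^ e)) ^ (2 * R - 1) * (\<Sum>c\<in>{0..<p ^ e}. cmod (?F t (?Ac c)) ^ (2 * R)))"
      by (rule mult_left_mono[OF F]) simp
    also have "\<dots> = real (nat (p ^ e)) ^ (2 * R - 1) * (\<Sum>c\<in>{0..<p ^ e}. (cmod (expsum K t (pow_sums I) (?G' c)))\<^sup>2)"
      unfolding e2 sq by (simp add: sum_distrib_left mult_ac)
    finally show "(cmod (expsum K t (pow_sums I) ?G))\<^sup>2 \<le> real (nat (p ^ e)) ^ (2 * R - 1) * (\<Sum>c\<in>{0..<p ^ e}. (cmod (expsum K t (pow_sums I) (?G' c)))\<^sup>2)" .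
  qed auto
  also have "\<dots> = real (nat (p ^ e) ^ (2 * R - 1) * (\<Sum>c\<in>{0..<p ^ e}. energy K (pow_sums I) (?G' c)))"
    by simp
  finally have "energy K (pow_sums I) ?G \<le> nat (p ^ e) ^ (2 * R - 1) * (\<Sum>c\<in>{0..<p ^ e}. energy K (pow_sums I) (?G' c))"
    by (simp only: of_nat_le_iff)
  then have "energy K (pow_sums I) ?G * ?X \<le> nat (p ^ e) ^ (2 * R - 1) * (\<Sum>c\<in>{0..<p ^ e}. energy K (pow_sums I) (?G' c)) * ?X"
    by (rule mult_right_mono) simp
  also have "\<dots> = nat (p ^ e) ^ (2 * R - 1) * (\<Sum>c\<in>{0..<p ^ e}. energy K (pow_sums I) (?G' c) * ?X)"
    by (simp only: sum_distrib_right mult.assoc)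
  also have "\<dots> \<le> nat (p ^ e) ^ (2 * R - 1) * (\<Sum>c\<in>{0..<p ^ e}. ?E)"
    by (intro mult_left_mono sum_mono energy_conditioned_class I(1-3) p em e) simp_all
  also have "\<dots> = (nat (p ^ e) ^ (2 * R - 1) * nat (p ^ e)) * ?E"
    by simp
  also have "nat (p ^ e) ^ (2 * R - 1) * nat (p ^ e) = nat (p ^ e) ^ (2 * R)"
    using R0 by (simp flip: power_Suc2)
  also have "\<dots> = nat p ^ (2 * e * R)" using p0 by (simp add: nat_power_eq power_mult[symmetric] mult_ac)
  finally show ?thesis by (simp add: R_def)
qed

lemma energy_mono: "finite H \<Longrightarrow> G \<subseteq> H \<Longrightarrow> energy K h G \<le> energy K h H"
  unfolding diffcount_def by (rule card_mono) (auto intro: finite_subset[of _ "H \<times> H"])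

text \<open>Such a tuple assigns to each index an entry of a list of \<open>K\<close> values, padded
  by repeating one of them. The point is that the power of \<open>card B\<close> does not grow with
  \<open>I\<close>.\<close>

lemma card_few_values_le:
  fixes I :: "'i set" and B :: "'b set"
  assumes "finite I" "finite B" "I \<noteq> {}"
  shows "card {r \<in> PiE I (\<lambda>_. B). card (r ` I) < K} \<le> card B ^ K * K ^ card I"
proof -
  have "{r \<in> PiE I (\<lambda>_. B). card (r ` I) < K} \<subseteq> (\<Union>g\<in>PiE {..<K} (\<lambda>_. B). PiE I (\<lambda>_. g ` {..<K}))"
  proof
    fix r assume r: "r \<in> {r \<in> PiE I (\<lambda>_. B). card (r ` I) < K}"
    show "r \<in> (\<Union>g\<in>PiE {..<K} (\<lambda>_. B). PiE I (\<lambda>_. g ` {..<K}))"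
    proof -
      obtain b where b: "b \<in> r ` I" using assms(3) by blast
      obtain h where h: "bij_betw h {0..<card (r ` I)} (r ` I)"
        using ex_bij_betw_nat_finite[of "r ` I"] assms by auto
      define g where "g = (\<lambda>i\<in>{..<K}. if i < card (r ` I) then h i else b)"
      have rB: "r ` I \<subseteq> B" using r by auto
      have "h i \<in> r ` I" if "i < card (r ` I)" for i
        using bij_betw_apply[OF h, of i] that by simp
      then have "g i \<in> B" if "i < K" for i
        using that b rB by (simp add: g_def subsetD)
      moreover have "g \<in> extensional {..<K}" by (simp add: g_def)
      ultimately have g: "g \<in> PiE {..<K} (\<lambda>_. B)" by (simp add: PiE_iff)
      have "r ` I \<subseteq> g ` {..<K}"
      proof
        fix x assume "x \<in> r ` I"
        then have "x \<in> h ` {0..<card (r ` I)}" using h by (simp only: bij_betw_def)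
        then obtain i where "i < card (r ` I)" "x = h i" by auto
        then show "x \<in> g ` {..<K}" using r by (intro image_eqI[of _ _ i]) (auto simp: g_def)
      qed
      then have "r \<in> PiE I (\<lambda>_. g ` {..<K})" using r by (auto simp: PiE_iff)
      then show ?thesis using g by blast
    qed
  qed
  then have "card {r \<in> PiE I (\<lambda>_. B). card (r ` I) < K} \<le> card (\<Union>g\<in>PiE {..<K} (\<lambda>_. B). PiE I (\<lambda>_. g ` {..<K}))"
    using assms by (intro card_mono finite_UN_I finite_PiE) auto
  also have "\<dots> \<le> (\<Sum>g\<in>PiE {..<K} (\<lambda>_. B). card (PiE I (\<lambda>_. g ` {..<K})))"
    using assms by (intro card_UN_le finite_PiE) auto
  also have "\<dots> \<le> (\<Sum>g\<in>PiE {..<K} (\<lambda>_. B). K ^ card I)"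
  proof (rule sum_mono)
    fix g :: "nat \<Rightarrow> 'b"
    have "card (g ` {..<K}) \<le> K" using card_image_le[of "{..<K}" g] by simp
    then show "card (PiE I (\<lambda>_. g ` {..<K})) \<le> K ^ card I" using assms by (simp add: card_PiE power_mono)
  qed
  also have "\<dots> = card B ^ K * K ^ card I" by (simp add: card_PiE)
  finally show ?thesis .
qed

text \<open>For a fixed vector of residues the exponential sum is a product of class sums, hence at
  most a power of the largest one. This brings all variables into a single class modulo
  \<open>p\<close>, where the system rescales. Combining the few residue vectors by Cauchy-Schwarz
  costs the square of their number.\<close>

lemma energy_few_residues:
  fixes p :: int
  assumes I: "finite I" "I \<noteq> {}" and p: "p > 0" and m: "m \<ge> 1"
  shows "energy K (pow_sums I) {f \<in> PiE I (\<lambda>_. {0..<p ^ m}). card ((\<lambda>i. f i mod p) ` I) < K}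
     \<le> (nat p ^ K * K ^ card I)\<^sup>2 * (nat p * energy K (pow_sums I) (PiE I (\<lambda>_. {0..<p ^ (m - 1)})))"
proof -
  let ?A = "{0..<p ^ m}" and ?Ac = "\<lambda>c. {y \<in> {0..<p ^ m}. y mod p = c}"
  let ?R = "{r \<in> PiE I (\<lambda>_. {0..<p}). card (r ` I) < K}"
  let ?E = "energy K (pow_sums I) (PiE I (\<lambda>_. {0..<p ^ (m - 1)}))"
  let ?F = "\<lambda>t B. expsum K t (power :: int \<Rightarrow> nat \<Rightarrow> int) B"
  have finR: "finite ?R" using I by (auto intro!: finite_PiE)
  have fin: "finite (PiE I (\<lambda>i. ?Ac (r i)))" for r :: "'a \<Rightarrow> int"
    by (rule finite_PiE[OF I(1)]) (rule finite_subset[of _ ?A], auto)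
  have one: "energy K (pow_sums I) (PiE I (\<lambda>i. ?Ac (r i))) \<le> nat p * ?E" if r: "r \<in> ?R" for r
  proof -
    have "real (energy K (pow_sums I) (PiE I (\<lambda>i. ?Ac (r i)))) \<le> 1 * (\<Sum>c\<in>{0..<p}. real (energy K (pow_sums I) (PiE I (\<lambda>_. ?Ac c))))"
    proof (rule energy_le_sum_energy)
      show "finite (PiE I (\<lambda>i. ?Ac (r i)))" by (rule fin)
      show "finite (PiE I (\<lambda>_. ?Ac c))" for c using fin[of "\<lambda>_. c"] by simp
      fix t
      \<comment> \<open>The class with the largest sum depends on \<open>t\<close>; summing over all
        classes removes this dependence at the price of a factor \<open>p\<close>.\<close>
      have "Max ((\<lambda>b. cmod (?F t (?Ac b))) ` {0..<p}) \<in> (\<lambda>b. cmod (?F t (?Ac b))) ` {0..<p}"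
        using p by (intro Max_in) auto
      then obtain c where c0: "c \<in> {0..<p}" "Max ((\<lambda>b. cmod (?F t (?Ac b))) ` {0..<p}) = cmod (?F t (?Ac c))"
        by (elim imageE)
      have c: "c \<in> {0..<p}" "\<And>b. b \<in> {0..<p} \<Longrightarrow> cmod (?F t (?Ac b)) \<le> cmod (?F t (?Ac c))"
        unfolding c0(2)[symmetric] using c0(1) by (auto intro!: Max_ge)
      have finc: "finite (?Ac b)" for b by (rule finite_subset[of _ ?A]) auto
      have "cmod (expsum K t (pow_sums I) (PiE I (\<lambda>i. ?Ac (r i)))) = (\<Prod>i\<in>I. cmod (?F t (?Ac (r i))))"
        using I finc by (subst expsum_PiE) (simp_all add: prod_norm)
      also have "\<dots> \<le> (\<Prod>i\<in>I. cmod (?F t (?Ac c)))"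
        using r c(2) by (intro prod_mono conjI norm_ge_zero) (auto simp: PiE_iff)
      also have "\<dots> = cmod (expsum K t (pow_sums I) (PiE I (\<lambda>_. ?Ac c)))"
        using I finc by (subst expsum_PiE) (simp_all add: norm_power)
      finally have "(cmod (expsum K t (pow_sums I) (PiE I (\<lambda>i. ?Ac (r i)))))\<^sup>2
         \<le> (cmod (expsum K t (pow_sums I) (PiE I (\<lambda>_. ?Ac c))))\<^sup>2" by (rule power_mono) simp
      also have "\<dots> \<le> (\<Sum>c\<in>{0..<p}. (cmod (expsum K t (pow_sums I) (PiE I (\<lambda>_. ?Ac c))))\<^sup>2)"
        using c(1) by (intro member_le_sum) auto
      finally show "(cmod (expsum K t (pow_sums I) (PiE I (\<lambda>i. ?Ac (r i)))))\<^sup>2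
         \<le> 1 * (\<Sum>c\<in>{0..<p}. (cmod (expsum K t (pow_sums I) (PiE I (\<lambda>_. ?Ac c))))\<^sup>2)" by simp
    qed auto
    also have "\<dots> = (\<Sum>c\<in>{0..<p}. real (energy K (pow_sums I) (PiE I (\<lambda>_. ?Ac c))))" by simp
    also have "\<dots> \<le> (\<Sum>c\<in>{0..<p}. real ?E)"
    proof (rule sum_mono)
      fix c assume "c \<in> {0..<p}"
      then show "real (energy K (pow_sums I) (PiE I (\<lambda>_. ?Ac c))) \<le> real ?E"
        using energy_residue_class_le[of I p c 1 m K] I p m by simp
    qed
    also have "\<dots> = real (nat p * ?E)" by simp
    finally show ?thesis by (simp only: of_nat_le_iff)
  qed
  have "energy K (pow_sums I) {f \<in> PiE I (\<lambda>_. ?A). card ((\<lambda>i. f i mod p) ` I) < K}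
      \<le> energy K (pow_sums I) (\<Union>r\<in>?R. PiE I (\<lambda>i. ?Ac (r i)))"
  proof (rule energy_mono)
    show "finite (\<Union>r\<in>?R. PiE I (\<lambda>i. ?Ac (r i)))" using finR fin by blast
    show "{f \<in> PiE I (\<lambda>_. ?A). card ((\<lambda>i. f i mod p) ` I) < K} \<subseteq> (\<Union>r\<in>?R. PiE I (\<lambda>i. ?Ac (r i)))"
    proof
      fix f assume f: "f \<in> {f \<in> PiE I (\<lambda>_. ?A). card ((\<lambda>i. f i mod p) ` I) < K}"
      have im: "(\<lambda>i\<in>I. f i mod p) ` I = (\<lambda>i. f i mod p) ` I" by auto
      have "(\<lambda>i\<in>I. f i mod p) \<in> ?R" using f p by (simp add: im)
      moreover have "f \<in> PiE I (\<lambda>i. ?Ac ((\<lambda>i\<in>I. f i mod p) i))" using f by (auto simp: PiE_iff)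
      ultimately show "f \<in> (\<Union>r\<in>?R. PiE I (\<lambda>i. ?Ac (r i)))" by blast
    qed
  qed
  also have "\<dots> \<le> card ?R * (\<Sum>r\<in>?R. energy K (pow_sums I) (PiE I (\<lambda>i. ?Ac (r i))))"
    using finR fin by (rule energy_UN_le)
  also have "\<dots> \<le> card ?R * (\<Sum>r\<in>?R. nat p * ?E)"
    by (intro mult_left_mono sum_mono one) auto
  also have "\<dots> = (card ?R)\<^sup>2 * (nat p * ?E)" by (simp add: power2_eq_square)
  also have "\<dots> \<le> (nat p ^ K * K ^ card I)\<^sup>2 * (nat p * ?E)"
    using card_few_values_le[of I "{0..<p}" K] I by (intro mult_right_mono power_mono) auto
  finally show ?thesis .
qed

text \<open>The number of variables is \<open>2 * r\<close>. Lengths are powers of \<open>p\<close>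
  because restriction to a class modulo a power of \<open>p\<close>, followed by rescaling,
  preserves this form.\<close>

definition mean_value :: "nat \<Rightarrow> int \<Rightarrow> nat \<Rightarrow> nat \<Rightarrow> nat" where
  "mean_value K p r m = energy K (pow_sums {..<r}) (PiE {..<r} (\<lambda>_. {0..<p ^ m}))"

text \<open>Exponential sums with equal moduli at every \<open>t\<close> have equal energies: the
  comparison of energies is applied in both directions with a one-element family, which avoids
  transporting tuples along a bijection.\<close>

lemma energy_PiE_eq_mean_value:
  fixes p :: int and I :: "'i set"
  assumes "finite I"
  shows "energy K (pow_sums I) (PiE I (\<lambda>_. {0..<p ^ m})) = mean_value K p (card I) m"
proof -
  let ?J = "{..<card I}"
  have *: "cmod (expsum K t (pow_sums I) (PiE I (\<lambda>_. {0..<p ^ m})))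
      = cmod (expsum K t (pow_sums ?J) (PiE ?J (\<lambda>_. {0..<p ^ m})))" for t
    using assms by (subst (1 2) expsum_PiE) auto
  have fin: "finite (PiE I (\<lambda>_. {0..<p ^ m}))" "finite (PiE ?J (\<lambda>_. {0..<p ^ m}))"
    using assms by (auto intro!: finite_PiE)
  have "real (energy K (pow_sums I) (PiE I (\<lambda>_. {0..<p ^ m})))
      \<le> 1 * (\<Sum>i\<in>{()}. real (energy K (pow_sums ?J) (PiE ?J (\<lambda>_. {0..<p ^ m}))))"
    using fin * by (intro energy_le_sum_energy) auto
  moreover have "real (energy K (pow_sums ?J) (PiE ?J (\<lambda>_. {0..<p ^ m})))
      \<le> 1 * (\<Sum>i\<in>{()}. real (energy K (pow_sums I) (PiE I (\<lambda>_. {0..<p ^ m}))))"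
    using fin * by (intro energy_le_sum_energy) auto
  ultimately show ?thesis by (simp add: mean_value_def)
qed

lemma mean_value_le_trivial:
  assumes "p > 0"
  shows "mean_value K p r m \<le> nat p ^ (2 * r * m)"
proof -
  let ?G = "PiE {..<r} (\<lambda>_. {0..<p ^ m})"
  have fin: "finite ?G" by (auto intro!: finite_PiE)
  have "mean_value K p r m \<le> card (?G \<times> ?G)"
    unfolding mean_value_def diffcount_def using fin by (intro card_mono) auto
  also have "\<dots> = (nat p ^ m) ^ r * (nat p ^ m) ^ r"
    using assms by (simp add: card_cartesian_product card_PiE nat_power_eq)
  also have "\<dots> = nat p ^ (m * r + m * r)" by (simp only: power_mult[symmetric] power_add[symmetric])
  also have "m * r + m * r = 2 * r * m" by simp
  finally show ?thesis .
qed

text \<open>Solutions with \<open>K\<close> variables in distinct residue classes modulo \<open>p\<close> are counted by Linnik's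
  lemma, after Hoelder's inequality has moved the other variables into one class modulo \<open>p ^ e\<close>. The
  residues of all other tuples take fewer than \<open>K\<close> values, and there the problem rescales to
  \<open>m - 1\<close>.\<close>

lemma mean_value_recursion:
  fixes p :: int
  assumes p: "prime p" "int K < p" and K: "K \<ge> 1" and R: "R \<ge> 1" and m: "m \<ge> 1" and em: "e * K \<le> m"
  shows "real (mean_value K p (R + K) m)
    \<le> 2 * real (R + K) ^ (2 * K) * real K ^ K * real (nat p) ^ (2 * e * R + 2 * K * m)
          / real (nat p) ^ (\<Sum>j=1..K. e * j) * real (mean_value K p R (m - e))
      + 2 * real (nat p) ^ (2 * K + 1) * real K ^ (2 * (R + K)) * real (mean_value K p (R + K) (m - 1))"
proof -
  define r where "r = R + K"
  define X where "X = nat p ^ (\<Sum>j=1..K. e * j)"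
  let ?I = "{..<r}" and ?A = "{0..<p ^ m}"
  let ?h = "pow_sums ?I"
  let ?G = "\<lambda>S. {f \<in> PiE ?I (\<lambda>_. ?A). inj_on (\<lambda>i. f i mod p) S}"
  let ?B = "{f \<in> PiE ?I (\<lambda>_. ?A). card ((\<lambda>i. f i mod p) ` ?I) < K}"
  \<comment> \<open>The possible positions of \<open>K\<close> variables with distinct residues.
    There are at most \<open>r ^ K\<close>, and this number enters squared through
    \<open>energy_UN_le\<close>.\<close>
  define F where "F = {S. S \<subseteq> ?I \<and> card S = K}"
  define good where "good = (\<Union>S\<in>F. ?G S)"
  have p0: "p > 0" using p by (simp add: prime_gt_0_int)
  have X0: "X > 0" using p0 by (simp add: X_def)
  have em': "e \<le> m" using em K by (metis le_trans mult.right_neutral mult_le_mono2)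
  have finA: "finite (PiE ?I (\<lambda>_. ?A))" by (auto intro!: finite_PiE)
  have finF: "finite F" by (simp add: F_def)
  have fin: "finite (?G S)" "finite ?B" for S using finA by auto
  have fing: "finite good" unfolding good_def using finF fin by blast
  have cF: "card F \<le> r ^ K"
    unfolding F_def using n_subsets[of ?I K] binomial_le_pow[of K r] by (simp add: r_def)
  have cover: "PiE ?I (\<lambda>_. ?A) = (\<Union>b\<in>{True, False}. if b then good else ?B)"
  proof (intro equalityI subsetI)
    fix f assume f: "f \<in> PiE ?I (\<lambda>_. ?A)"
    show "f \<in> (\<Union>b\<in>{True, False}. if b then good else ?B)"
    proof (cases "card ((\<lambda>i. f i mod p) ` ?I) < K")
      case True
      then show ?thesis using f by simp
    next
      case False
      then obtain T where T: "T \<subseteq> (\<lambda>i. f i mod p) ` ?I" "card T = K"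
        by (metis not_less obtain_subset_with_card_n)
      then obtain S where S: "S \<subseteq> ?I" "inj_on (\<lambda>i. f i mod p) S" "T = (\<lambda>i. f i mod p) ` S"
        by (auto simp: subset_image_inj)
      then have "card S = K" using T by (simp add: card_image)
      then have "f \<in> good" using f S by (auto simp: good_def F_def)
      then show ?thesis by simp
    qed
  qed (auto simp: good_def split: if_splits)
  have "mean_value K p r m \<le> 2 * (energy K ?h good + energy K ?h ?B)"
  proof -
    have "energy K ?h (\<Union>b\<in>{True, False}. if b then good else ?B)
        \<le> card {True, False} * (\<Sum>b\<in>{True, False}. energy K ?h (if b then good else ?B))"
      using fing fin(2) by (intro energy_UN_le) (simp_all split: if_split)
    then show ?thesis unfolding cover[symmetric] mean_value_def by simp
  qed
  then have "mean_value K p r m * X \<le> 2 * (energy K ?h good + energy K ?h ?B) * X"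
    by (rule mult_right_mono) simp
  then have main: "mean_value K p r m * X \<le> 2 * (energy K ?h good * X) + energy K ?h ?B * (2 * X)"
    by (simp only: distrib_left distrib_right mult_ac)
  let ?g = "nat p ^ (2 * e * R) * (K ^ K * nat p ^ (2 * K * m) * mean_value K p R (m - e))"
  have gS: "energy K ?h (?G S) * X \<le> ?g" if "S \<in> F" for S
  proof -
    have S: "S \<subseteq> ?I" "card S = K" using that by (auto simp: F_def)
    have "card S < card ?I" using S R by (simp add: r_def)
    then have ne: "S \<noteq> ?I" by blast
    have c: "card (?I - S) = R" using S by (subst card_Diff_subset) (auto simp: r_def intro: finite_subset)
    show ?thesis
      using energy_conditioned[OF _ S(1,2) ne p em em'] energy_PiE_eq_mean_value[of "?I - S" K p "m - e"]
      by (simp add: X_def c)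
  qed
  have "energy K ?h good * X \<le> card F * (\<Sum>S\<in>F. energy K ?h (?G S)) * X"
    unfolding good_def using finF fin by (intro mult_right_mono energy_UN_le) auto
  also have "\<dots> = card F * (\<Sum>S\<in>F. energy K ?h (?G S) * X)" by (simp only: sum_distrib_right mult.assoc)
  also have "\<dots> \<le> card F * (\<Sum>S\<in>F. ?g)" by (intro mult_left_mono sum_mono gS) auto
  also have "\<dots> = (card F)\<^sup>2 * ?g" by (simp add: power2_eq_square)
  also have "\<dots> \<le> (r ^ K)\<^sup>2 * ?g" using cF by (intro mult_right_mono power_mono) auto
  finally have good: "energy K ?h good * X \<le> (r ^ K)\<^sup>2 * ?g" .
  have bad: "energy K ?h ?B \<le> (nat p ^ K * K ^ r)\<^sup>2 * (nat p * mean_value K p r (m - 1))"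
  proof -
    have "0 \<in> ?I" using R by (simp add: r_def)
    then have "?I \<noteq> {}" by blast
    from energy_few_residues[OF _ this p0 m, of K] show ?thesis by (simp add: mean_value_def)
  qed
  have "mean_value K p r m * X \<le> 2 * ((r ^ K)\<^sup>2 * ?g) + 2 * ((nat p ^ K * K ^ r)\<^sup>2 * (nat p * mean_value K p r (m - 1))) * X"
  proof -
    have "energy K ?h ?B * (2 * X) \<le> (nat p ^ K * K ^ r)\<^sup>2 * (nat p * mean_value K p r (m - 1)) * (2 * X)"
      by (rule mult_right_mono[OF bad]) simp
    also have "\<dots> = 2 * ((nat p ^ K * K ^ r)\<^sup>2 * (nat p * mean_value K p r (m - 1))) * X" by (simp only: mult_ac)
    finally show ?thesis using main good by linarith
  qed
  then have "real (mean_value K p r m * X) \<le> real (2 * ((r ^ K)\<^sup>2 * ?g) + 2 * ((nat p ^ K * K ^ r)\<^sup>2 * (nat p * mean_value K p r (m - 1))) * X)"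
    by (simp only: of_nat_le_iff)
  then have "real (mean_value K p r m) \<le> 2 * ((real r ^ K)\<^sup>2 * (real (nat p) ^ (2 * e * R) * (real K ^ K * real (nat p) ^ (2 * K * m) * real (mean_value K p R (m - e))))) / real X
     + 2 * ((real (nat p) ^ K * real K ^ r)\<^sup>2 * (real (nat p) * real (mean_value K p r (m - 1))))"
    using X0 by (simp add: field_simps)
  also have "2 * ((real r ^ K)\<^sup>2 * (real (nat p) ^ (2 * e * R) * (real K ^ K * real (nat p) ^ (2 * K * m) * real (mean_value K p R (m - e))))) / real X
     = 2 * real r ^ (2 * K) * real K ^ K * real (nat p) ^ (2 * e * R + 2 * K * m) / real X * real (mean_value K p R (m - e))"
    by (simp add: power_add power_mult[symmetric] mult_ac)
  also have "2 * ((real (nat p) ^ K * real K ^ r)\<^sup>2 * (real (nat p) * real (mean_value K p r (m - 1))))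
     = 2 * real (nat p) ^ (2 * K + 1) * real K ^ (2 * r) * real (mean_value K p r (m - 1))"
    by (simp add: power_mult_distrib power_mult[symmetric] mult_ac)
  finally show ?thesis by (simp add: r_def X_def)
qed

text \<open>The ideal exponent is \<open>m * (2 * r - Kp)\<close> with
  \<open>r = K * (K + t)\<close> and \<open>Kp\<close> the sum of the degrees;
  \<open>Kp * (1 - 1 / K) ^ t\<close> is the excess, which at \<open>t = 0\<close> is that of the
  trivial bound. The outer induction adds a block of \<open>K\<close> variables. The inner one, on
  \<open>m\<close>, handles the term of the recursion that keeps their number. Each of the two terms
  receives half of the bound.\<close>

lemma mean_value_bound:
  fixes p :: int and K t m :: nat
  defines "P \<equiv> real (nat p)"
  defines "Kp \<equiv> real K * (real K + 1) / 2"
  assumes p: "prime p" and K: "K \<ge> 4" "real K ^ 4 \<le> P" and r: "real (K * (K + t)) \<le> P"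
  shows "real (mean_value K p (K * (K + t)) m)
    \<le> P powr (2 * real K ^ 2 * real t + real m * (2 * real (K * (K + t)) - Kp + Kp * (1 - 1 / real K) ^ t))"
  using r
proof (induction t arbitrary: m)
  case 0
  have p0: "p > 0" using p by (simp add: prime_gt_0_int)
  then have "real (mean_value K p (K * K) m) \<le> real (nat p ^ (2 * (K * K) * m))"
    using mean_value_le_trivial[OF p0, of K "K * K" m] by (simp only: of_nat_le_iff)
  also have "\<dots> = P powr real (2 * (K * K) * m)"
    using p0 powr_realpow[of P "2 * (K * K) * m"] by (simp add: P_def)
  finally show ?case by (simp add: mult_ac)
next
  case (Suc t)
  define R where "R = K * (K + t)"
  define r where "r = R + K"
  define \<eta> where "\<eta> = Kp * (1 - 1 / real K) ^ t"
  define \<eta>' where "\<eta>' = Kp * (1 - 1 / real K) ^ Suc t"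
  define c where "c = 2 * real K ^ 2"
  have req: "K * (K + Suc t) = r" by (simp add: r_def R_def)
  have p0: "p > 0" using p by (simp add: prime_gt_0_int)
  have K4: "real K \<ge> 4" using K by simp
  define y where "y = real K * real K"
  have K2: "4 * real K \<le> y" unfolding y_def using K4 by (intro mult_right_mono) auto
  have KK: "real K \<le> real K ^ 4" using K4 by (intro self_le_power) auto
  have "256 \<le> real K ^ 4" using power_mono[OF K4, of 4] by simp
  then have P4: "P \<ge> 256" using K(2) by linarith
  have Kp: "int K < p"
  proof -
    have "real K * 64 \<le> real K * real K ^ 3" using power_mono[OF K4, of 3] by (intro mult_left_mono) auto
    then have "real K < real K ^ 4" using K4 by (simp add: eval_nat_numeral)
    then have "real K < P" using K(2) by linarith
    then have "real_of_int (int K) < real_of_int p" using p0 by (simp add: P_def)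
    then show ?thesis by (simp only: of_int_less_iff)
  qed
  have R1: "R \<ge> 1" "K \<ge> 1" using K by (auto simp: R_def)
  have rR: "real r = real R + real K" by (simp add: r_def)
  have rK: "real r \<ge> real K ^ 2 + real K" by (simp add: rR R_def power2_eq_square distrib_left)
  have rP: "real r \<le> P" using Suc.prems unfolding req .
  have \<eta>0: "0 \<le> \<eta>" "\<eta> \<le> Kp" "0 \<le> \<eta>'"
  proof -
    have "0 \<le> 1 - 1 / real K" "1 - 1 / real K \<le> 1" using K4 by auto
    then show "0 \<le> \<eta>" "\<eta> \<le> Kp" "0 \<le> \<eta>'"
      unfolding \<eta>_def \<eta>'_def Kp_def using power_le_one[of "1 - 1 / real K" t]
      by (auto intro!: mult_left_le)
  qed
  have IH: "real (mean_value K p R m) \<le> P powr (c * real t + real m * (2 * real R - Kp + \<eta>))" for m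
  proof -
    have "real (K * (K + t)) \<le> P" using Suc.prems by (simp add: algebra_simps)
    from Suc.IH[OF this, of m] show ?thesis by (simp add: c_def R_def \<eta>_def)
  qed
  define E where "E = 2 * real r - Kp + \<eta>'"
  have goal: "real (mean_value K p r m) \<le> P powr (c * real (Suc t) + real m * E)" for m
  proof (induction m)
    case 0
    have "real (mean_value K p r 0) \<le> 1"
      using mean_value_le_trivial[OF p0, of K r 0] by simp
    also have "1 \<le> P powr (c * real (Suc t) + real 0 * E)"
      using P4 by (intro ge_one_powr_ge_zero) (auto simp: c_def)
    finally show ?case .
  next
    case (Suc m')
    define m where "m = Suc m'"
    \<comment> \<open>The largest \<open>e\<close> that the Linnik count admits. Replacing
      \<open>m\<close> by \<open>m - e\<close> shrinks the excess by the factor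
      \<open>1 - 1 / K\<close>, and rounding costs at most \<open>P powr Kp\<close>, for which
      \<open>c\<close> has room.\<close>
    define e where "e = m div K"
    have em: "e * K \<le> m" by (simp add: e_def)
    have em': "e \<le> m" by (simp add: e_def)
    have eK: "real e \<ge> real m / real K - 1"
    proof -
      have "m mod K < K" using K by simp
      then have "m \<le> e * K + K" using div_mult_mod_eq[of m K] unfolding e_def by linarith
      then have "real m \<le> real (e * K + K)" by (simp only: of_nat_le_iff)
      then have "real m \<le> (real e + 1) * real K" by (simp add: distrib_right)
      then show ?thesis using K4 by (simp add: field_simps)
    qed
    have sum_j: "real (\<Sum>j=1..K. e * j) = real e * Kp"
    proof -
      have "(\<Sum>j=1..k. real j) = real k * (real k + 1) / 2" for k
        by (induction k) (simp_all add: field_simps)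
      then show ?thesis by (simp add: sum_distrib_left[symmetric] Kp_def)
    qed
    have Pp: "P ^ k = P powr real k" for k using P4 by (simp add: powr_realpow)
    have rec: "real (mean_value K p r m)
        \<le> 2 * real r ^ (2 * K) * real K ^ K * P ^ (2 * e * R + 2 * K * m) / P ^ (\<Sum>j=1..K. e * j) * real (mean_value K p R (m - e))
          + 2 * P ^ (2 * K + 1) * real K ^ (2 * r) * real (mean_value K p r (m - 1))"
      using mean_value_recursion[OF p Kp R1(2) R1(1) _ em] by (simp add: m_def r_def P_def)
    have "4 * real r ^ (2 * K) * real K ^ K \<le> P * P ^ (2 * K) * P ^ K"
    proof -
      have "real K \<le> P" using KK K(2) by linarith
      then show ?thesis using rP P4 by (intro mult_mono power_mono) auto
    qed
    also have "P * P ^ (2 * K) * P ^ K = P ^ (1 + 2 * K + K)" by (simp only: power_add power_one_right)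
    also have "\<dots> = P powr (1 + 3 * real K)" unfolding Pp by (rule arg_cong[of _ _ "(powr) P"]) simp
    finally have c1: "2 * real r ^ (2 * K) * real K ^ K \<le> P powr (1 + 3 * real K) / 2" by simp
    have ex1: "(2 * real e * real R + 2 * real K * real m) - real e * Kp + (c * real t + (real m - real e) * (2 * real R - Kp + \<eta>)) + (1 + 3 * real K)
        \<le> c * real (Suc t) + real m * E"
    proof -
      have "(real m - real e) * \<eta> \<le> (real m - (real m / real K - 1)) * \<eta>"
        using eK \<eta>0 by (intro mult_right_mono) auto
      also have "\<dots> = real m * \<eta>' + \<eta>"
        by (simp add: \<eta>'_def \<eta>_def algebra_simps)
      also have "\<dots> \<le> real m * \<eta>' + Kp" using \<eta>0 by simp
      finally have 1: "(real m - real e) * \<eta> \<le> real m * \<eta>' + Kp" .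
      have 2: "Kp + 1 + 3 * real K \<le> c"
        using K2 K4 unfolding Kp_def c_def power2_eq_square distrib_left mult_1_right y_def[symmetric]
        by (simp add: field_simps)
      have "(2 * real e * real R + 2 * real K * real m) - real e * Kp + (c * real t + (real m - real e) * (2 * real R - Kp + \<eta>)) + (1 + 3 * real K)
          = c * real t + real m * (2 * real r - Kp) + (real m - real e) * \<eta> + (1 + 3 * real K)"
        by (simp add: rR algebra_simps)
      also have "\<dots> \<le> c * real t + real m * (2 * real r - Kp) + real m * \<eta>' + c"
        using 1 2 by linarith
      also have "\<dots> = c * real (Suc t) + real m * E" by (simp add: E_def algebra_simps)
      finally show ?thesis .
    qed
    have "2 * real r ^ (2 * K) * real K ^ K * P ^ (2 * e * R + 2 * K * m) / P ^ (\<Sum>j=1..K. e * j) * real (mean_value K p R (m - e))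
       \<le> (P powr (1 + 3 * real K) / 2) * P ^ (2 * e * R + 2 * K * m) / P ^ (\<Sum>j=1..K. e * j) * P powr (c * real t + real (m - e) * (2 * real R - Kp + \<eta>))"
      using P4 by (intro mult_mono divide_right_mono mult_right_mono c1 IH) auto
    also have "\<dots> = P powr ((2 * real e * real R + 2 * real K * real m) - real e * Kp + (c * real t + (real m - real e) * (2 * real R - Kp + \<eta>)) + (1 + 3 * real K)) / 2"
    proof -
      have gen: "P powr x / 2 * P ^ a / P ^ b * P powr y = P powr (real a - real b + y + x) / 2" for a b x y
        unfolding Pp powr_add powr_diff by (simp add: mult_ac)
      show ?thesis unfolding gen sum_j of_nat_diff[OF em'] by simp
    qed
    also have "\<dots> \<le> P powr (c * real (Suc t) + real m * E) / 2"
      using P4 by (intro divide_right_mono powr_mono ex1) auto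
    finally have t1: "2 * real r ^ (2 * K) * real K ^ K * P ^ (2 * e * R + 2 * K * m) / P ^ (\<Sum>j=1..K. e * j) * real (mean_value K p R (m - e))
       \<le> P powr (c * real (Suc t) + real m * E) / 2" .
    \<comment> \<open>The degenerate tuples. From \<open>K ^ 4 \<le> P\<close> the factor
      \<open>K ^ (2 * r)\<close> is at most \<open>P powr (r / 2)\<close>, and having at least
      \<open>K ^ 2 + K\<close> for \<open>r\<close> makes \<open>2 * r - Kp\<close> large enough to
      pay for this and for \<open>P ^ (2 * K + 1)\<close>.\<close>
    have c2: "4 * (P ^ (2 * K + 1) * real K ^ (2 * r)) \<le> P powr E"
    proof -
      have "(real K ^ (2 * r))\<^sup>2 = (real K ^ 4) ^ r" by (simp add: power_mult[symmetric] mult.commute)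
      also have "\<dots> \<le> P ^ r" using K by (intro power_mono) auto
      also have "\<dots> = (P powr (real r / 2))\<^sup>2" using P4 by (simp add: Pp power2_eq_square powr_add[symmetric])
      finally have "real K ^ (2 * r) \<le> P powr (real r / 2)" by (rule power2_le_imp_le) simp
      then have "4 * (P ^ (2 * K + 1) * real K ^ (2 * r)) \<le> P * (P ^ (2 * K + 1) * P powr (real r / 2))"
        using P4 by (intro mult_mono) auto
      also have "\<dots> = P powr (1 + (real (2 * K + 1) + real r / 2))"
        using P4 unfolding Pp powr_add by simp
      also have "\<dots> \<le> P powr E"
      proof (rule powr_mono)
        have "3 / 2 * real r \<ge> Kp + 2 * real K + 2"
          using rK K2 K4 unfolding Kp_def power2_eq_square distrib_left mult_1_right y_def[symmetric]
          by (simp add: field_simps)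
        then show "1 + (real (2 * K + 1) + real r / 2) \<le> E" using \<eta>0 by (simp add: E_def)
      qed (use P4 in simp)
      finally show ?thesis .
    qed
    have "2 * P ^ (2 * K + 1) * real K ^ (2 * r) * real (mean_value K p r (m - 1))
        \<le> (P powr E / 2) * P powr (c * real (Suc t) + real m' * E)"
      using c2 Suc.IH by (intro mult_mono) (auto simp: m_def)
    also have "\<dots> = P powr (c * real (Suc t) + real m * E) / 2"
      by (simp add: powr_add[symmetric] m_def algebra_simps)
    finally have t2: "2 * P ^ (2 * K + 1) * real K ^ (2 * r) * real (mean_value K p r (m - 1))
        \<le> P powr (c * real (Suc t) + real m * E) / 2" .
    show ?case using rec t1 t2 unfolding m_def by linarith
  qed
  show ?case using goal[of m] unfolding req by (simp add: E_def c_def \<eta>'_def)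
qed

section \<open>Bilinear sums\<close>

text \<open>Hoelder in \<open>x\<close> opens the \<open>2 * b\<close>-th power of the sum over
  \<open>y\<close>. The number \<open>c l\<close> of representations of a vector \<open>l\<close> of
  power sum differences then weights the one-variable sums \<open>F\<close> with coefficients
  \<open>\<alpha> k * l k\<close>. The second Hoelder step makes the sum over \<open>l\<close>
  unweighted on a box, and opening \<open>F\<close> again gives a second vector,
  \<open>\<mu>\<close>. The bound \<open>c l \<le> J\<close> is used once for each vector, hence
  \<open>J ^ 2\<close>.\<close>

lemma double_sum_bound:
  fixes P :: int and \<alpha> :: "nat \<Rightarrow> real" and K b :: nat
  defines "A \<equiv> {0..<P}"
  defines "G \<equiv> PiE {..<b} (\<lambda>_. A)"
  defines "J \<equiv> real (energy K (pow_sums {..<b}) G)"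
  defines "H \<equiv> (\<lambda>k. int b * P ^ k)"
  assumes P: "P > 0" and b: "b \<ge> 1"
  shows "cmod (\<Sum>x\<in>A. \<Sum>y\<in>A. cis (2 * pi * (\<Sum>k=1..K. \<alpha> k * of_int (x * y) ^ k))) ^ (4 * b\<^sup>2)
    \<le> real_of_int P ^ (4 * b * (2 * b - 1)) * J\<^sup>2
        * (\<Prod>k=1..K. \<Sum>\<mu>\<in>{- H k..H k}. cmod (\<Sum>l\<in>{- H k..H k}. cis (2 * pi * (\<alpha> k * of_int l * of_int \<mu>))))"
    (is "cmod ?W ^ _ \<le> _")
proof -
  let ?s = "pow_sums {..<b}"
  define F where "F t = expsum K t (power :: int \<Rightarrow> nat \<Rightarrow> int) A" for t
  define key where "key = (\<lambda>(g, g'). \<lambda>k\<in>{1..K}. ?s g k - ?s g' k)"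
  define Box where "Box = PiE {1..K} (\<lambda>k. {- H k..H k})"
  define c where "c l = real (card {x \<in> G \<times> G. key x = l})" for l
  define v where "v k \<mu> = cmod (\<Sum>l\<in>{- H k..H k}. cis (2 * pi * (\<alpha> k * of_int l * of_int \<mu>)))" for k \<mu>
  define B where "B = (\<Prod>k=1..K. \<Sum>\<mu>\<in>{- H k..H k}. v k \<mu>)"
  have finA: "finite A" by (simp add: A_def)
  have finG: "finite G" unfolding G_def using finA by (auto intro!: finite_PiE)
  have finBox: "finite Box" unfolding Box_def by (auto intro!: finite_PiE)
  have cardA: "real (card A) = of_int P" using P by (simp add: A_def)
  have pow_b: "expsum K t ?s G = F t ^ b" for t
    unfolding G_def F_def using finA by (subst expsum_PiE) auto
  have F2b: "complex_of_real (cmod (F t) ^ (2 * b))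
      = (\<Sum>x\<in>G \<times> G. cis (2 * pi * (\<Sum>k=1..K. t k * of_int (key x k))))" for t
  proof -
    have "cmod (F t) ^ (2 * b) = (cmod (expsum K t ?s G))\<^sup>2"
      by (simp add: pow_b norm_power power_mult[symmetric] mult.commute)
    moreover have "(\<Sum>x\<in>G \<times> G. cis (2 * pi * (\<Sum>k=1..K. t k * of_int (key x k))))
        = (\<Sum>(g, g')\<in>G \<times> G. cis (2 * pi * (\<Sum>k=1..K. t k * of_int (?s g k - ?s g' k))))"
      by (intro sum.cong refl) (auto simp: key_def)
    ultimately show ?thesis by (simp only: expsum_norm_square)
  qed
  have keyBox: "key x \<in> Box" if "x \<in> G \<times> G" for x
  proof -
    obtain g g' where x: "x = (g, g')" by (cases x)
    have pb: "0 \<le> ?s h k \<and> ?s h k \<le> H k" if "h \<in> G" for h k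
    proof -
      have h: "0 \<le> h i" "h i \<le> P" if "i < b" for i using \<open>h \<in> G\<close> that by (auto simp: G_def A_def PiE_iff less_imp_le)
      have "?s h k \<le> (\<Sum>i<b. P ^ k)" unfolding pow_sums_def using h by (intro sum_mono power_mono) auto
      moreover have "0 \<le> ?s h k" unfolding pow_sums_def using h by (intro sum_nonneg) auto
      ultimately show ?thesis by (simp add: H_def)
    qed
    have "g \<in> G" "g' \<in> G" using that x by auto
    then have "- H k \<le> ?s g k - ?s g' k \<and> ?s g k - ?s g' k \<le> H k" for k
      using pb[of g k] pb[of g' k] by linarith
    then show ?thesis by (simp add: key_def Box_def x)
  qed
  have group: "(\<Sum>x\<in>G \<times> G. f (key x)) = (\<Sum>l\<in>Box. c l * f l)" for f :: "(nat \<Rightarrow> int) \<Rightarrow> real"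
  proof -
    have "(\<Sum>x\<in>G \<times> G. f (key x)) = (\<Sum>l\<in>Box. \<Sum>x\<in>{x \<in> G \<times> G. key x = l}. f (key x))"
      using finG finBox keyBox by (intro sum.group[symmetric]) auto
    also have "\<dots> = (\<Sum>l\<in>Box. c l * f l)"
      by (intro sum.cong refl) (simp add: c_def)
    finally show ?thesis .
  qed
  have cJ: "c l \<le> J" for l
  proof -
    have "{x \<in> G \<times> G. key x = l} \<subseteq> {(g, g'). g \<in> G \<and> g' \<in> G \<and> (\<forall>j\<in>{1..K}. ?s g j - ?s g' j = l j)}"
      by (auto simp: key_def)
    then have "card {x \<in> G \<times> G. key x = l} \<le> diffcount K ?s G l"
      unfolding diffcount_def by (intro card_mono) (auto intro: finite_subset[of _ "G \<times> G"] simp: finG)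
    also have "\<dots> \<le> energy K ?s G" by (rule diffcount_le_energy[OF finG])
    finally show ?thesis by (simp add: c_def J_def)
  qed
  have c0: "c l \<ge> 0" for l by (simp add: c_def)
  have sumc: "(\<Sum>l\<in>Box. c l) = of_int P ^ (2 * b)"
  proof -
    have "(\<Sum>l\<in>Box. c l) = (\<Sum>x\<in>G \<times> G. 1)" using group[of "\<lambda>_. 1"] by simp
    also have "\<dots> = real (card A ^ b * card A ^ b)" by (simp add: card_cartesian_product G_def card_PiE)
    also have "\<dots> = of_int P ^ (2 * b)" using cardA by (simp add: mult_2 power_add)
    finally show ?thesis .
  qed
  have J0: "J \<ge> 0" by (simp add: J_def)
  text \<open>Summing over the box of all possible differences of power sums decouples the degrees.\<close>
  have boxF: "(\<Sum>l\<in>Box. cmod (F (\<lambda>k. \<alpha> k * of_int (l k))) ^ (2 * b)) \<le> J * B"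
  proof -
    have "complex_of_real (\<Sum>l\<in>Box. cmod (F (\<lambda>k. \<alpha> k * of_int (l k))) ^ (2 * b))
        = (\<Sum>l\<in>Box. \<Sum>x\<in>G \<times> G. cis (2 * pi * (\<Sum>k=1..K. \<alpha> k * of_int (l k) * of_int (key x k))))"
      by (simp only: of_real_sum F2b)
    also have "\<dots> = (\<Sum>x\<in>G \<times> G. \<Sum>l\<in>Box. \<Prod>k=1..K. cis (2 * pi * (\<alpha> k * of_int (l k) * of_int (key x k))))"
      by (subst sum.swap) (simp only: sum_distrib_left cis_sum)
    also have "\<dots> = (\<Sum>x\<in>G \<times> G. \<Prod>k=1..K. \<Sum>l\<in>{- H k..H k}. cis (2 * pi * (\<alpha> k * of_int l * of_int (key x k))))"
      unfolding Box_def by (intro sum.cong refl prod_sum_PiE[symmetric]) auto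
    finally have eq: "complex_of_real (\<Sum>l\<in>Box. cmod (F (\<lambda>k. \<alpha> k * of_int (l k))) ^ (2 * b)) = \<dots>" .
    have "(\<Sum>l\<in>Box. cmod (F (\<lambda>k. \<alpha> k * of_int (l k))) ^ (2 * b))
        = cmod (complex_of_real (\<Sum>l\<in>Box. cmod (F (\<lambda>k. \<alpha> k * of_int (l k))) ^ (2 * b)))"
      unfolding norm_of_real by (intro abs_of_nonneg[symmetric] sum_nonneg) simp
    also have "\<dots> \<le> (\<Sum>x\<in>G \<times> G. \<Prod>k=1..K. v k (key x k))"
      unfolding eq by (rule sum_norm_le) (simp add: v_def prod_norm)
    also have "\<dots> = (\<Sum>l\<in>Box. c l * (\<Prod>k=1..K. v k (l k)))" by (rule group)
    also have "\<dots> \<le> (\<Sum>l\<in>Box. J * (\<Prod>k=1..K. v k (l k)))"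
      by (intro sum_mono mult_right_mono cJ prod_nonneg) (auto simp: v_def)
    also have "\<dots> = J * B"
      unfolding B_def Box_def sum_distrib_left[symmetric] by (subst prod_sum_PiE) auto
    finally show ?thesis .
  qed
  define Z where "Z = (\<Sum>l\<in>Box. c l * cmod (F (\<lambda>k. \<alpha> k * of_int (l k))))"
  have Z0: "Z \<ge> 0" unfolding Z_def by (intro sum_nonneg mult_nonneg_nonneg c0) simp
  have W1: "cmod ?W ^ (2 * b) \<le> of_int P ^ (2 * b - 1) * Z"
  proof -
    have "?W = (\<Sum>x\<in>A. F (\<lambda>k. \<alpha> k * of_int x ^ k))"
      by (simp add: F_def expsum_def power_mult_distrib mult.assoc)
    then have "cmod ?W \<le> (\<Sum>x\<in>A. cmod (F (\<lambda>k. \<alpha> k * of_int x ^ k)))" by (simp add: norm_sum)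
    then have "cmod ?W ^ (2 * b) \<le> (\<Sum>x\<in>A. cmod (F (\<lambda>k. \<alpha> k * of_int x ^ k))) ^ (2 * b)"
      by (rule power_mono) simp
    also have "\<dots> \<le> of_int P ^ (2 * b - 1) * (\<Sum>x\<in>A. cmod (F (\<lambda>k. \<alpha> k * of_int x ^ k)) ^ (2 * b))"
      unfolding cardA[symmetric] using b by (intro power_mean_card) auto
    also have "(\<Sum>x\<in>A. cmod (F (\<lambda>k. \<alpha> k * of_int x ^ k)) ^ (2 * b)) \<le> Z"
    proof -
      have "complex_of_real (\<Sum>x\<in>A. cmod (F (\<lambda>k. \<alpha> k * of_int x ^ k)) ^ (2 * b))
         = (\<Sum>x\<in>A. \<Sum>y\<in>G \<times> G. cis (2 * pi * (\<Sum>k=1..K. \<alpha> k * of_int x ^ k * of_int (key y k))))"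
        by (simp only: of_real_sum F2b)
      also have "\<dots> = (\<Sum>y\<in>G \<times> G. F (\<lambda>k. \<alpha> k * of_int (key y k)))"
        by (subst sum.swap) (simp add: F_def expsum_def mult_ac)
      finally have eq: "complex_of_real (\<Sum>x\<in>A. cmod (F (\<lambda>k. \<alpha> k * of_int x ^ k)) ^ (2 * b)) = \<dots>" .
      have "(\<Sum>x\<in>A. cmod (F (\<lambda>k. \<alpha> k * of_int x ^ k)) ^ (2 * b))
          = cmod (complex_of_real (\<Sum>x\<in>A. cmod (F (\<lambda>k. \<alpha> k * of_int x ^ k)) ^ (2 * b)))"
        unfolding norm_of_real by (intro abs_of_nonneg[symmetric] sum_nonneg) simp
      also have "\<dots> \<le> (\<Sum>y\<in>G \<times> G. cmod (F (\<lambda>k. \<alpha> k * of_int (key y k))))"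
        unfolding eq by (rule norm_sum)
      also have "\<dots> = Z" unfolding Z_def by (rule group)
      finally show ?thesis .
    qed
    finally show ?thesis using P by simp
  qed
  have Z1: "Z ^ (2 * b) \<le> of_int P ^ (2 * b * (2 * b - 1)) * J * (J * B)"
  proof -
    let ?f = "\<lambda>l. cmod (F (\<lambda>k. \<alpha> k * of_int (l k)))"
    have P1: "real_of_int P \<ge> 0" using P by simp
    have "Z ^ b \<le> (\<Sum>l\<in>Box. c l) ^ (b - 1) * (\<Sum>l\<in>Box. c l * ?f l ^ b)"
      using weighted_power_mean[of Box c ?f "b - 1"] c0 b by (simp add: Z_def)
    then have "(Z ^ b)\<^sup>2 \<le> ((\<Sum>l\<in>Box. c l) ^ (b - 1) * (\<Sum>l\<in>Box. c l * ?f l ^ b))\<^sup>2"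
      using Z0 by (intro power_mono) auto
    also have "\<dots> = of_int P ^ (4 * b * (b - 1)) * (\<Sum>l\<in>Box. c l * ?f l ^ b)\<^sup>2"
      unfolding sumc by (simp add: power_mult_distrib power_mult[symmetric] mult_ac)
    \<comment> \<open>Cauchy-Schwarz separates the weights from the sums: the weights yield
      \<open>J * P ^ (2 * b)\<close>, and the \<open>2 * b\<close>-th powers are left to be summed
      over the whole box.\<close>
    also have "\<dots> \<le> of_int P ^ (4 * b * (b - 1)) * ((\<Sum>l\<in>Box. (c l)\<^sup>2) * (\<Sum>l\<in>Box. (?f l ^ b)\<^sup>2))"
      using P1 by (intro mult_left_mono Cauchy_Schwarz_ineq_sum) auto
    also have "\<dots> \<le> of_int P ^ (4 * b * (b - 1)) * ((J * of_int P ^ (2 * b)) * (J * B))"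
    proof (intro mult_left_mono mult_mono)
      have "(\<Sum>l\<in>Box. (c l)\<^sup>2) \<le> (\<Sum>l\<in>Box. J * c l)"
        unfolding power2_eq_square by (intro sum_mono mult_right_mono cJ c0)
      then show "(\<Sum>l\<in>Box. (c l)\<^sup>2) \<le> J * of_int P ^ (2 * b)" by (simp add: sum_distrib_left[symmetric] sumc)
      show "(\<Sum>l\<in>Box. (?f l ^ b)\<^sup>2) \<le> J * B" using boxF by (simp add: power_mult[symmetric] mult.commute)
    qed (use P1 J0 in \<open>auto intro!: sum_nonneg\<close>)
    also have "\<dots> = of_int P ^ (4 * b * (b - 1) + 2 * b) * J * (J * B)" by (simp add: power_add mult_ac)
    also have "4 * b * (b - 1) + 2 * b = 2 * b * (2 * b - 1)" using b by (cases b) (simp_all add: algebra_simps)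
    finally show ?thesis by (simp add: power_mult[symmetric] mult.commute)
  qed
  have "cmod ?W ^ (4 * b\<^sup>2) = (cmod ?W ^ (2 * b)) ^ (2 * b)"
    by (simp add: power_mult[symmetric] power2_eq_square mult_ac)
  also have "\<dots> \<le> (of_int P ^ (2 * b - 1) * Z) ^ (2 * b)" by (rule power_mono[OF W1]) simp
  also have "\<dots> = of_int P ^ (2 * b * (2 * b - 1)) * Z ^ (2 * b)"
    by (simp add: power_mult_distrib power_mult[symmetric] mult.commute)
  also have "\<dots> \<le> of_int P ^ (2 * b * (2 * b - 1)) * (of_int P ^ (2 * b * (2 * b - 1)) * J * (J * B))"
    using P by (intro mult_left_mono Z1) auto
  also have "\<dots> = of_int P ^ (2 * b * (2 * b - 1) + 2 * b * (2 * b - 1)) * J\<^sup>2 * B"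
    by (simp only: power_add power2_eq_square mult_ac)
  also have "2 * b * (2 * b - 1) + 2 * b * (2 * b - 1) = 4 * b * (2 * b - 1)" by simp
  finally show ?thesis unfolding B_def v_def .
qed

lemma sum_cis_full_period:
  fixes Q c B l :: int
  assumes "Q > 0" "c \<ge> 0"
  shows "(\<Sum>\<mu>\<in>{B..<B + c * Q}. cis (2 * pi * (of_int (l * \<mu>) / of_int Q)))
    = (if Q dvd l then of_int (c * Q) else 0)"
proof (cases "Q dvd l")
  case True
  then obtain k where k: "l = Q * k" by auto
  have "cis (2 * pi * (of_int (l * \<mu>) / of_int Q)) = 1" for \<mu>
    using cis_2pi_int[of "k * \<mu>"] assms by (simp add: k)
  then show ?thesis using True assms by simp
next
  case False
  define w where "w = cis (2 * pi * (of_int l / of_int Q))"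
  define n where "n = nat (c * Q)"
  have n: "int n = c * Q" using assms by (simp add: n_def)
  have w1: "w ^ n = 1"
  proof -
    have "real n * of_int l = of_int Q * of_int (c * l)" by (metis mult.assoc mult.commute n of_int_mult of_int_of_nat_eq)
    then have "real n * (of_int l / of_int Q) = of_int (c * l)" using assms by (simp add: field_simps)
    then have "2 * pi * of_int (c * l) = real n * (2 * pi * (of_int l / of_int Q))" by (metis mult.left_commute)
    then show ?thesis using cis_2pi_int[of "c * l"] unfolding w_def Complex.DeMoivre by simp
  qed
  have "w \<noteq> 1"
  proof
    assume "w = 1"
    then have "cos (2 * pi * (of_int l / of_int Q)) = 1"
      by (simp add: w_def complex_eq_iff)
    then obtain k :: int where "2 * pi * (of_int l / of_int Q) = of_int k * 2 * pi"
      using cos_one_2pi_int by auto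
    then have "of_int l = real_of_int (k * Q)"
      using assms by (simp add: field_simps)
    then have "l = k * Q" by (simp only: of_int_eq_iff)
    then show False using False by simp
  qed
  then have geo: "(\<Sum>j<n. w ^ j) = 0" by (simp add: geometric_sum w1)
  have "(\<Sum>\<mu>\<in>{B..<B + c * Q}. cis (2 * pi * (of_int (l * \<mu>) / of_int Q)))
      = (\<Sum>j<n. cis (2 * pi * (of_int (l * (B + int j)) / of_int Q)))"
    by (rule sum.reindex_bij_witness[where i = "\<lambda>j. B + int j" and j = "\<lambda>\<mu>. nat (\<mu> - B)"]) (auto simp: n[symmetric])
  also have "\<dots> = (\<Sum>j<n. cis (2 * pi * (of_int (l * B) / of_int Q)) * w ^ j)"
    unfolding w_def Complex.DeMoivre cis_mult
    by (intro sum.cong refl arg_cong[of _ _ cis]) (simp add: ring_distribs add_divide_distrib mult_ac)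
  also have "\<dots> = 0" by (simp only: sum_distrib_left[symmetric] geo mult_zero_right)
  finally show ?thesis using False by simp
qed

lemma card_residues_interval_le:
  fixes H Q x c :: int
  assumes "H \<ge> 0" "2 * H + 1 \<le> c * Q" "Q > 0" "c \<ge> 0"
  shows "card {y \<in> {- H..H}. Q dvd x - y} \<le> nat c"
proof -
  have "{y \<in> {- H..H}. Q dvd x - y} \<subseteq> (\<lambda>z. z - H) ` {z \<in> {0..<Q * c}. [z = x + H] (mod Q)}"
  proof
    fix y assume y: "y \<in> {y \<in> {- H..H}. Q dvd x - y}"
    then have "Q dvd (y + H) - (x + H)" by (simp add: dvd_diff_commute)
    then have "[y + H = x + H] (mod Q)" by (simp add: cong_iff_dvd_diff)
    then have "y + H \<in> {z \<in> {0..<Q * c}. [z = x + H] (mod Q)}" using y assms by (simp add: mult.commute)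
    then show "y \<in> (\<lambda>z. z - H) ` {z \<in> {0..<Q * c}. [z = x + H] (mod Q)}" by (intro image_eqI[of _ _ "y + H"]) auto
  qed
  moreover have fin: "finite {z \<in> {0..<Q * c}. [z = x + H] (mod Q)}"
    by (rule finite_subset[of _ "{0..<Q * c}"]) auto
  ultimately have "card {y \<in> {- H..H}. Q dvd x - y} \<le> card ((\<lambda>z. z - H) ` {z \<in> {0..<Q * c}. [z = x + H] (mod Q)})"
    by (intro card_mono) auto
  also have "\<dots> \<le> card {z \<in> {0..<Q * c}. [z = x + H] (mod Q)}" using fin by (rule card_image_le)
  also have "\<dots> \<le> nat c" using assms by (intro card_cong_interval_le) auto
  finally show ?thesis .
qed

text \<open>Against the trivial bound this saves \<open>1 / sqrt Q + sqrt Q / (2 * H + 1)\<close>.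
  By Cauchy-Schwarz a mean square over \<open>\<mu>\<close> suffices; extending \<open>\<mu>\<close>
  to \<open>c\<close> full periods modulo \<open>Q\<close> turns it into a count of pairs
  \<open>l\<close>, \<open>l'\<close> congruent modulo \<open>Q\<close>, so that no logarithms
  arise.\<close>

lemma bilinear_sum_bound:
  fixes H Q a :: int
  assumes "H \<ge> 0" "Q > 0" "coprime a Q"
  shows "(\<Sum>\<mu>\<in>{- H..H}. cmod (\<Sum>l\<in>{- H..H}. cis (2 * pi * (of_int (a * l * \<mu>) / of_int Q))))
    \<le> of_int (2 * H + 1) * sqrt (of_int Q) * (of_int (2 * H + 1) / of_int Q + 1)"
proof -
  define h where "h = real_of_int (2 * H + 1)"
  define c where "c = (2 * H + 1) div Q + 1"
  define f where "f \<mu> = (\<Sum>l\<in>{- H..H}. cis (2 * pi * (of_int (a * l * \<mu>) / of_int Q)))" for \<mu>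
  have h0: "h > 0" using assms by (simp add: h_def)
  have c0: "c \<ge> 0" using assms by (simp add: c_def pos_imp_zdiv_nonneg_iff)
  have cQ: "2 * H + 1 \<le> c * Q"
  proof -
    have "(2 * H + 1) mod Q < Q" using assms by simp
    moreover have "c * Q = Q * ((2 * H + 1) div Q) + Q" by (simp add: c_def algebra_simps)
    ultimately show ?thesis using mult_div_mod_eq[of Q "2 * H + 1"] by linarith
  qed
  have c_le: "real_of_int c \<le> h / of_int Q + 1"
  proof -
    have "real_of_int ((2 * H + 1) div Q) \<le> real_of_int (2 * H + 1) / real_of_int Q"
      by (rule real_of_int_div4)
    then show ?thesis unfolding c_def h_def of_int_add of_int_1 by linarith
  qed
  have sq: "complex_of_real (\<Sum>\<mu>\<in>{- H..<- H + c * Q}. (cmod (f \<mu>))\<^sup>2)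
      = (\<Sum>l\<in>{- H..H}. \<Sum>l'\<in>{- H..H}. if Q dvd l - l' then of_int (c * Q) else 0)"
  proof -
    have "complex_of_real ((cmod (f \<mu>))\<^sup>2) = (\<Sum>l\<in>{- H..H}. \<Sum>l'\<in>{- H..H}. cis (2 * pi * (of_int ((a * (l - l')) * \<mu>) / of_int Q)))" for \<mu>
    proof -
      have "complex_of_real ((cmod (f \<mu>))\<^sup>2) = f \<mu> * cnj (f \<mu>)" by (rule complex_norm_square)
      also have "\<dots> = (\<Sum>l\<in>{- H..H}. \<Sum>l'\<in>{- H..H}. cis (2 * pi * (of_int (a * l * \<mu>) / of_int Q)) * cis (- (2 * pi * (of_int (a * l' * \<mu>) / of_int Q))))"
        by (simp add: f_def cis_cnj sum_product)
      also have "\<dots> = (\<Sum>l\<in>{- H..H}. \<Sum>l'\<in>{- H..H}. cis (2 * pi * (of_int ((a * (l - l')) * \<mu>) / of_int Q)))"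
        unfolding cis_mult
          by (intro sum.cong refl arg_cong[of _ _ cis]) (simp add: ring_distribs diff_divide_distrib mult_ac)
      finally show ?thesis .
    qed
    then have "complex_of_real (\<Sum>\<mu>\<in>{- H..<- H + c * Q}. (cmod (f \<mu>))\<^sup>2)
       = (\<Sum>\<mu>\<in>{- H..<- H + c * Q}. \<Sum>l\<in>{- H..H}. \<Sum>l'\<in>{- H..H}. cis (2 * pi * (of_int ((a * (l - l')) * \<mu>) / of_int Q)))"
      by (simp only: of_real_sum)
    also have "\<dots> = (\<Sum>l\<in>{- H..H}. \<Sum>l'\<in>{- H..H}. \<Sum>\<mu>\<in>{- H..<- H + c * Q}. cis (2 * pi * (of_int ((a * (l - l')) * \<mu>) / of_int Q)))"
      by (rule trans[OF sum.swap sum.cong[OF refl sum.swap]])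
    also have "\<dots> = (\<Sum>l\<in>{- H..H}. \<Sum>l'\<in>{- H..H}. if Q dvd l - l' then of_int (c * Q) else 0)"
    proof (intro sum.cong refl)
      fix l l'
      have "Q dvd a * (l - l') \<longleftrightarrow> Q dvd l - l'" using assms(3) by (simp add: coprime_dvd_mult_right_iff coprime_commute)
      then show "(\<Sum>\<mu>\<in>{- H..<- H + c * Q}. cis (2 * pi * (of_int ((a * (l - l')) * \<mu>) / of_int Q))) = (if Q dvd l - l' then of_int (c * Q) else 0)"
        using sum_cis_full_period[OF assms(2) c0, of "a * (l - l')" "- H"] by (simp only:)
    qed
    finally show ?thesis .
  qed
  have "(\<Sum>\<mu>\<in>{- H..<- H + c * Q}. (cmod (f \<mu>))\<^sup>2) = cmod (complex_of_real (\<Sum>\<mu>\<in>{- H..<- H + c * Q}. (cmod (f \<mu>))\<^sup>2))"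
    unfolding norm_of_real by (intro abs_of_nonneg[symmetric] sum_nonneg) simp
  also have "\<dots> \<le> (\<Sum>l\<in>{- H..H}. of_int c * of_int (c * Q))"
    unfolding sq
  proof (rule sum_norm_le)
    fix l
    have "(\<Sum>l'\<in>{- H..H}. if Q dvd l - l' then of_int (c * Q) else 0) = (\<Sum>l'\<in>{l' \<in> {- H..H}. Q dvd l - l'}. of_int (c * Q) :: complex)"
      by (rule sum.inter_filter[symmetric]) simp
    also have "\<dots> = of_nat (card {l' \<in> {- H..H}. Q dvd l - l'}) * of_int (c * Q)" by simp
    finally have "cmod (\<Sum>l'\<in>{- H..H}. if Q dvd l - l' then of_int (c * Q) else 0) = real (card {l' \<in> {- H..H}. Q dvd l - l'}) * of_int (c * Q)"
      using c0 assms by (simp add: norm_mult)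
    also have "\<dots> \<le> real (nat c) * of_int (c * Q)"
      using card_residues_interval_le[OF assms(1) cQ assms(2) c0, of l] c0 assms by (intro mult_right_mono) auto
    finally show "cmod (\<Sum>l'\<in>{- H..H}. if Q dvd l - l' then of_int (c * Q) else 0) \<le> of_int c * of_int (c * Q)"
      using c0 by simp
  qed
  also have "\<dots> = h * of_int Q * (of_int c)\<^sup>2" using assms by (simp add: h_def power2_eq_square)
  finally have big: "(\<Sum>\<mu>\<in>{- H..<- H + c * Q}. (cmod (f \<mu>))\<^sup>2) \<le> h * of_int Q * (of_int c)\<^sup>2" .
  have "(\<Sum>\<mu>\<in>{- H..H}. cmod (f \<mu>))\<^sup>2 \<le> (\<Sum>\<mu>\<in>{- H..H}. (cmod (f \<mu>))\<^sup>2) * real (card {- H..H})"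
    by (rule sum_squared_le_sum_of_squares)
  also have "real (card {- H..H}) = h" using assms by (simp add: h_def)
  also have "(\<Sum>\<mu>\<in>{- H..H}. (cmod (f \<mu>))\<^sup>2) \<le> (\<Sum>\<mu>\<in>{- H..<- H + c * Q}. (cmod (f \<mu>))\<^sup>2)"
    using cQ by (intro sum_mono2) auto
  also have "\<dots> \<le> h * of_int Q * (of_int c)\<^sup>2" by (rule big)
  finally have "(\<Sum>\<mu>\<in>{- H..H}. cmod (f \<mu>))\<^sup>2 \<le> h * of_int Q * (of_int c)\<^sup>2 * h" using h0 by simp
  also have "\<dots> = (h * sqrt (of_int Q) * of_int c)\<^sup>2"
    using assms by (simp add: power_mult_distrib power2_eq_square)
  finally have "(\<Sum>\<mu>\<in>{- H..H}. cmod (f \<mu>)) \<le> h * sqrt (of_int Q) * of_int c"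
  proof (rule power2_le_imp_le)
    show "0 \<le> h * sqrt (of_int Q) * of_int c"
      using h0 c0 assms(2) by (intro mult_nonneg_nonneg) (simp_all add: less_imp_le)
  qed
  also have "\<dots> \<le> h * sqrt (of_int Q) * (h / of_int Q + 1)"
    using h0 assms(2) by (intro mult_left_mono c_le mult_nonneg_nonneg) (simp_all add: less_imp_le)
  finally show ?thesis unfolding f_def h_def .
qed

section \<open>Reduction of the Kloosterman sum\<close>

text \<open>Each exponent of \<open>q\<close> is divided by \<open>s\<close> and rounded up. In the
  \<open>s\<close>-th power the rounding adds less than \<open>s\<close> at each prime, hence a
  divisor of the \<open>s\<close>-th power of the kernel.\<close>

lemma exists_root_modulus:
  assumes "q > 0" "s > 0"
  shows "\<exists>q1. q dvd q1 ^ s \<and> q1 ^ s dvd q * squarefree_kernel q ^ s"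
proof -
  define q1 where "q1 = (\<Prod>p\<in>prime_factors q. p ^ ((multiplicity p q + s - 1) div s))"
  have q: "q = (\<Prod>p\<in>prime_factors q. p ^ multiplicity p q)"
    using prime_factorization_nat[of q] assms by simp
  have q1s: "q1 ^ s = (\<Prod>p\<in>prime_factors q. p ^ ((multiplicity p q + s - 1) div s * s))"
    by (simp add: q1_def prod_power_distrib power_mult)
  have div: "n \<le> (n + s - 1) div s * s" "(n + s - 1) div s * s \<le> n + s" for n
  proof -
    have "(n + s - 1) mod s < s" using assms by simp
    then show "n \<le> (n + s - 1) div s * s" "(n + s - 1) div s * s \<le> n + s"
      using div_mult_mod_eq[of "n + s - 1" s] assms by linarith+
  qed
  have "q dvd q1 ^ s"
    by (subst q, unfold q1s, intro prod_dvd_prod le_imp_power_dvd div)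
  moreover have "q1 ^ s dvd q * squarefree_kernel q ^ s"
  proof -
    have "q * squarefree_kernel q ^ s = (\<Prod>p\<in>prime_factors q. p ^ multiplicity p q) * (\<Prod>p\<in>prime_factors q. p) ^ s"
      unfolding squarefree_kernel_def using q by simp
    also have "\<dots> = (\<Prod>p\<in>prime_factors q. p ^ (multiplicity p q + s))"
      by (simp add: power_add prod.distrib prod_power_distrib)
    finally show ?thesis unfolding q1s by (simp only:) (intro prod_dvd_prod le_imp_power_dvd div)
  qed
  ultimately show ?thesis by blast
qed

lemma kloosterman_term_cis:
  "kloosterman_term q a b n m = cis (2 * pi * (of_int (a * m + b * n) / real q))"
proof -
  have "2 * complex_of_real pi * \<i> * of_int (a * m + b * n) / of_nat q
      = \<i> * complex_of_real (2 * pi * (of_int (a * m + b * n) / real q))" by simp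
  then show ?thesis unfolding kloosterman_term_def cis_conv_exp by (simp only:)
qed

text \<open>Every prime factor of \<open>q\<close> divides \<open>q1\<close>, so adding a multiple
  of \<open>q1\<close> changes no residue modulo such a prime.\<close>

lemma coprime_add_mult_radical:
  fixes q q1 n z :: int
  assumes "q dvd q1 ^ s"
  shows "coprime (n + q1 * z) q \<longleftrightarrow> coprime n q"
proof -
  have "coprime n q" if "coprime (n + q1 * z) q" for n z
  proof (rule ccontr)
    assume "\<not> coprime n q"
    then have "\<not> is_unit (gcd n q)" by (simp add: coprime_iff_gcd_eq_1)
    then have "q = 0 \<and> n = 0 \<or> (\<exists>p. prime p \<and> p dvd gcd n q)"
      by (metis gcd_eq_0_iff prime_divisor_exists)
    \<comment> \<open>When both numbers are zero, every prime divides them and \<open>2\<close> is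
      taken.\<close>
    then obtain p where p: "prime p" "p dvd n" "p dvd q"
      using prime_divisor_exists[of "2 :: int"] by (metis dvd_0_right gcd_greatest_iff two_is_prime_nat prime_int_numeral_eq)
    then have "p dvd q1" using assms by (meson dvd_trans prime_dvd_power)
    then have "p dvd n + q1 * z" using p by simp
    then show False using that p by (meson coprime_common_divisor not_prime_unit)
  qed
  from this[of n z] this[of "n + q1 * z" "- z"] show ?thesis by auto
qed

text \<open>With \<open>v\<close> inverse to \<open>n\<close> modulo \<open>q\<close>, these are for
  \<open>k \<ge> 1\<close> the coefficients of \<open>z ^ k\<close> in
  \<open>a * w + b * (n + q1 * z)\<close>, where \<open>w\<close> is the truncated geometric series
  inverting \<open>n + q1 * z\<close>. The second summand is the linear part of the phase.\<close>

definition shift_coeff :: "int \<Rightarrow> int \<Rightarrow> int \<Rightarrow> int \<Rightarrow> nat \<Rightarrow> int" where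
  "shift_coeff a b q1 v k = a * v * (- q1 * v) ^ k + (if k = 1 then b * q1 else 0)"

text \<open>Modulo \<open>q\<close> the number \<open>n + q1 * z\<close> is \<open>n\<close> times
  \<open>1 + q1 * z * v\<close>, and the \<open>s\<close>-th power of \<open>q1 * z * v\<close>
  vanishes there, so the geometric series with \<open>s\<close> terms is an exact inverse.\<close>

lemma kloosterman_term_shift:
  assumes q: "q > 0" and s: "s \<ge> 2" and dvd: "int q dvd q1 ^ s" and n: "coprime n (int q)"
  shows "kloosterman_term q a b (n + q1 * z) (modular_inverse (int q) (n + q1 * z))
    = kloosterman_term q a b n (modular_inverse (int q) n)
      * cis (2 * pi * (\<Sum>k=1..s - 1. of_int (shift_coeff a b q1 (modular_inverse (int q) n) k) / real q * of_int z ^ k))"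
proof -
  define v where "v = modular_inverse (int q) n"
  define w where "w = v * (\<Sum>k<s. (- q1 * z * v) ^ k)"
  have nv: "[n * v = 1] (mod int q)" unfolding v_def using n by (rule cong_modular_inverse1)
  have cop: "coprime (n + q1 * z) (int q)" using n coprime_add_mult_radical[OF dvd] by blast
  have geo: "(1 - x) * (\<Sum>k<s. x ^ k) = 1 - x ^ s" for x :: int by (rule one_diff_power_eq[symmetric])
  have "[(n + q1 * z) * w = 1] (mod int q)"
  proof -
    have "(n + q1 * z) * w = (n * v + q1 * z * v) * (\<Sum>k<s. (- q1 * z * v) ^ k)"
      by (simp add: w_def algebra_simps)
    also have "[\<dots> = (1 + q1 * z * v) * (\<Sum>k<s. (- q1 * z * v) ^ k)] (mod int q)"
      by (intro cong_mult cong_add nv cong_refl)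
    also have "(1 + q1 * z * v) * (\<Sum>k<s. (- q1 * z * v) ^ k) = 1 - (- q1 * z * v) ^ s"
      using geo[of "- q1 * z * v"] by simp
    also have "(- q1 * z * v) ^ s = q1 ^ s * (- z * v) ^ s"
      unfolding power_mult_distrib[symmetric] by (rule arg_cong[of _ _ "\<lambda>x. x ^ s"]) simp
    also have "[1 - q1 ^ s * (- z * v) ^ s = 1 - 0] (mod int q)"
      by (intro cong_diff cong_refl) (use dvd in \<open>simp add: cong_0_iff\<close>)
    finally show ?thesis by simp
  qed
  then have "[(n + q1 * z) * modular_inverse (int q) (n + q1 * z) = (n + q1 * z) * w] (mod int q)"
    using cong_modular_inverse1[OF cop] by (metis cong_sym cong_trans)
  then have "[modular_inverse (int q) (n + q1 * z) = w] (mod int q)"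
    using cop by (simp add: cong_mult_lcancel)
  then have t1: "kloosterman_term q a b (n + q1 * z) (modular_inverse (int q) (n + q1 * z))
      = kloosterman_term q a b (n + q1 * z) w" by (rule kloosterman_term_cong[OF q])
  have eq: "a * w + b * (n + q1 * z) = (a * v + b * n) + (\<Sum>k=1..s - 1. shift_coeff a b q1 v k * z ^ k)"
  proof -
    have "{..<s} = insert 0 {1..s - 1}" using s by auto
    then have "a * w = a * v + (\<Sum>k=1..s - 1. a * v * (- q1 * z * v) ^ k)"
      by (simp add: w_def distrib_left sum_distrib_left mult.assoc)
    also have "(\<Sum>k=1..s - 1. a * v * (- q1 * z * v) ^ k) = (\<Sum>k=1..s - 1. a * v * (- q1 * v) ^ k * z ^ k)"
      by (intro sum.cong refl) (simp add: power_mult_distrib[symmetric] mult_ac)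
    finally have aw: "a * w = a * v + (\<Sum>k=1..s - 1. a * v * (- q1 * v) ^ k * z ^ k)" .
    have "(\<Sum>k=1..s - 1. (if k = 1 then b * q1 else 0) * z ^ k) = (\<Sum>k\<in>{1}. b * q1 * z ^ k)"
      using s by (intro sum.mono_neutral_cong_right) auto
    then have bq: "(\<Sum>k=1..s - 1. (if k = 1 then b * q1 else 0) * z ^ k) = b * q1 * z" by simp
    have "(\<Sum>k=1..s - 1. shift_coeff a b q1 v k * z ^ k)
       = (\<Sum>k=1..s - 1. a * v * (- q1 * v) ^ k * z ^ k) + (\<Sum>k=1..s - 1. (if k = 1 then b * q1 else 0) * z ^ k)"
      unfolding shift_coeff_def distrib_right sum.distrib ..
    then show ?thesis unfolding aw bq by (simp add: algebra_simps)
  qed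
  have t2: "kloosterman_term q a b (n + q1 * z) w
      = cis (2 * pi * (of_int (a * v + b * n) / real q) + 2 * pi * (\<Sum>k=1..s - 1. of_int (shift_coeff a b q1 v k) / real q * of_int z ^ k))"
    unfolding kloosterman_term_cis eq by (simp add: add_divide_distrib sum_divide_distrib distrib_left)
  show ?thesis unfolding t1 t2 cis_mult[symmetric] v_def[symmetric] kloosterman_term_cis[of q a b n v] ..
qed

lemma norm_kloosterman_term: "cmod (kloosterman_term q a b n m) = 1"
  by (simp add: kloosterman_term_cis)

text \<open>Averaging over the \<open>P ^ 2\<close> shifts \<open>q1 * x * y\<close>, each at most
  \<open>q1 * P ^ 2\<close>. A shift by \<open>h\<close> costs at most \<open>2 * h\<close> at the
  ends of the interval, which accounts for the last summand.\<close>

lemma kloosterman_sum_shift_bound: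
  fixes P N :: int
  assumes q: "q > 0" and s: "s \<ge> 2" and dvd: "int q dvd q1 ^ s" and q1: "q1 \<ge> 0" and P: "P > 0" and N: "N \<ge> 0"
    and B: "\<And>n. coprime n (int q) \<Longrightarrow> cmod (\<Sum>x\<in>{0..<P}. \<Sum>y\<in>{0..<P}.
       cis (2 * pi * (\<Sum>k=1..s - 1. of_int (shift_coeff a b q1 (modular_inverse (int q) n) k) / real q * of_int (x * y) ^ k))) \<le> B"
    and B0: "B \<ge> 0"
  shows "(of_int P)\<^sup>2 * cmod (kloosterman_sum q a b c N) \<le> of_int N * B + 2 * of_int q1 * of_int P ^ 4"
proof -
  \<comment> \<open>The summand is extended by zero to all integers, so that shifting the range of
    summation needs no attention to coprimality.\<close>
  define g where "g n = (if coprime n (int q) then kloosterman_term q a b n (modular_inverse (int q) n) else 0)" for n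
  define S where "S = (\<Sum>n\<in>{c<..c + N}. g n)"
  define T where "T n = (\<Sum>x\<in>{0..<P}. \<Sum>y\<in>{0..<P}.
       cis (2 * pi * (\<Sum>k=1..s - 1. of_int (shift_coeff a b q1 (modular_inverse (int q) n) k) / real q * of_int (x * y) ^ k)))" for n
  have S: "kloosterman_sum q a b c N = S"
    unfolding kloosterman_sum_def S_def g_def by (rule sum.inter_filter) simp
  have g1: "cmod (g n) \<le> 1" for n by (simp add: g_def norm_kloosterman_term)
  have gsum: "cmod (\<Sum>n\<in>{u<..u + h}. g n) \<le> of_int h" if "h \<ge> 0" for u h
    using sum_norm_le[of "{u<..u + h}" g "\<lambda>_. 1"] g1 that by simp
  have shift: "cmod (S - (\<Sum>n\<in>{c<..c + N}. g (n + h))) \<le> 2 * of_int h" if h: "h \<ge> 0" for h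
  proof -
    have "(\<Sum>n\<in>{c<..c + N}. g (n + h)) = (\<Sum>n\<in>{c + h<..c + N + h}. g n)"
      by (rule sum.reindex_bij_witness[where i = "\<lambda>n. n - h" and j = "\<lambda>n. n + h"]) auto
    moreover have "(\<Sum>n\<in>{c<..c + h}. g n) + (\<Sum>n\<in>{c + h<..c + N + h}. g n) = (\<Sum>n\<in>{c<..c + N + h}. g n)"
      using h N by (subst sum.union_disjoint[symmetric]) (auto intro!: sum.cong)
    moreover have "S + (\<Sum>n\<in>{c + N<..c + N + h}. g n) = (\<Sum>n\<in>{c<..c + N + h}. g n)"
      unfolding S_def using h N by (subst sum.union_disjoint[symmetric]) (auto intro!: sum.cong)
    ultimately have "S - (\<Sum>n\<in>{c<..c + N}. g (n + h)) = (\<Sum>n\<in>{c<..c + h}. g n) - (\<Sum>n\<in>{c + N<..c + N + h}. g n)"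
      by (simp add: algebra_simps)
    then show ?thesis using norm_triangle_ineq4[of "\<Sum>n\<in>{c<..c + h}. g n" "\<Sum>n\<in>{c + N<..c + N + h}. g n"] gsum[OF h, of c] gsum[OF h, of "c + N"]
      by simp
  qed
  have main: "(\<Sum>x\<in>{0..<P}. \<Sum>y\<in>{0..<P}. \<Sum>n\<in>{c<..c + N}. g (n + q1 * (x * y))) = (\<Sum>n\<in>{c<..c + N}. g n * T n)"
  proof -
    have gs: "g (n + q1 * z) = g n * cis (2 * pi * (\<Sum>k=1..s - 1. of_int (shift_coeff a b q1 (modular_inverse (int q) n) k) / real q * of_int z ^ k))" for n z
      using kloosterman_term_shift[OF q s dvd, of n a b z] coprime_add_mult_radical[OF dvd, of n z] by (simp add: g_def)
    have "(\<Sum>x\<in>{0..<P}. \<Sum>y\<in>{0..<P}. \<Sum>n\<in>{c<..c + N}. g (n + q1 * (x * y)))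
        = (\<Sum>x\<in>{0..<P}. \<Sum>n\<in>{c<..c + N}. \<Sum>y\<in>{0..<P}. g (n + q1 * (x * y)))"
      by (intro sum.cong[OF refl] sum.swap)
    also have "\<dots> = (\<Sum>n\<in>{c<..c + N}. \<Sum>x\<in>{0..<P}. \<Sum>y\<in>{0..<P}. g (n + q1 * (x * y)))"
      by (rule sum.swap)
    also have "\<dots> = (\<Sum>n\<in>{c<..c + N}. g n * T n)"
      unfolding gs T_def sum_distrib_left ..
    finally show ?thesis .
  qed
  have mainle: "cmod (\<Sum>n\<in>{c<..c + N}. g n * T n) \<le> of_int N * B"
  proof -
    have "cmod (\<Sum>n\<in>{c<..c + N}. g n * T n) \<le> (\<Sum>n\<in>{c<..c + N}. B)"
    proof (rule sum_norm_le)
      fix n show "cmod (g n * T n) \<le> B"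
        using B[of n] B0 by (auto simp: g_def T_def norm_mult norm_kloosterman_term)
    qed
    then show ?thesis using N by simp
  qed
  have "(\<Sum>x\<in>{0..<P}. \<Sum>y\<in>{0..<P}. S - (\<Sum>n\<in>{c<..c + N}. g (n + q1 * (x * y))))
     = (of_int P)\<^sup>2 * S - (\<Sum>n\<in>{c<..c + N}. g n * T n)"
    unfolding sum_subtractf main using P by (simp add: power2_eq_square)
  moreover have "cmod (\<Sum>x\<in>{0..<P}. \<Sum>y\<in>{0..<P}. S - (\<Sum>n\<in>{c<..c + N}. g (n + q1 * (x * y))))
      \<le> (\<Sum>x\<in>{0..<P}. \<Sum>y\<in>{0..<P}. 2 * (of_int q1 * (of_int P)\<^sup>2))"
  proof (intro sum_norm_le)
    fix x y assume xy: "x \<in> {0..<P}" "y \<in> {0..<P}"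
    have "x * y \<le> P * P" using xy by (intro mult_mono) auto
    then have "real_of_int (x * y) \<le> real_of_int (P * P)" by (simp only: of_int_le_iff)
    then have "real_of_int (q1 * (x * y)) \<le> of_int q1 * (of_int P)\<^sup>2"
      using q1 unfolding of_int_mult[of q1] by (intro mult_left_mono) (auto simp: power2_eq_square)
    moreover have "q1 * (x * y) \<ge> 0" using q1 xy by simp
    ultimately show "cmod (S - (\<Sum>n\<in>{c<..c + N}. g (n + q1 * (x * y)))) \<le> 2 * (of_int q1 * (of_int P)\<^sup>2)"
      using shift[of "q1 * (x * y)"] by linarith
  qed
  moreover have "(\<Sum>x\<in>{0..<P}. \<Sum>y\<in>{0..<P}. 2 * (real_of_int q1 * (of_int P)\<^sup>2)) = 2 * of_int q1 * of_int P ^ 4"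
    using P by (simp add: power2_eq_square power4_eq_xxxx)
  ultimately have "cmod ((of_int P)\<^sup>2 * S - (\<Sum>n\<in>{c<..c + N}. g n * T n)) \<le> 2 * of_int q1 * of_int P ^ 4"
    by (simp only:)
  moreover have "cmod ((of_int P)\<^sup>2 * S) \<le> cmod ((of_int P)\<^sup>2 * S - (\<Sum>n\<in>{c<..c + N}. g n * T n)) + cmod (\<Sum>n\<in>{c<..c + N}. g n * T n)"
    by (metis diff_add_cancel norm_triangle_ineq)
  moreover have "cmod ((of_int P)\<^sup>2 * S) = (of_int P)\<^sup>2 * cmod S" by (simp add: norm_mult norm_power)
  ultimately show ?thesis using mainle unfolding S by linarith
qed

lemma norm_bilinear_sum_trivial:
  fixes H :: int
  assumes "H \<ge> 0"
  shows "(\<Sum>\<mu>\<in>{- H..H}. cmod (\<Sum>l\<in>{- H..H}. cis (f l \<mu>))) \<le> (of_int (2 * H + 1))\<^sup>2"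
proof -
  have "(\<Sum>\<mu>\<in>{- H..H}. cmod (\<Sum>l\<in>{- H..H}. cis (f l \<mu>))) \<le> (\<Sum>\<mu>\<in>{- H..H}. of_int (2 * H + 1))"
  proof (rule sum_mono)
    fix \<mu>
    have "cmod (\<Sum>l\<in>{- H..H}. cis (f l \<mu>)) \<le> (\<Sum>l\<in>{- H..H}. 1)" by (rule sum_norm_le) simp
    then show "cmod (\<Sum>l\<in>{- H..H}. cis (f l \<mu>)) \<le> of_int (2 * H + 1)" using assms by simp
  qed
  also have "\<dots> = (of_int (2 * H + 1))\<^sup>2" using assms by (simp add: power2_eq_square)
  finally show ?thesis .
qed

text \<open>Degrees outside \<open>M\<close> are bounded trivially. The product over all degrees
  then contributes \<open>P ^ (K * (K + 1))\<close>, which the ideal part of the squared mean value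
  exactly compensates. What remains is the loss in the mean value, the factors \<open>3 * b\<close>,
  and one saving \<open>S\<close> for each degree in \<open>M\<close>.\<close>

lemma double_sum_mean_value_bound:
  fixes p :: int and \<alpha> :: "nat \<Rightarrow> real" and K t m :: nat and S :: real
  defines "P \<equiv> p ^ m" and "b \<equiv> K * (K + t)"
  defines "H \<equiv> (\<lambda>k. int b * P ^ k)"
  assumes p: "prime p" and K: "K \<ge> 4" "real K ^ 4 \<le> of_int p" and r: "real b \<le> of_int p"
    and M: "M \<subseteq> {1..K}" and S: "S \<ge> 0"
    and V: "\<And>k. k \<in> M \<Longrightarrow> (\<Sum>\<mu>\<in>{- H k..H k}. cmod (\<Sum>l\<in>{- H k..H k}. cis (2 * pi * (\<alpha> k * of_int l * of_int \<mu>))))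
        \<le> (of_int (2 * H k + 1))\<^sup>2 * S"
  shows "cmod (\<Sum>x\<in>{0..<P}. \<Sum>y\<in>{0..<P}. cis (2 * pi * (\<Sum>k=1..K. \<alpha> k * of_int (x * y) ^ k))) ^ (4 * b\<^sup>2)
    \<le> of_int P ^ (8 * b\<^sup>2)
       * (of_int p powr (4 * real K ^ 2 * real t + real m * (real K * (real K + 1)) * (1 - 1 / real K) ^ t)
       * (3 * real b) ^ (2 * K) * S ^ card M)"
    (is "?W ^ _ \<le> _")
proof -
  define q where "q = real_of_int p"
  define Kp where "Kp = real K * (real K + 1) / 2"
  define e where "e = (1 - 1 / real K) ^ t"
  let ?v = "\<lambda>k. \<Sum>\<mu>\<in>{- H k..H k}. cmod (\<Sum>l\<in>{- H k..H k}. cis (2 * pi * (\<alpha> k * of_int l * of_int \<mu>)))"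
  have p0: "p > 1" using p by (simp add: prime_gt_1_int)
  have P0: "P > 0" using p0 by (simp add: P_def)
  have q0: "q > 1" using p0 by (simp add: q_def)
  have qn: "real (nat p) = q" using p0 by (simp add: q_def)
  have b1: "b \<ge> 1" using K by (simp add: b_def)
  have qP: "real_of_int P ^ n = q powr (real m * real n)" for n
    using q0 by (simp add: P_def q_def[symmetric] power_mult[symmetric] powr_realpow[symmetric] powr_powr)
  have H0: "H k \<ge> 0" for k using P0 by (simp add: H_def)
  have H3: "(of_int (2 * H k + 1))\<^sup>2 \<le> (3 * real b)\<^sup>2 * (of_int P ^ (2 * k))" for k
  proof -
    have "1 \<le> int b * P ^ k" using b1 P0 by (metis int_one_le_iff_zero_less mult_pos_pos of_nat_0_less_iff less_le_trans zero_less_one zero_less_power)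
    then have "2 * H k + 1 \<le> 3 * (int b * P ^ k)" by (simp add: H_def)
    then have "real_of_int (2 * H k + 1) \<le> real_of_int (3 * (int b * P ^ k))" by (simp only: of_int_le_iff)
    then have "(of_int (2 * H k + 1))\<^sup>2 \<le> (real_of_int (3 * (int b * P ^ k)))\<^sup>2" using H0[of k] by (intro power_mono) auto
    also have "\<dots> = (3 * real b)\<^sup>2 * (of_int P ^ (2 * k))"
      by (simp add: power_mult_distrib power_mult[symmetric] mult.commute)
    finally show ?thesis .
  qed
  have prodV: "(\<Prod>k=1..K. ?v k) \<le> (3 * real b) ^ (2 * K) * q powr (real m * (2 * Kp)) * S ^ card M"
  proof -
    have "(\<Prod>k=1..K. ?v k) \<le> (\<Prod>k=1..K. (3 * real b)\<^sup>2 * (of_int P ^ (2 * k)) * (if k \<in> M then S else 1))"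
    proof (intro prod_mono conjI sum_nonneg)
      fix k assume "k \<in> {1..K}"
      show "?v k \<le> (3 * real b)\<^sup>2 * (of_int P ^ (2 * k)) * (if k \<in> M then S else 1)"
      proof (cases "k \<in> M")
        case True
        have "?v k \<le> (of_int (2 * H k + 1))\<^sup>2 * S" by (rule V[OF True])
        also have "\<dots> \<le> (3 * real b)\<^sup>2 * (of_int P ^ (2 * k)) * S" by (intro mult_right_mono H3 S)
        finally show ?thesis using True by simp
      next
        case False
        have "?v k \<le> (of_int (2 * H k + 1))\<^sup>2" by (rule norm_bilinear_sum_trivial[OF H0])
        then show ?thesis using H3[of k] False by simp
      qed
    qed auto
    also have "\<dots> = ((3 * real b)\<^sup>2) ^ K * (\<Prod>k=1..K. of_int P ^ (2 * k)) * (\<Prod>k=1..K. if k \<in> M then S else 1)"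
      by (simp add: prod.distrib)
    also have "(\<Prod>k=1..K. if k \<in> M then S else 1) = S ^ card M"
    proof -
      have "(\<Prod>k=1..K. if k \<in> M then S else 1) = (\<Prod>k\<in>M. S)"
        using M by (intro prod.mono_neutral_cong_right) auto
      then show ?thesis by simp
    qed
    also have "(\<Prod>k=1..K. real_of_int P ^ (2 * k)) = of_int P ^ (\<Sum>k=1..K. 2 * k)" by (simp add: power_sum)
    also have "\<dots> = q powr (real m * (2 * Kp))"
    proof -
      have "real (\<Sum>k=1..n. 2 * k) = real n * (real n + 1)" for n
        by (induction n) (simp_all add: algebra_simps)
      then show ?thesis unfolding qP Kp_def by simp
    qed
    also have "((3 * real b)\<^sup>2) ^ K = (3 * real b) ^ (2 * K)" by (simp add: power_mult)
    finally show ?thesis .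
  qed
  define J where "J = real (energy K (pow_sums {..<b}) (PiE {..<b} (\<lambda>_. {0..<P})))"
  have J: "J \<le> q powr (2 * real K ^ 2 * real t + real m * (2 * real b - Kp + Kp * e))"
    using mean_value_bound[OF p K(1), of t m] K(2) r unfolding qn b_def J_def Kp_def e_def P_def q_def mean_value_def by simp
  have "?W ^ (4 * b\<^sup>2) \<le> of_int P ^ (4 * b * (2 * b - 1)) * J\<^sup>2 * (\<Prod>k=1..K. ?v k)"
    using double_sum_bound[OF P0 b1, of \<alpha> K] unfolding H_def J_def by simp
  also have "\<dots> \<le> of_int P ^ (4 * b * (2 * b - 1)) * (q powr (2 * real K ^ 2 * real t + real m * (2 * real b - Kp + Kp * e)))\<^sup>2
      * ((3 * real b) ^ (2 * K) * q powr (real m * (2 * Kp)) * S ^ card M)"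
    using J P0 S by (intro mult_mono prodV power_mono) (auto intro!: prod_nonneg sum_nonneg simp: J_def)
  also have "\<dots> = q powr (real m * real (4 * b * (2 * b - 1)) + 2 * (2 * real K ^ 2 * real t + real m * (2 * real b - Kp + Kp * e)) + real m * (2 * Kp))
      * (3 * real b) ^ (2 * K) * S ^ card M"
  proof -
    have "q powr x * (q powr y)\<^sup>2 * (A * q powr z * B) = q powr (x + 2 * y + z) * A * B" for x y z A B
      unfolding mult_2 powr_add power2_eq_square by (simp only: mult_ac)
    then show ?thesis unfolding qP .
  qed
  also have "real m * real (4 * b * (2 * b - 1)) + 2 * (2 * real K ^ 2 * real t + real m * (2 * real b - Kp + Kp * e)) + real m * (2 * Kp)
      = real m * real (8 * b\<^sup>2) + (4 * real K ^ 2 * real t + real m * (real K * (real K + 1)) * e)"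
  proof -
    have "real (2 * b - 1) = 2 * real b - 1" using b1 by simp
    then have "real (4 * b * (2 * b - 1)) = 8 * real b * real b - 4 * real b" by (simp add: algebra_simps)
    then show ?thesis by (simp add: Kp_def power2_eq_square algebra_simps)
  qed
  finally show ?thesis unfolding qP e_def q_def powr_add by (simp only: mult.assoc)
qed

text \<open>In lowest terms the coefficient has denominator \<open>Q\<close>, because
  \<open>a\<close> and the inverse of \<open>n\<close> are prime to \<open>q\<close>; from degree
  two on \<open>b\<close> does not occur. The number \<open>h\<close> bounds from below the distance
  of \<open>ln Q\<close> from both ends of the useful range, so each of the two terms of the
  bilinear estimate saves \<open>exp (- h / 2)\<close>.\<close>

lemma kloosterman_coeff_bilinear:
  fixes H :: int
  assumes q: "q > 0" and a: "coprime a (int q)" and n: "coprime n (int q)" and k: "k \<ge> 2" and H: "H \<ge> 0"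
    and Q: "Q = real q / real (gcd q (q1 ^ k))" "exp h \<le> Q" "Q * exp h \<le> (of_int (2 * H + 1))\<^sup>2"
  shows "(\<Sum>\<mu>\<in>{- H..H}. cmod (\<Sum>l\<in>{- H..H}. cis (2 * pi *
      (of_int (shift_coeff a b (int q1) (modular_inverse (int q) n) k) / real q * of_int l * of_int \<mu>))))
    \<le> (of_int (2 * H + 1))\<^sup>2 * (2 * exp (- h / 2))"
proof -
  define v where "v = modular_inverse (int q) n"
  define g where "g = gcd q (q1 ^ k)"
  have g0: "g > 0" using q by (simp add: g_def)
  define Q' where "Q' = q div g"
  define t where "t = q1 ^ k div g"
  have qg: "q = g * Q'" by (simp add: Q'_def g_def)
  have tg: "q1 ^ k = g * t" by (simp add: t_def g_def)
  have Q'0: "Q' > 0" using q qg by (cases Q') auto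
  have "coprime t Q'"
    using div_gcd_coprime[of q "q1 ^ k"] q by (simp add: t_def Q'_def g_def coprime_commute)
  then have ct: "coprime (int t) (int Q')" by simp
  have dvd: "int Q' dvd int q" using qg by simp
  have "[n * v = 1] (mod int q)" unfolding v_def using n by (rule cong_modular_inverse1)
  then have "coprime (n * v) (int q)" by (metis cong_imp_coprime cong_sym coprime_1_left)
  then have cv: "coprime v (int q)" by simp
  define a' where "a' = a * v * (- v) ^ k * int t"
  have ca: "coprime a' (int Q')"
  proof -
    have "coprime a (int Q')" "coprime v (int Q')" using a cv dvd by (meson coprime_divisors dvd_refl)+
    then show ?thesis using ct by (simp add: a'_def)
  qed
  have sc: "shift_coeff a b (int q1) v k = a' * int g"
  proof -
    have "(- int q1 * v) ^ k = (- v) ^ k * int q1 ^ k" by (simp add: power_mult_distrib[symmetric] mult.commute)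
    also have "int q1 ^ k = int g * int t" using tg by (metis of_nat_mult of_nat_power)
    finally show ?thesis using k by (simp add: shift_coeff_def a'_def mult_ac)
  qed
  have "Q = real q / real g" by (simp add: Q(1) g_def)
  then have QQ: "Q = real Q'" using g0 by (simp add: qg)
  have coef: "of_int (shift_coeff a b (int q1) v k) / real q * of_int l * of_int \<mu> = of_int (a' * l * \<mu>) / of_int (int Q')" for l \<mu>
    using g0 by (simp add: sc qg)
  define z where "z = real_of_int (2 * H + 1)"
  have z0: "z > 0" using H by (simp add: z_def)
  have Q0: "Q > 0" using Q'0 QQ by simp
  have "(\<Sum>\<mu>\<in>{- H..H}. cmod (\<Sum>l\<in>{- H..H}. cis (2 * pi * (of_int (a' * l * \<mu>) / of_int (int Q')))))
      \<le> z * sqrt Q * (z / Q + 1)"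
    using bilinear_sum_bound[OF H _ ca] Q'0 by (simp add: QQ z_def)
  also have "\<dots> = z\<^sup>2 * (sqrt Q / Q) + z * sqrt Q"
    by (simp add: power2_eq_square algebra_simps)
  also have "\<dots> \<le> z\<^sup>2 * exp (- h / 2) + z * (z * exp (- h / 2))"
  proof (intro add_mono mult_left_mono)
    have e2: "exp (h / 2) = sqrt (exp h)"
      by (rule real_sqrt_unique[symmetric]) (simp_all add: power2_eq_square exp_add[symmetric])
    have "sqrt Q / Q = 1 / sqrt Q" using Q0 by (simp add: field_simps)
    also have "\<dots> \<le> 1 / exp (h / 2)"
      using Q(2) Q0 unfolding e2 by (intro divide_left_mono) auto
    finally show "sqrt Q / Q \<le> exp (- h / 2)" by (simp add: exp_minus inverse_eq_divide)
    have "sqrt Q * exp (h / 2) = sqrt (Q * exp h)" by (simp add: e2 real_sqrt_mult)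
    also have "\<dots> \<le> sqrt (z\<^sup>2)" using Q(3) by (intro real_sqrt_le_mono) (simp add: z_def)
    also have "\<dots> = z" using z0 by simp
    finally show "sqrt Q \<le> z * exp (- h / 2)" by (simp add: exp_minus field_simps)
  qed (use z0 in auto)
  also have "\<dots> = z\<^sup>2 * (2 * exp (- h / 2))" by (simp add: power2_eq_square)
  finally show ?thesis unfolding v_def[symmetric] coef z_def .
qed

lemma root_modulus_bounds:
  fixes q q1 d s k :: nat
  assumes q: "q > 0" and d: "d > 0" and s: "s > 0" and dvd: "q dvd q1 ^ s" "q1 ^ s dvd q * d ^ s" and k: "k \<le> s"
  defines "Q \<equiv> real q / real (gcd q (q1 ^ k))"
  shows "real q1 > 0" "ln (real q1) \<le> ln (real d) + ln (real q) / real s"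
    "ln Q \<ge> ln (real q) - real k * (ln (real d) + ln (real q) / real s)"
    "ln Q \<le> ln (real q) - real k * ln (real q) / real s" "Q > 0"
proof -
  have "q1 \<noteq> 0"
  proof
    assume "q1 = 0"
    then have "0 dvd q * d ^ s" using dvd(2) s by (simp add: power_0_left)
    then show False using q d by simp
  qed
  then show q1: "real q1 > 0" by simp
  define g where "g = gcd q (q1 ^ k)"
  have g0: "real g > 0" using q by (simp add: g_def)
  show "Q > 0" using q g0 by (simp add: Q_def g_def)
  have "q1 ^ s \<le> q * d ^ s" using dvd(2) q d by (intro dvd_imp_le) auto
  then have "real q1 ^ s \<le> real q * real d ^ s" by (metis of_nat_le_iff of_nat_mult of_nat_power)
  then have "ln (real q1 ^ s) \<le> ln (real q * real d ^ s)" using q1 q d by (subst ln_le_cancel_iff) auto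
  then have "real s * ln (real q1) \<le> ln (real q) + real s * ln (real d)"
    using q1 q d by (simp add: ln_mult ln_realpow)
  then show l1: "ln (real q1) \<le> ln (real d) + ln (real q) / real s" using s by (simp add: field_simps)
  have lQ: "ln Q = ln (real q) - ln (real g)" using q g0 by (simp add: Q_def g_def[symmetric] ln_div)
  have "g \<le> q1 ^ k" using q1 unfolding g_def by (intro dvd_imp_le) auto
  then have "real g \<le> real q1 ^ k" by (metis of_nat_le_iff of_nat_power)
  then have "ln (real g) \<le> ln (real q1 ^ k)" using g0 q1 by (subst ln_le_cancel_iff) auto
  also have "\<dots> = real k * ln (real q1)" using q1 by (simp add: ln_realpow)
  also have "\<dots> \<le> real k * (ln (real d) + ln (real q) / real s)" by (rule mult_left_mono[OF l1]) simp
  finally show "ln Q \<ge> ln (real q) - real k * (ln (real d) + ln (real q) / real s)" using lQ by simp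
  \<comment> \<open>The gcd commutes with powers, so \<open>g ^ s\<close> is the gcd on the right;
    this bounds \<open>g\<close> from below without factoring.\<close>
  have "q ^ k dvd gcd (q ^ s) ((q1 ^ k) ^ s)"
  proof (rule gcd_greatest)
    show "q ^ k dvd q ^ s" using k by (rule le_imp_power_dvd)
    have "q ^ k dvd (q1 ^ s) ^ k" using dvd(1) by (rule dvd_power_same)
    then show "q ^ k dvd (q1 ^ k) ^ s" by (simp add: power_mult[symmetric] mult.commute)
  qed
  also have "gcd (q ^ s) ((q1 ^ k) ^ s) = g ^ s" unfolding g_def by (rule gcd_exp)
  finally have "q ^ k \<le> g ^ s" using g0 by (intro dvd_imp_le) auto
  then have "real q ^ k \<le> real g ^ s" by (metis of_nat_le_iff of_nat_power)
  then have "ln (real q ^ k) \<le> ln (real g ^ s)" using g0 q by (subst ln_le_cancel_iff) auto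
  then have "real k * ln (real q) \<le> real s * ln (real g)" using g0 q by (simp add: ln_realpow)
  then have "real k * ln (real q) / real s \<le> ln (real g)" using s by (simp add: field_simps)
  then show "ln Q \<le> ln (real q) - real k * ln (real q) / real s" using lQ by simp
qed

section \<open>Numerical bounds\<close>

text \<open>Here \<open>A = ln q / (\<delta> * ln N)\<close>, \<open>L = ln (1 / \<delta>)\<close> and \<open>x = ln P\<close>. The last summand on the left
  is the saving from the good degrees.\<close>

lemma total_exponent_bound:
  fixes A \<delta> L LN K t lp x lb c e :: real
  assumes \<delta>: "0 < \<delta>" "\<delta> < 1 / 10" and L: "L \<ge> 2" and A: "A \<ge> 2000"
    and LN: "LN \<ge> 1728000000 * L\<^sup>2 * A\<^sup>2 / \<delta> ^ 4"
    and K: "1 \<le> K" "K \<le> 4 * A" and t: "0 \<le> t" "t \<le> 9 * L * K + 1" and lp: "0 \<le> lp" "lp \<le> 9 * K"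
    and x: "0 \<le> x" "x \<le> LN / 4" and e: "0 \<le> e" "e \<le> \<delta> ^ 9" and lb: "lb \<le> 2 * lp"
    and c: "c \<ge> 27 / 100 * A * \<delta>\<^sup>2"
  shows "4 * K\<^sup>2 * t * lp + x * (K * (K + 1)) * e + 2 * K * lb + c * (ln 2 - 4 / 100 * \<delta>\<^sup>2 * A * LN)
    \<le> - (8 * (K * (K + t))\<^sup>2 * (\<delta> ^ 4 * LN / (201 ^ 4 * L\<^sup>2 * A\<^sup>2)))"
proof -
  \<comment> \<open>The common yardstick: the good degrees save \<open>108 / 10000 * X\<close>,
    every cost is at most \<open>X / 10000\<close>, and the required bound is at most
    \<open>2 / 10000 * X\<close> in size.\<close>
  define X where "X = A\<^sup>2 * \<delta> ^ 4 * LN"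
  have A0: "A > 0" using A by simp
  have L0: "L > 0" using L by simp
  have d4: "\<delta> ^ 4 > 0" using \<delta> by simp
  have LN0: "LN > 0"
  proof -
    have "0 < 1728000000 * L\<^sup>2 * A\<^sup>2 / \<delta> ^ 4" using A0 L0 d4 by simp
    then show ?thesis using LN by linarith
  qed
  have X0: "X \<ge> 0" unfolding X_def using LN0 d4 by simp
  have dLN: "\<delta> ^ 4 * LN \<ge> 1728000000 * L\<^sup>2 * A\<^sup>2"
    using LN d4 by (simp add: field_simps)
  have X1: "X \<ge> 1728000000 * L\<^sup>2 * A ^ 4"
    using mult_left_mono[OF dLN, of "A\<^sup>2"] by (simp add: X_def power2_eq_square power4_eq_xxxx mult_ac)
  have L2: "L\<^sup>2 \<ge> 2 * L" using L by (simp add: power2_eq_square)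
  have XL: "X \<ge> 3456000000 * (L * A ^ 4)"
  proof -
    have "1728000000 * (2 * L) * A ^ 4 \<le> 1728000000 * L\<^sup>2 * A ^ 4" using L2 L0 by (intro mult_mono) auto
    then show ?thesis using X1 by simp
  qed
  have A42: "A\<^sup>2 \<le> A ^ 4" using A by (intro power_increasing) auto
  have XA: "X \<ge> 6912000000 * A ^ 4"
  proof -
    have "2 * A ^ 4 \<le> L * A ^ 4" using L by (intro mult_right_mono) auto
    then show ?thesis using XL by linarith
  qed
  have LK: "1 \<le> L * K" using L K mult_mono[of 1 L 1 K] by simp
  have K0: "0 \<le> K" using K by simp
  have t10: "t \<le> 10 * (L * K)" using t LK by simp
  have K4A: "K ^ 4 \<le> 256 * A ^ 4" using power_mono[OF K(2) K0, of 4] by (simp add: power_mult_distrib)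
  have K2A: "K\<^sup>2 \<le> 16 * A\<^sup>2" using power_mono[OF K(2) K0, of 2] by (simp add: power_mult_distrib)
  have c1: "4 * K\<^sup>2 * t * lp \<le> X / 10000"
  proof -
    have "4 * K\<^sup>2 * t * lp \<le> 4 * K\<^sup>2 * (10 * (L * K)) * (9 * K)"
      using t10 lp t K0 L0 by (intro mult_mono) auto
    also have "\<dots> = 360 * (L * K ^ 4)" by (simp add: power2_eq_square power4_eq_xxxx)
    also have "\<dots> \<le> 360 * (L * (256 * A ^ 4))" using K4A L0 by (intro mult_left_mono) auto
    also have "\<dots> \<le> X / 10000"
    proof -
      have "0 \<le> L * A ^ 4" using A0 L0 by simp
      then show ?thesis using XL by linarith
    qed
    finally show ?thesis .
  qed
  have c2: "x * (K * (K + 1)) * e \<le> X / 10000"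
  proof -
    have "K * (K + 1) \<le> K * (2 * K)" using K by (intro mult_left_mono) auto
    also have "\<dots> \<le> 32 * A\<^sup>2" using K2A by (simp add: power2_eq_square)
    finally have KK: "K * (K + 1) \<le> 32 * A\<^sup>2" .
    have "x * (K * (K + 1)) * e \<le> LN / 4 * (32 * A\<^sup>2) * \<delta> ^ 9"
    proof (rule mult_mono)
      show "x * (K * (K + 1)) \<le> LN / 4 * (32 * A\<^sup>2)"
        by (rule mult_mono) (use x KK K0 LN0 in auto)
    qed (use e LN0 in auto)
    also have "\<delta> ^ 9 = \<delta> ^ 5 * \<delta> ^ 4" by (simp add: power_add[symmetric])
    also have "LN / 4 * (32 * A\<^sup>2) * (\<delta> ^ 5 * \<delta> ^ 4) = 8 * \<delta> ^ 5 * X" by (simp add: X_def)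
    also have "\<dots> \<le> 8 * (1 / 10) ^ 5 * X"
      using \<delta> LN0 by (intro mult_mono power_mono X0) auto
    also have "\<dots> \<le> X / 10000" using X0 by (simp add: power_divide)
    finally show ?thesis .
  qed
  have c3: "2 * K * lb \<le> X / 10000"
  proof -
    have "2 * K * lb \<le> 2 * K * (18 * K)" using lb lp K0 by (intro mult_left_mono) auto
    also have "\<dots> \<le> 576 * A\<^sup>2" using K2A by (simp add: power2_eq_square)
    also have "\<dots> \<le> X / 10000" using XA A42 zero_le_power[of A 4] A0 by linarith
    finally show ?thesis .
  qed
  have c4: "c * (ln 2 - 4 / 100 * \<delta>\<^sup>2 * A * LN) \<le> X / 10000 - 108 / 10000 * X"
  proof -
    have d2: "\<delta>\<^sup>2 \<le> 1" using \<delta> by (simp add: power_le_one)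
    have "\<delta> ^ 4 \<le> \<delta>\<^sup>2" using \<delta> by (intro power_decreasing) auto
    then have "\<delta>\<^sup>2 * LN \<ge> \<delta> ^ 4 * LN" using LN0 by (intro mult_right_mono) auto
    moreover have "1728000000 * L\<^sup>2 * A\<^sup>2 \<ge> 1728000000 * 1 * 1"
      using L A by (intro mult_mono) (auto simp: one_le_power)
    ultimately have b1: "\<delta>\<^sup>2 * LN \<ge> 1728000000" using dLN by linarith
    then have "\<delta>\<^sup>2 * LN * A \<ge> 1728000000 * 2000" using A by (intro mult_mono) auto
    then have neg: "1 - 4 / 100 * \<delta>\<^sup>2 * A * LN \<le> 0" by (simp add: mult_ac)
    have "ln 2 - 4 / 100 * \<delta>\<^sup>2 * A * LN \<le> 1 - 4 / 100 * \<delta>\<^sup>2 * A * LN" using ln_2_less_1 by simp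
    moreover have c0: "0 \<le> c" using c A0 by (meson mult_nonneg_nonneg order_trans zero_le_power2 less_imp_le divide_nonneg_nonneg zero_le_numeral)
    ultimately have "c * (ln 2 - 4 / 100 * \<delta>\<^sup>2 * A * LN) \<le> c * (1 - 4 / 100 * \<delta>\<^sup>2 * A * LN)"
      by (intro mult_left_mono)
    also have "\<dots> \<le> 27 / 100 * A * \<delta>\<^sup>2 * (1 - 4 / 100 * \<delta>\<^sup>2 * A * LN)"
      by (rule mult_right_mono_neg[OF c neg])
    also have "\<dots> = 27 / 100 * A * \<delta>\<^sup>2 - 108 / 10000 * X"
      unfolding X_def right_diff_distrib by (simp add: power2_eq_square power4_eq_xxxx)
    also have "27 / 100 * A * \<delta>\<^sup>2 \<le> X / 10000"
    proof -
      have "27 / 100 * A * \<delta>\<^sup>2 \<le> 27 / 100 * A * 1" using d2 A0 by (intro mult_left_mono) auto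
      also have "\<dots> \<le> A ^ 4" using A self_le_power[of A 4] by simp
      also have "\<dots> \<le> X / 10000" using XA zero_le_power[of A 4] A0 by linarith
      finally show ?thesis .
    qed
    finally show ?thesis by simp
  qed
  have c5: "8 * (K * (K + t))\<^sup>2 * (\<delta> ^ 4 * LN / (201 ^ 4 * L\<^sup>2 * A\<^sup>2)) \<le> 2 / 10000 * X"
  proof -
    have "K + 1 \<le> L * K" using K L mult_right_mono[OF L K0] by linarith
    then have "K + t \<le> 10 * (L * K)" using t by simp
    then have "K * (K + t) \<le> K * (10 * (L * K))" using K0 by (intro mult_left_mono) auto
    also have "\<dots> = 10 * L * K\<^sup>2" by (simp add: power2_eq_square)
    also have "\<dots> \<le> 10 * L * (16 * A\<^sup>2)" using K2A L0 by (intro mult_left_mono) auto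
    finally have "(K * (K + t))\<^sup>2 \<le> (160 * L * A\<^sup>2)\<^sup>2" using K0 t by (intro power_mono) auto
    then have "8 * (K * (K + t))\<^sup>2 * (\<delta> ^ 4 * LN / (201 ^ 4 * L\<^sup>2 * A\<^sup>2))
        \<le> 8 * (160 * L * A\<^sup>2)\<^sup>2 * (\<delta> ^ 4 * LN / (201 ^ 4 * L\<^sup>2 * A\<^sup>2))"
      using d4 LN0 by (intro mult_right_mono) auto
    also have "\<dots> = 204800 / 201 ^ 4 * X"
      using A0 L0 by (simp add: X_def field_simps power2_eq_square)
    also have "\<dots> \<le> 2 / 10000 * X" using X0 by (intro mult_right_mono) auto
    finally show ?thesis .
  qed
  show ?thesis using X0 c1 c2 c3 c4 c5 by linarith
qed

text \<open>The quotient \<open>\<rho> / k\<close> must lie between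
  \<open>\<theta> + 1 / 2 - 0.23 * \<delta>\<close> and
  \<open>\<theta> + 1 / 2 - 0.06 * \<delta>\<close>, limits that will come from the sizes of
  \<open>d\<close> and \<open>P ^ 2\<close>. The radius \<open>\<epsilon>\<close> about the centre
  \<open>c\<close> takes the middle half of this interval; the outer quarters are the margin that
  becomes the saving in each degree.\<close>

lemma degree_window:
  fixes \<delta> \<rho> \<theta> :: real
  assumes \<delta>: "0 < \<delta>" "\<delta> < 1 / 10" and \<rho>: "\<rho> * \<delta> \<ge> 20" and \<theta>: "0 \<le> \<theta>" "\<theta> \<le> \<delta> / 4"
  defines "c \<equiv> \<theta> + 1 / 2 - 145 / 1000 * \<delta>" and "\<epsilon> \<equiv> 425 / 10000 * \<delta>"
  obtains M :: "nat set" where "finite M" "real (card M) \<ge> 27 / 100 * \<rho> * \<delta>"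
    "\<And>k. k \<in> M \<Longrightarrow> \<rho> \<le> real k * (c + \<epsilon>) \<and> real k * (c - \<epsilon>) \<le> \<rho> \<and> 194 / 100 * \<rho> \<le> real k \<and> real k \<le> 21 / 10 * \<rho>"
proof -
  have \<rho>0: "\<rho> \<ge> 0" using \<rho> \<delta> by (smt (verit) mult_neg_pos)
  have c1: "c - \<epsilon> \<ge> 48 / 100" "c + \<epsilon> \<le> 515 / 1000" "c + \<epsilon> > 0" "c \<le> 511 / 1000"
    using \<delta> \<theta> by (simp_all add: c_def \<epsilon>_def)
  have \<epsilon>0: "\<epsilon> > 0" using \<delta> by (simp add: \<epsilon>_def)
  define u where "u = \<rho> / (c + \<epsilon>)"
  define w where "w = \<rho> / (c - \<epsilon>)"
  have uw: "w - u \<ge> 32 / 100 * (\<rho> * \<delta>)"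
  proof -
    have "w - u = \<rho> * (2 * \<epsilon>) / ((c - \<epsilon>) * (c + \<epsilon>))"
      using c1 by (simp add: u_def w_def diff_frac_eq algebra_simps)
    moreover have "(c - \<epsilon>) * (c + \<epsilon>) \<le> 262 / 1000"
    proof -
      have "(c - \<epsilon>) * (c + \<epsilon>) \<le> c * c" using \<epsilon>0 by (simp add: algebra_simps)
      also have "\<dots> \<le> (511 / 1000) * (511 / 1000)" using c1 \<epsilon>0 by (intro mult_mono) auto
      finally show ?thesis by simp
    qed
    moreover have "(c - \<epsilon>) * (c + \<epsilon>) > 0" using c1 by simp
    ultimately have "w - u \<ge> \<rho> * (2 * \<epsilon>) / (262 / 1000)"
      using divide_left_mono[of "(c - \<epsilon>) * (c + \<epsilon>)" "262 / 1000" "\<rho> * (2 * \<epsilon>)"] \<rho>0 \<epsilon>0 by simp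
    moreover have "\<rho> * (2 * \<epsilon>) / (262 / 1000) \<ge> 32 / 100 * (\<rho> * \<delta>)"
    proof -
      have eq: "\<rho> * (2 * \<epsilon>) / (262 / 1000) = 85 / 262 * (\<rho> * \<delta>)" by (simp add: \<epsilon>_def)
      show ?thesis unfolding eq using \<rho> by linarith
    qed
    ultimately show ?thesis by linarith
  qed
  have u0: "u \<ge> 0" using \<rho>0 c1 by (simp add: u_def)
  define M where "M = {nat \<lceil>u\<rceil>..nat \<lfloor>w\<rfloor>}"
  have w0: "w \<ge> 0" using uw u0 \<rho> by linarith
  have M: "u \<le> real k" "real k \<le> w" if "k \<in> M" for k
  proof -
    have k: "nat \<lceil>u\<rceil> \<le> k" "k \<le> nat \<lfloor>w\<rfloor>" using that by (auto simp: M_def)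
    then show "u \<le> real k" by linarith
    from k w0 show "real k \<le> w" by linarith
  qed
  have "real (nat \<lfloor>w\<rfloor>) + 1 - real (nat \<lceil>u\<rceil>) \<ge> w - u - 1"
  proof -
    have "real (nat \<lfloor>w\<rfloor>) > w - 1" using w0 by linarith
    moreover have "real (nat \<lceil>u\<rceil>) < u + 1" using u0 by linarith
    ultimately show ?thesis by linarith
  qed
  moreover have "real (card M) \<ge> real (nat \<lfloor>w\<rfloor>) + 1 - real (nat \<lceil>u\<rceil>)"
    unfolding M_def by simp
  \<comment> \<open>Rounding the ends costs at most one degree, which is at most
    \<open>5 / 100 * \<rho> * \<delta>\<close> because
    \<open>\<rho> * \<delta> \<ge> 20\<close>.\<close>
  ultimately have "real (card M) \<ge> 27 / 100 * \<rho> * \<delta>" using uw \<rho> by linarith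
  moreover have "\<rho> \<le> real k * (c + \<epsilon>) \<and> real k * (c - \<epsilon>) \<le> \<rho> \<and> 194 / 100 * \<rho> \<le> real k \<and> real k \<le> 21 / 10 * \<rho>"
    if "k \<in> M" for k
  proof (intro conjI)
    show 1: "\<rho> \<le> real k * (c + \<epsilon>)" using M(1)[OF that] c1 by (simp add: u_def field_simps)
    show 2: "real k * (c - \<epsilon>) \<le> \<rho>" using M(2)[OF that] c1 by (simp add: w_def field_simps)
    have "real k * (c + \<epsilon>) \<le> real k * (515 / 1000)" using c1 by (intro mult_left_mono) auto
    then show "194 / 100 * \<rho> \<le> real k" using 1 \<rho>0 by linarith
    have "real k * (48 / 100) \<le> real k * (c - \<epsilon>)" using c1 by (intro mult_left_mono) auto
    then show "real k \<le> 21 / 10 * \<rho>" using 2 \<rho>0 by linarith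
  qed
  ultimately show thesis by (intro that[of M]) (auto simp: M_def)
qed

text \<open>The explicit threshold \<open>3\<close> suffices because the range of \<open>N\<close>
  already forces all parameters to be large: its upper end gives \<open>A \<ge> 2000\<close>, and
  its lower end makes \<open>ln N\<close> large in terms of \<open>A\<close>.\<close>

lemma kloosterman_sum_small:
  fixes \<delta> :: real and q :: nat and a b c N :: int
  assumes \<delta>: "0 < \<delta>" "\<delta> < 1 / 10" and q: "q \<ge> 3" and a: "coprime a (int q)"
    and N1: "real (squarefree_kernel q) powr (2 + \<delta>) \<le> real_of_int N"
    and N2: "exp (gamma1 \<delta> * ln (real q) powr (2 / 3)) \<le> real_of_int N"
    and N3: "real_of_int N \<le> real q powr (\<delta> / 20)"
  shows "cmod (kloosterman_sum q a b c N) <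
                real_of_int N * exp (- gamma0 \<delta> * (ln (real_of_int N) ^ 3 / ln (real q) ^ 2))"
proof -

  \<comment> \<open>Sizes on the logarithmic scale\<close>
  define d where "d = squarefree_kernel q"
  define LN where "LN = ln (real_of_int N)"
  define lq where "lq = ln (real q)"
  define ld where "ld = ln (real d)"
  define L where "L = ln (1 / \<delta>)"
  define \<rho> where "\<rho> = lq / LN"
  define A where "A = \<rho> / \<delta>"
  define \<Gamma> where "\<Gamma> = \<delta> ^ 4 * LN / (201 ^ 4 * L\<^sup>2 * A\<^sup>2)"
  have d0: "d > 0" unfolding d_def squarefree_kernel_def by (intro prod_pos) (auto dest: in_prime_factors_imp_prime prime_gt_0_nat)
  have N0: "real_of_int N > 0" using N2 exp_gt_zero order_less_le_trans by blast
  have q0: "real q > 0" "q > 0" using q by auto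
  have lq0: "lq > 0" using q by (simp add: lq_def)
  have L2: "L \<ge> 2"
  proof -
    have "exp 2 = exp 1 * exp (1 :: real)" by (simp flip: exp_add)
    also have "\<dots> \<le> 3 * 3" using exp_le by (intro mult_mono) auto
    also have "\<dots> \<le> 1 / \<delta>" using \<delta> by (simp add: field_simps)
    finally show ?thesis using \<delta> by (simp add: L_def ln_ge_iff)
  qed
  have L\<delta>: "exp (- L) = \<delta>" using \<delta> by (simp add: L_def ln_div)
  have LN1: "(2 + \<delta>) * ld \<le> LN"
  proof -
    have "ln (real d powr (2 + \<delta>)) \<le> LN"
      unfolding LN_def using N1 N0 d0 by (subst ln_le_cancel_iff) (auto simp: d_def)
    then show ?thesis using d0 by (simp add: ld_def ln_powr)
  qed
  have LN2: "gamma1 \<delta> * lq powr (2 / 3) \<le> LN"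
    using N2 N0 by (simp add: LN_def lq_def ln_ge_iff)
  have LN3: "LN \<le> \<delta> / 20 * lq"
  proof -
    have "LN \<le> ln (real q powr (\<delta> / 20))"
      unfolding LN_def using N3 N0 q0 by (subst ln_le_cancel_iff) auto
    then show ?thesis using q0 by (simp add: lq_def ln_powr)
  qed
  have g1: "gamma1 \<delta> = 1200 / \<delta>\<^sup>2 * L powr (2 / 3)"
    by (simp add: gamma1_def L_def power_int_def inverse_eq_divide power_divide)
  have g1pos: "gamma1 \<delta> > 0" using \<delta> L2 by (simp add: g1)
  have LN0: "LN > 0" using LN2 g1pos lq0 by (smt (verit) mult_pos_pos powr_gt_zero)
  \<comment> \<open>Cubing clears the exponents \<open>2 / 3\<close> in the lower bound for
    \<open>N\<close>; the constant is \<open>1200 ^ 3\<close>.\<close>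
  have cube: "1728000000 / \<delta> ^ 6 * L\<^sup>2 * lq\<^sup>2 \<le> LN ^ 3"
  proof -
    have p3: "(y powr (2 / 3)) ^ 3 = y\<^sup>2" if "y > 0" for y :: real
    proof -
      have "(y powr (2 / 3)) ^ 3 = (y powr (2 / 3)) powr real 3" using that by (subst powr_realpow) auto
      also have "\<dots> = y powr real 2" by (simp add: powr_powr)
      also have "\<dots> = y\<^sup>2" using that by (subst powr_realpow) auto
      finally show ?thesis .
    qed
    have "(gamma1 \<delta> * lq powr (2 / 3)) ^ 3 \<le> LN ^ 3"
      using LN2 g1pos by (intro power_mono) (auto intro!: mult_nonneg_nonneg)
    moreover have "(gamma1 \<delta> * lq powr (2 / 3)) ^ 3 = (1200 / \<delta>\<^sup>2) ^ 3 * L\<^sup>2 * lq\<^sup>2"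
      unfolding g1 power_mult_distrib using p3[of L] p3[of lq] L2 lq0 by simp
    moreover have "(1200 / \<delta>\<^sup>2) ^ 3 = 1728000000 / \<delta> ^ 6" by (simp add: power_divide power_mult[symmetric])
    ultimately show ?thesis by simp
  qed
  have \<rho>20: "\<rho> * \<delta> \<ge> 20" using LN3 LN0 by (simp add: \<rho>_def field_simps)
  have \<rho>A: "\<rho> = A * \<delta>" using \<delta> by (simp add: A_def)
  have lq\<rho>: "lq = \<rho> * LN" using LN0 by (simp add: \<rho>_def)
  have \<rho>0: "\<rho> > 0" using lq0 LN0 by (simp add: \<rho>_def)
  have A0: "A > 0" using \<rho>0 \<delta> by (simp add: A_def)
  have Ad: "A * \<delta>\<^sup>2 \<ge> 20" using \<rho>20 by (simp add: \<rho>A power2_eq_square mult.assoc)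
  have A2000: "A \<ge> 2000"
  proof -
    have "\<delta>\<^sup>2 \<le> (1 / 10)\<^sup>2" using \<delta> by (intro power_mono) auto
    then have "A * \<delta>\<^sup>2 \<le> A * (1 / 100)" using A0 by (intro mult_left_mono) (auto simp: power2_eq_square)
    then show ?thesis using Ad by linarith
  qed
  have LNA: "LN \<ge> 1728000000 * L\<^sup>2 * A\<^sup>2 / \<delta> ^ 4"
  proof -
    have "1728000000 / \<delta> ^ 6 * L\<^sup>2 * (\<rho> * LN)\<^sup>2 \<le> LN * LN\<^sup>2"
      using cube lq\<rho> by (simp add: power2_eq_square power3_eq_cube)
    then have "(1728000000 / \<delta> ^ 6 * L\<^sup>2 * \<rho>\<^sup>2) * LN\<^sup>2 \<le> LN * LN\<^sup>2"
      by (simp add: power_mult_distrib mult_ac)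
    then have "1728000000 / \<delta> ^ 6 * L\<^sup>2 * \<rho>\<^sup>2 \<le> LN"
      using LN0 by (subst (asm) mult_le_cancel_right) auto
    moreover have "1728000000 / \<delta> ^ 6 * L\<^sup>2 * \<rho>\<^sup>2 = 1728000000 * L\<^sup>2 * A\<^sup>2 / \<delta> ^ 4"
      using \<delta> unfolding \<rho>A by (simp add: field_simps eval_nat_numeral)
    ultimately show ?thesis by simp
  qed
  have LNbig: "\<delta> * LN \<ge> 7200 * A"
  proof -
    have "\<delta> ^ 4 * LN \<ge> 1728000000 * L\<^sup>2 * A\<^sup>2" using LNA \<delta> by (simp add: field_simps)
    moreover have "L\<^sup>2 \<ge> 1" using L2 by (simp add: one_le_power)
    then have "1728000000 * L\<^sup>2 * A\<^sup>2 \<ge> 1728000000 * 1 * A\<^sup>2" by (intro mult_right_mono) auto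
    moreover have "A\<^sup>2 \<ge> A" using A2000 by (simp add: power2_eq_square)
    moreover have "\<delta> ^ 4 * LN \<le> \<delta> * LN"
      using \<delta> LN0 power_decreasing[of 1 4 \<delta>] by (intro mult_right_mono) auto
    ultimately show ?thesis using A0 by linarith
  qed
  have \<Gamma>: "gamma0 \<delta> * (ln (real_of_int N) ^ 3 / ln (real q) ^ 2) = \<Gamma>"
  proof -
    have "gamma0 \<delta> = \<delta> ^ 6 / (201 ^ 4 * L\<^sup>2)"
      by (simp add: gamma0_def L_def power_int_def power_divide inverse_eq_divide)
    then have "gamma0 \<delta> * (LN ^ 3 / lq\<^sup>2) = \<delta> ^ 6 / (201 ^ 4 * L\<^sup>2) * (LN ^ 3 / (A * \<delta> * LN)\<^sup>2)"
      by (simp add: lq\<rho> \<rho>A)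
    also have "\<dots> = \<Gamma>" using LN0 A0 \<delta> L2 by (simp add: \<Gamma>_def field_simps eval_nat_numeral)
    finally show ?thesis by (simp add: LN_def lq_def)
  qed
  have \<Gamma>1: "\<Gamma> \<ge> 1"
  proof -
    have "\<delta> ^ 4 * LN \<ge> 1728000000 * L\<^sup>2 * A\<^sup>2" using LNA \<delta> by (simp add: field_simps)
    moreover have "201 ^ 4 * L\<^sup>2 * A\<^sup>2 \<le> 1728000000 * L\<^sup>2 * A\<^sup>2" by (intro mult_right_mono) auto
    ultimately have "201 ^ 4 * L\<^sup>2 * A\<^sup>2 \<le> \<delta> ^ 4 * LN" by linarith
    moreover have "201 ^ 4 * L\<^sup>2 * A\<^sup>2 > 0" using A0 L2 by simp
    ultimately show ?thesis unfolding \<Gamma>_def by (simp only: le_divide_eq_1_pos)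
  qed
  \<comment> \<open>The right side is the margin by which \<open>q1 * P ^ 2\<close> will fall short
    of \<open>N\<close>, on the logarithmic scale.\<close>
  have \<Gamma>3: "3 * \<Gamma> \<le> 3 / 100 * \<delta> * LN"
  proof -
    have "1 * 1 \<le> L\<^sup>2 * A\<^sup>2" using L2 A2000 by (intro mult_mono) (auto simp: one_le_power)
    then have "201 ^ 4 * L\<^sup>2 * A\<^sup>2 \<ge> 100" by simp
    then have "\<Gamma> \<le> \<delta> ^ 4 * LN / 100" unfolding \<Gamma>_def using \<delta> LN0 by (intro divide_left_mono) auto
    also have "\<dots> \<le> \<delta> ^ 1 * LN / 100" using \<delta> LN0 by (intro divide_right_mono mult_right_mono power_decreasing) auto
    finally show ?thesis by (simp add: mult_ac)
  qed

  \<comment> \<open>Choice of the degree, the number of variables and the prime\<close>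
  define s where "s = nat \<lceil>4 * A\<rceil>"
  define K where "K = s - 1"
  \<comment> \<open>From \<open>s \<ge> 4 * A\<close> the factor \<open>q powr (1 / s)\<close> in
    the bound for \<open>q1\<close> is at most \<open>N powr (\<delta> / 4)\<close>.\<close>
  have s1: "real s \<ge> 4 * A" "real s < 4 * A + 1" using A0 by (simp_all add: s_def) linarith+
  have s2: "s \<ge> 2" using s1 A2000 by linarith
  have KR: "real K = real s - 1" using s2 by (simp add: K_def)
  have K1: "real K \<le> 4 * A" "real K \<ge> 4 * A - 1" "real K \<ge> 7999" using KR s1 A2000 by linarith+
  \<comment> \<open>With this many blocks
    \<open>(1 - 1 / K) ^ t \<le> exp (- 9 * L) = \<delta> ^ 9\<close>.\<close>
  define t where "t = nat \<lceil>9 * L * real K\<rceil>"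
  have t1: "9 * L * real K \<le> real t" "real t \<le> 9 * L * real K + 1"
  proof -
    have "9 * L * real K \<ge> 0" using L2 by simp
    then show "9 * L * real K \<le> real t" "real t \<le> 9 * L * real K + 1" unfolding t_def by linarith+
  qed
  define bb where "bb = K * (K + t)"
  have LK: "L \<le> real K / 9"
  proof -
    have "L \<le> 1 / \<delta> - 1" unfolding L_def using \<delta> by (intro ln_le_minus_one) simp
    moreover have "1 / \<delta> \<le> A / 200"
    proof -
      have "1 / \<delta> \<le> \<delta> * A / 20" using Ad \<delta> by (simp add: field_simps power2_eq_square)
      also have "\<dots> \<le> (1 / 10) * A / 20" using \<delta> A0 by (intro divide_right_mono mult_right_mono) auto
      finally show ?thesis by simp
    qed
    ultimately show ?thesis using K1 A2000 by linarith
  qed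
  have bbK: "real bb \<le> real K ^ 4"
  proof -
    define y where "y = real K * real K"
    have "9 * L * real K \<le> y" unfolding y_def using LK by (intro mult_right_mono) auto
    moreover have "1 * real K \<le> y" unfolding y_def using K1 by (intro mult_right_mono) auto
    ultimately have "real (K + t) \<le> 3 * y" using t1 K1 unfolding of_nat_add by linarith
    then have "real (K + t) \<le> 3 * (real K * real K)" by (simp only: y_def)
    also have "\<dots> \<le> real K * (real K * real K)" using K1 by (intro mult_right_mono) auto
    finally have "real K * real (K + t) \<le> real K * (real K * (real K * real K))" by (intro mult_left_mono) auto
    then show ?thesis by (simp add: bb_def power4_eq_xxxx)
  qed
  have K4: "K \<ge> 4" using K1 by linarith
  \<comment> \<open>Exceeding \<open>K ^ 4\<close> meets both lower bounds on the prime in the mean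
    value estimate, since \<open>bb \<le> K ^ 4\<close>; the upper bound keeps \<open>ln p\<close>
    of order \<open>ln K\<close>.\<close>
  obtain p where p: "prime p" "K ^ 4 < p" "p \<le> (K ^ 4)\<^sup>2 + 1"
  proof -
    have "K ^ 1 \<le> K ^ 4" using K4 by (intro power_increasing) auto
    then have "K ^ 4 \<ge> 5" using K1 by simp
    then show thesis using exists_prime_between that by blast
  qed
  define lp where "lp = ln (real p)"
  have pK: "real K ^ 4 < real p" using p(2) unfolding of_nat_power[symmetric] of_nat_less_iff .
  have p3: "real p \<ge> 3"
  proof -
    have "real K ^ 1 \<le> real K ^ 4" using K1 by (intro power_increasing) auto
    then show ?thesis using pK K1 by simp
  qed
  have lp0: "lp > 0" using p3 by (simp add: lp_def)
  have lp9: "lp \<le> 9 * real K"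
  proof -
    have "real p \<le> real ((K ^ 4)\<^sup>2 + 1)" using p(3) by (simp only: of_nat_le_iff)
    also have "\<dots> = (real K ^ 4)\<^sup>2 + 1" by simp
    also have "\<dots> \<le> 2 * (real K ^ 4)\<^sup>2" using K1 by (simp add: one_le_power)
    also have "\<dots> \<le> real K * (real K ^ 4)\<^sup>2" using K1 by (intro mult_right_mono) auto
    also have "\<dots> = real K ^ 9" by (simp add: power_mult[symmetric] flip: power_Suc)
    finally have "lp \<le> ln (real K ^ 9)" unfolding lp_def using p3 K1 by (subst ln_le_cancel_iff) auto
    also have "\<dots> = 9 * ln (real K)" using K1 by (simp add: ln_realpow)
    also have "\<dots> \<le> 9 * real K" using ln_le_minus_one[of "real K"] K1 by simp
    finally show ?thesis .
  qed
  have bbp: "real bb \<le> real p" using bbK pK by simp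
  define lb where "lb = ln (3 * real bb)"
  have "bb \<ge> 1" using K4 by (simp add: bb_def Suc_le_eq)
  then have bb1: "real bb \<ge> 1" by simp
  have lb2: "lb \<le> 2 * lp"
  proof -
    have "3 * real bb \<le> real p * real p" using bbp p3 bb1 by (intro mult_mono) auto
    then have "lb \<le> ln (real p * real p)" unfolding lb_def using bb1 p3 by (subst ln_le_cancel_iff) auto
    then show ?thesis using p3 by (simp add: lp_def ln_mult)
  qed

  \<comment> \<open>Choice of the length \<open>P\<close>\<close>
  define \<tau> where "\<tau> = 1 / 4 - \<delta> / 40"
  \<comment> \<open>\<open>P\<close> will be the largest power of \<open>p\<close> up to
    \<open>N powr \<tau>\<close>, so that \<open>P ^ 2 \<le> N powr (1 / 2 - \<delta> / 20)\<close>.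
    Rounding to a power of \<open>p\<close> worsens the matching lower bound from
    \<open>0.05 * \<delta>\<close> to \<open>0.06 * \<delta>\<close> in the exponent.\<close>
  define m where "m = nat \<lfloor>\<tau> * LN / lp\<rfloor>"
  define x where "x = real m * lp"
  have \<tau>0: "\<tau> > 0" using \<delta> by (simp add: \<tau>_def)
  have x1: "x \<le> \<tau> * LN" "x \<ge> \<tau> * LN - lp" "x \<ge> 0"
  proof -
    have y0: "\<tau> * LN / lp \<ge> 0" using \<tau>0 LN0 lp0 by simp
    have "real m \<le> \<tau> * LN / lp" "real m \<ge> \<tau> * LN / lp - 1" using y0 unfolding m_def by linarith+
    then have "real m * lp \<le> \<tau> * LN / lp * lp" "real m * lp \<ge> (\<tau> * LN / lp - 1) * lp"
      using lp0 by (intro mult_right_mono; simp)+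
    then show "x \<le> \<tau> * LN" "x \<ge> \<tau> * LN - lp" using lp0 by (simp_all add: x_def left_diff_distrib)
    show "x \<ge> 0" using lp0 by (simp add: x_def)
  qed
  have x4: "x \<le> LN / 4"
  proof -
    have "\<tau> * LN \<le> 1 / 4 * LN" using \<delta> LN0 by (intro mult_right_mono) (auto simp: \<tau>_def)
    then show ?thesis using x1(1) by linarith
  qed
  have x2up: "2 * x \<le> (1 / 2 - 5 / 100 * \<delta>) * LN" using x1(1) by (simp add: \<tau>_def algebra_simps)
  have x2lo: "2 * x \<ge> (1 / 2 - 6 / 100 * \<delta>) * LN"
  proof -
    have "2 * lp \<le> 72 * A" using lp9 K1 by linarith
    also have "\<dots> \<le> 1 / 100 * (\<delta> * LN)" using LNbig by linarith
    finally show ?thesis using x1(2) by (simp add: \<tau>_def algebra_simps)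
  qed
  define P where "P = int p ^ m"
  have P0: "P > 0" using p3 by (simp add: P_def)
  have Pexp: "real_of_int P = exp x"
  proof -
    have "exp x = (exp lp) ^ m" by (simp add: x_def exp_of_nat_mult)
    then show ?thesis using p3 by (simp add: P_def lp_def)
  qed

  \<comment> \<open>The root modulus and the good degrees\<close>
  obtain q1 where q1: "q dvd q1 ^ s" "q1 ^ s dvd q * d ^ s"
    using exists_root_modulus[of q s] q0 s2 by (auto simp: d_def)
  define \<theta> where "\<theta> = \<rho> / real s"
  have \<theta>: "0 \<le> \<theta>" "\<theta> \<le> \<delta> / 4"
  proof -
    show "0 \<le> \<theta>" using \<rho>0 by (simp add: \<theta>_def)
    have "\<rho> / real s \<le> \<rho> / (4 * A)" using s1 A0 \<rho>0 by (intro divide_left_mono) auto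
    then show "\<theta> \<le> \<delta> / 4" using A0 by (simp add: \<theta>_def \<rho>A)
  qed
  have lqs: "lq / real s = \<theta> * LN" by (simp add: \<theta>_def lq\<rho>)
  have ld1: "ld \<le> (1 / 2 - 23 / 100 * \<delta>) * LN"
  proof -
    \<comment> \<open>To first order \<open>1 / (2 + \<delta>)\<close> is
      \<open>1 / 2 - \<delta> / 4\<close>; relaxing \<open>0.25\<close> to \<open>0.23\<close>
      covers the quadratic term for \<open>\<delta> < 1 / 10\<close>.\<close>
    have "1 \<le> (2 + \<delta>) * (1 / 2 - 23 / 100 * \<delta>)"
    proof -
      have "\<delta> * \<delta> \<le> \<delta> * (1 / 10)" using \<delta> by (intro mult_left_mono) auto
      moreover have "(2 + \<delta>) * (1 / 2 - 23 / 100 * \<delta>) = 1 + 4 / 100 * \<delta> - 23 / 100 * (\<delta> * \<delta>)" by (simp add: field_simps)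
      ultimately show ?thesis using \<delta> by linarith
    qed
    then have "1 * LN \<le> (2 + \<delta>) * (1 / 2 - 23 / 100 * \<delta>) * LN" using LN0 by (intro mult_right_mono) auto
    then have "(2 + \<delta>) * ld \<le> (2 + \<delta>) * ((1 / 2 - 23 / 100 * \<delta>) * LN)" using LN1 by (simp add: mult.assoc)
    then show ?thesis using \<delta> by (subst (asm) mult_le_cancel_left) auto
  qed
  \<comment> \<open>In the window \<open>k \<ge> 1.94 * \<rho>\<close>, so the margin
    \<open>0.0425 * \<delta> * k * LN\<close> is at least
    \<open>0.08 * \<delta> * \<rho> * LN\<close>, which is \<open>h\<close> because
    \<open>\<rho> = \<delta> * A\<close>.\<close>
  define h where "h = 8 / 100 * \<delta>\<^sup>2 * A * LN"
  have h0: "h \<ge> 0" using A0 LN0 by (simp add: h_def)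
  obtain M where M: "finite M" "real (card M) \<ge> 27 / 100 * \<rho> * \<delta>"
    "\<And>k. k \<in> M \<Longrightarrow> \<rho> \<le> real k * (\<theta> + 1 / 2 - 145 / 1000 * \<delta> + 425 / 10000 * \<delta>)
       \<and> real k * (\<theta> + 1 / 2 - 145 / 1000 * \<delta> - 425 / 10000 * \<delta>) \<le> \<rho> \<and> 194 / 100 * \<rho> \<le> real k \<and> real k \<le> 21 / 10 * \<rho>"
    using degree_window[OF \<delta> \<rho>20 \<theta>] by metis
  \<comment> \<open>The good degrees lie near \<open>2 * \<rho>\<close>, and
    \<open>\<rho> = \<delta> * A\<close> is below \<open>A / 10\<close>, so they are far below
    \<open>K\<close>, which is about \<open>4 * A\<close>.\<close>
  have Mk: "2 \<le> k \<and> k \<le> K" if "k \<in> M" for k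
  proof -
    have "\<rho> \<ge> 20"
    proof -
      have "\<rho> * \<delta> \<le> \<rho> * 1" using \<delta> \<rho>0 by (intro mult_left_mono) auto
      then show ?thesis using \<rho>20 by simp
    qed
    moreover have "10 * \<rho> \<le> A" using \<delta> A0 by (simp add: \<rho>A)
    ultimately have "2 \<le> real k \<and> real k \<le> real K" using M(3)[OF that] K1 A2000 by linarith
    then show ?thesis by simp
  qed
  define H where "H k = int bb * P ^ k" for k
  have H1: "(exp (real k * x))\<^sup>2 \<le> (of_int (2 * H k + 1))\<^sup>2" for k
  proof -
    have "real_of_int (P ^ k) = exp (real k * x)" by (simp add: Pexp exp_of_nat_mult)
    moreover have "P ^ k \<le> 2 * H k + 1"
    proof -
      have "1 * P ^ k \<le> int bb * P ^ k" using bb1 P0 by (intro mult_right_mono) auto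
      moreover have "0 \<le> int bb * P ^ k" using P0 by simp
      ultimately show ?thesis by (simp add: H_def)
    qed
    then have "real_of_int (P ^ k) \<le> of_int (2 * H k + 1)" by (simp only: of_int_le_iff)
    ultimately show ?thesis by (intro power_mono) auto
  qed
  have Qbounds: "exp h \<le> real q / real (gcd q (q1 ^ k)) \<and>
      real q / real (gcd q (q1 ^ k)) * exp h \<le> (of_int (2 * H k + 1))\<^sup>2" if k: "k \<in> M" for k
  proof -
    define Q where "Q = real q / real (gcd q (q1 ^ k))"
    note w = M(3)[OF k]
    have "k \<le> s" using Mk[OF k] unfolding K_def by linarith
    then have Qb: "ln Q \<ge> lq - real k * (ld + lq / real s)" "ln Q \<le> lq - real k * lq / real s" "Q > 0"
      using root_modulus_bounds[OF q0(2) d0 _ q1, of k] s2 unfolding Q_def lq_def ld_def by auto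
    have hk: "h \<le> real k * (425 / 10000 * \<delta>) * LN"
    proof -
      have "h = 8 / 100 * \<rho> * \<delta> * LN" by (simp add: h_def \<rho>A power2_eq_square)
      also have "\<dots> \<le> (194 / 100 * \<rho>) * (425 / 10000 * \<delta>) * LN" using \<rho>0 \<delta> LN0 by simp
      also have "\<dots> \<le> real k * (425 / 10000 * \<delta>) * LN"
        using w \<delta> LN0 by (intro mult_right_mono) auto
      finally show ?thesis .
    qed
    \<comment> \<open>The step from \<open>0.23\<close> to \<open>0.145 + 0.0425 = 0.1875\<close> in
      the coefficient of \<open>\<delta>\<close> is exactly the margin that pays for
      \<open>h\<close>; the upper bound uses \<open>0.06\<close> and \<open>0.145 - 0.0425\<close>
      in the same way.\<close>
    have lower: "h \<le> ln Q"
    proof -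
      have "real k * (ld + lq / real s) \<le> real k * ((1 / 2 - 23 / 100 * \<delta> + \<theta>) * LN)"
        using ld1 by (intro mult_left_mono) (simp_all add: lqs algebra_simps)
      also have "\<dots> = (real k * (\<theta> + 1 / 2 - 145 / 1000 * \<delta> - 425 / 10000 * \<delta>)) * LN - real k * (425 / 10000 * \<delta>) * LN"
        by (simp add: algebra_simps)
      also have "\<dots> \<le> \<rho> * LN - h"
        using w hk LN0 by (intro diff_mono mult_right_mono) auto
      finally show ?thesis using Qb(1) lq\<rho> by linarith
    qed
    have upper: "ln Q + h \<le> 2 * (real k * x)"
    proof -
      have "real k * lq / real s = real k * (lq / real s)" by simp
      also have "\<dots> = real k * \<theta> * LN" unfolding lqs by (simp only: mult.assoc)
      finally have "ln Q \<le> \<rho> * LN - real k * \<theta> * LN" using Qb(2) lq\<rho> by linarith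
      also have "\<dots> \<le> (real k * (\<theta> + 1 / 2 - 145 / 1000 * \<delta> + 425 / 10000 * \<delta>)) * LN - real k * \<theta> * LN"
        using w LN0 by (intro diff_right_mono mult_right_mono) auto
      also have "\<dots> = real k * ((1 / 2 - 6 / 100 * \<delta>) * LN) - real k * (425 / 10000 * \<delta>) * LN"
        by (simp add: algebra_simps)
      also have "\<dots> \<le> real k * (2 * x) - h" using x2lo hk by (intro diff_mono mult_left_mono) auto
      finally show ?thesis by simp
    qed
    have "exp h \<le> exp (ln Q)" using lower by simp
    moreover have "Q * exp h = exp (ln Q + h)" using Qb(3) by (simp add: exp_add)
    moreover have "exp (ln Q + h) \<le> exp (2 * (real k * x))" using upper by simp
    moreover have "exp (2 * (real k * x)) = (exp (real k * x))\<^sup>2" by (simp add: exp_double)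
    ultimately show ?thesis using Qb(3) H1[of k] unfolding Q_def[symmetric] by simp
  qed

  \<comment> \<open>The double sum over \<open>x\<close> and \<open>y\<close>\<close>
  define e where "e = (1 - 1 / real K) ^ t"
  have e1: "0 \<le> e" "e \<le> \<delta> ^ 9"
  proof -
    have k0: "0 \<le> 1 - 1 / real K" using K1 by simp
    then show "0 \<le> e" by (simp add: e_def)
    have "1 - 1 / real K \<le> exp (- (1 / real K))" using exp_ge_add_one_self[of "- (1 / real K)"] by simp
    then have "e \<le> exp (- (1 / real K)) ^ t" unfolding e_def using k0 by (intro power_mono)
    also have "\<dots> = exp (- (real t / real K))" by (simp flip: exp_of_nat_mult)
    also have "\<dots> \<le> exp (- (9 * L))" using t1 K1 by (simp add: field_simps)
    also have "\<dots> = exp (- L) ^ 9" by (simp flip: exp_of_nat_mult)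
    finally show "e \<le> \<delta> ^ 9" by (simp add: L\<delta>)
  qed
  have W: "cmod (\<Sum>x\<in>{0..<P}. \<Sum>y\<in>{0..<P}.
       cis (2 * pi * (\<Sum>k=1..s - 1. of_int (shift_coeff a b (int q1) (modular_inverse (int q) n) k) / real q * of_int (x * y) ^ k)))
       \<le> (of_int P)\<^sup>2 * exp (- 2 * \<Gamma>)" (is "?W \<le> _") if n: "coprime n (int q)" for n
  proof -
    let ?\<alpha> = "\<lambda>k. of_int (shift_coeff a b (int q1) (modular_inverse (int q) n) k) / real q"
    define S where "S = 2 * exp (- h / 2)"
    have "?W ^ (4 * bb\<^sup>2) \<le> of_int P ^ (8 * bb\<^sup>2)
       * (real_of_int (int p) powr (4 * real K ^ 2 * real t + real m * (real K * (real K + 1)) * (1 - 1 / real K) ^ t)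
       * (3 * real bb) ^ (2 * K) * S ^ card M)"
      unfolding P_def bb_def K_def[symmetric]
    proof (rule double_sum_mean_value_bound)
      show "prime (int p)" using p by simp
      show "real K ^ 4 \<le> real_of_int (int p)" "real (K * (K + t)) \<le> real_of_int (int p)"
        using pK bbp by (simp_all add: bb_def)
      show "M \<subseteq> {1..K}" using Mk by fastforce
      fix k assume k: "k \<in> M"
      have "0 \<le> H k" using P0 by (simp add: H_def)
      then show "(\<Sum>\<mu>\<in>{- (int (K * (K + t)) * (int p ^ m) ^ k)..int (K * (K + t)) * (int p ^ m) ^ k}.
          cmod (\<Sum>l\<in>{- (int (K * (K + t)) * (int p ^ m) ^ k)..int (K * (K + t)) * (int p ^ m) ^ k}. cis (2 * pi * (?\<alpha> k * of_int l * of_int \<mu>))))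
        \<le> (of_int (2 * (int (K * (K + t)) * (int p ^ m) ^ k) + 1))\<^sup>2 * S"
        using kloosterman_coeff_bilinear[where k = k and H = "H k" and ?q1.0 = q1 and h = h and b = b, OF q0(2) a n _ _ refl] Mk[OF k] Qbounds[OF k]
        unfolding S_def H_def P_def bb_def by blast
    qed (use K4 in \<open>auto simp: S_def\<close>)
    also have "real_of_int (int p) powr (4 * real K ^ 2 * real t + real m * (real K * (real K + 1)) * (1 - 1 / real K) ^ t)
       * (3 * real bb) ^ (2 * K) * S ^ card M
      = exp (4 * (real K)\<^sup>2 * real t * lp + x * (real K * (real K + 1)) * e + 2 * real K * lb
          + real (card M) * (ln 2 - 4 / 100 * \<delta>\<^sup>2 * A * LN))"
    proof -
      have "real_of_int (int p) powr (4 * real K ^ 2 * real t + real m * (real K * (real K + 1)) * (1 - 1 / real K) ^ t)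
          = exp (4 * (real K)\<^sup>2 * real t * lp + x * (real K * (real K + 1)) * e)"
        using p3 by (simp add: powr_def lp_def[symmetric] e_def x_def algebra_simps)
      moreover have "(3 * real bb) ^ (2 * K) = exp (2 * real K * lb)"
      proof -
        have "exp (2 * real K * lb) = exp lb ^ (2 * K)" by (simp flip: exp_of_nat_mult)
        then show ?thesis using bb1 by (simp add: lb_def)
      qed
      moreover have "S ^ card M = exp (real (card M) * (ln 2 - 4 / 100 * \<delta>\<^sup>2 * A * LN))"
      proof -
        have "S = exp (ln 2 - 4 / 100 * \<delta>\<^sup>2 * A * LN)"
        proof -
          have "- h / 2 = - (4 / 100 * \<delta>\<^sup>2 * A * LN)" by (simp add: h_def)
          moreover have "exp (ln 2 - y) = 2 * exp (- y)" for y :: real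
            by (simp add: exp_diff exp_minus divide_inverse)
          ultimately show ?thesis by (simp only: S_def)
        qed
        then show ?thesis by (simp only: exp_of_nat_mult)
      qed
      ultimately show ?thesis by (simp only: exp_add)
    qed
    also have "\<dots> \<le> exp (- (8 * (real K * (real K + real t))\<^sup>2 * \<Gamma>))"
      unfolding \<Gamma>_def exp_le_cancel_iff
      using \<delta> L2 A2000 LNA K1 t1 lp0 lp9 x1 x4 e1 lb2 M(2)
      by (intro total_exponent_bound) (auto simp: \<rho>A power2_eq_square mult.assoc)
    also have "8 * (real K * (real K + real t))\<^sup>2 * \<Gamma> = real (4 * bb\<^sup>2) * (2 * \<Gamma>)"
      by (simp add: bb_def)
    also have "of_int P ^ (8 * bb\<^sup>2) * exp (- (real (4 * bb\<^sup>2) * (2 * \<Gamma>))) = ((of_int P)\<^sup>2 * exp (- 2 * \<Gamma>)) ^ (4 * bb\<^sup>2)"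
    proof -
      have "exp (- (real (4 * bb\<^sup>2) * (2 * \<Gamma>))) = exp (- 2 * \<Gamma>) ^ (4 * bb\<^sup>2)"
        unfolding exp_of_nat_mult[symmetric] by simp
      moreover have "real_of_int P ^ (8 * bb\<^sup>2) = ((of_int P)\<^sup>2) ^ (4 * bb\<^sup>2)" by (simp flip: power_mult)
      ultimately show ?thesis by (simp only: power_mult_distrib)
    qed
    finally have pw: "?W ^ (4 * bb\<^sup>2) \<le> ((of_int P)\<^sup>2 * exp (- 2 * \<Gamma>)) ^ (4 * bb\<^sup>2)"
      using P0 by (simp add: mult_left_mono)
    have "4 * bb\<^sup>2 > 0" using bb1 by simp
    then show ?thesis using pw by (subst (asm) power_mono_iff) auto
  qed

  \<comment> \<open>Boundary terms and conclusion\<close>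
  have q1N: "real q1 * (of_int P)\<^sup>2 \<le> of_int N * exp (- 3 * \<Gamma>)"
  proof -
    have q1b: "real q1 > 0" "ln (real q1) \<le> ld + lq / real s"
      using root_modulus_bounds(1,2)[OF q0(2) d0 _ q1, of 0] s2 unfolding lq_def ld_def by auto
    \<comment> \<open>The three shares of \<open>ln N\<close> belong to \<open>d\<close>,
      \<open>q powr (1 / s)\<close> and \<open>P ^ 2\<close>; with
      \<open>\<theta> \<le> \<delta> / 4\<close> they add up to at most
      \<open>1 - 0.03 * \<delta>\<close>.\<close>
    have "ln (real q1) + 2 * x \<le> (1 / 2 - 23 / 100 * \<delta>) * LN + \<theta> * LN + (1 / 2 - 5 / 100 * \<delta>) * LN"
      using q1b(2) ld1 x2up lqs by linarith
    also have "\<dots> \<le> (1 / 2 - 23 / 100 * \<delta>) * LN + \<delta> / 4 * LN + (1 / 2 - 5 / 100 * \<delta>) * LN"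
      using \<theta> LN0 by (intro add_mono mult_right_mono) auto
    also have "\<dots> = LN - 3 / 100 * \<delta> * LN" by (simp add: algebra_simps)
    also have "\<dots> \<le> LN + - 3 * \<Gamma>" using \<Gamma>3 by linarith
    finally have "exp (ln (real q1) + 2 * x) \<le> exp (LN + - 3 * \<Gamma>)" by simp
    then show ?thesis using q1b(1) N0 by (simp only: exp_add exp_double Pexp LN_def exp_ln)
  qed
  have main: "(of_int P)\<^sup>2 * cmod (kloosterman_sum q a b c N)
      \<le> of_int N * ((of_int P)\<^sup>2 * exp (- 2 * \<Gamma>)) + 2 * of_int (int q1) * of_int P ^ 4"
  proof (rule kloosterman_sum_shift_bound[OF q0(2) s2])
    show "int q dvd int q1 ^ s" using q1(1) by (metis int_dvd_int_iff of_nat_power)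
  qed (use P0 N0 W in auto)
  have P2: "(real_of_int P)\<^sup>2 > 0" using P0 by simp
  have "(of_int P)\<^sup>2 * cmod (kloosterman_sum q a b c N)
      \<le> (of_int P)\<^sup>2 * (of_int N * exp (- 2 * \<Gamma>) + 2 * (real q1 * (of_int P)\<^sup>2))"
    using main by (simp add: algebra_simps power2_eq_square power4_eq_xxxx)
  then have "cmod (kloosterman_sum q a b c N) \<le> of_int N * exp (- 2 * \<Gamma>) + 2 * (real q1 * (of_int P)\<^sup>2)"
    using P2 by (simp only: mult_le_cancel_left_pos)
  also have "\<dots> \<le> of_int N * exp (- 2 * \<Gamma>) + 2 * (of_int N * exp (- 3 * \<Gamma>))" using q1N by simp
  also have "\<dots> = of_int N * exp (- \<Gamma>) * (exp (- \<Gamma>) + 2 * exp (- \<Gamma>) * exp (- \<Gamma>))"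
  proof -
    have "exp (- 2 * \<Gamma>) = exp (- \<Gamma>) * exp (- \<Gamma>)" "exp (- 3 * \<Gamma>) = exp (- \<Gamma>) * exp (- \<Gamma>) * exp (- \<Gamma>)"
      by (simp_all flip: exp_add)
    then show ?thesis by (simp add: algebra_simps)
  qed
  \<comment> \<open>The exponents \<open>2 * \<Gamma>\<close> and \<open>3 * \<Gamma>\<close> were
    aimed at so that one factor \<open>exp (- \<Gamma>)\<close> is left to absorb constants: with
    \<open>y = exp (- \<Gamma>) < 1 / 2\<close>, the bracket \<open>y + 2 * y ^ 2\<close> is below
    \<open>1\<close>.\<close>
  also have "\<dots> < of_int N * exp (- \<Gamma>) * 1"
  proof (rule mult_strict_left_mono)
    have "exp (- \<Gamma>) \<le> exp (- 1)" using \<Gamma>1 by simp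
    also have "exp (- 1) < 1 / (2 :: real)"
    proof -
      have "exp (1 :: real) > 2" using exp_lower_Taylor_quadratic[of "1 :: real"] by simp
      then show ?thesis by (simp add: exp_minus field_simps)
    qed
    finally have E: "exp (- \<Gamma>) < 1 / 2" .
    have "2 * exp (- \<Gamma>) * exp (- \<Gamma>) \<le> 1 * exp (- \<Gamma>)" using E by (intro mult_right_mono) auto
    then show "exp (- \<Gamma>) + 2 * exp (- \<Gamma>) * exp (- \<Gamma>) < 1" using E by linarith
  qed (use N0 in simp)
  finally show ?thesis using \<Gamma> by simp
qed

theorem theorem2:
  fixes \<delta> :: real
  assumes "0 < \<delta>" and "\<delta> < 0.1"
  shows "\<exists>q0 :: nat. \<forall>q \<ge> q0. \<forall>N :: int.
           max (real (squarefree_kernel q) powr (2 + \<delta>)) (exp (gamma1 \<delta> * ln (real q) powr (2 / 3)))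
               \<le> real_of_int N \<and>
           real_of_int N \<le> real q powr (\<delta> / 20) \<longrightarrow>
           (\<forall>a b c :: int. coprime a (int q) \<longrightarrow>
              cmod (kloosterman_sum q a b c N) <
                real_of_int N * exp (- gamma0 \<delta> * (ln (real_of_int N) ^ 3 / ln (real q) ^ 2)))"
  using assms kloosterman_sum_small[of \<delta>] by (intro exI[of _ 3]) auto

end
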